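(* (Decidability of synthesis for right continuous signals.) Given an $\mathit{MSO}[<]$ formula $\Psi(X,Y)$ (with $X$ ranging over signals over a finite input alphabet $\Sigma_{in}$ and $Y$ over signals over a finite output alphabet $\Sigma_{out}$), it is decidable whether there exists a C-operator $F$ from right continuous $\Sigma_{in}$-signals to right continuous $\Sigma_{out}$-signals such that $\mathit{Rsig}\models \forall X.\ \Psi(X,F(X))$.
   Context: A right continuous signal over a finite set $\Sigma$ is a function $f:\mathbb{R}^{\geq 0}\to\Sigma$ for which there is an unbounded strictly increasing sequence $0=\tau_0<\tau_1<\cdots$ of reals such that $f$ is constant on every half-open interval $[\tau_i,\tau_{i+1})$; signals over a finite $\Sigma$ are coded in the standard way by tuples of boolean signals. $\mathit{MSO}[<]$ is monadic second-order logic with atomic formulas $t<v$ and $X(t)$, boolean connectives, and first- and second-order quantifiers. $\mathit{Rsig}$ is the structure in which first-order variables range over $\mathbb{R}^{\geq 0}$ with its usual order and monadic second-order variables range over right continuous boolean signals. An operator $F$ (a function from signals to signals) is a C-operator if for every $t\geq 0$ and all input signals $X_1,X_2$ that agree on $[0,t]$, $F(X_1)(t)=F(X_2)(t)$. *)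

theory Defs
  imports Complex_Main "HOL-Library.FuncSet" "HOL-Library.Nat_Bijection"
begin

section \<open>Right continuous signals and C-operators\<close>

text \<open>
  A function on the nonnegative reals is represented by an extensional function on
  \<open>{0..}\<close>, so that equality of signals is equality of terms.
\<close>

definition signals :: "'a set \<Rightarrow> (real \<Rightarrow> 'a) set" where
  "signals \<Sigma> = {f \<in> {0..} \<rightarrow>\<^sub>E \<Sigma>. \<exists>\<tau>::nat \<Rightarrow> real. \<tau> 0 = 0 \<and> strict_mono \<tau> \<and>
      \<not> bdd_above (range \<tau>) \<and> (\<forall>i. \<exists>a. \<forall>t\<in>{\<tau> i..<\<tau> (Suc i)}. f t = a)}"

definition C_operator ::
    "'a set \<Rightarrow> 'b set \<Rightarrow> ((real \<Rightarrow> 'a) \<Rightarrow> (real \<Rightarrow> 'b)) \<Rightarrow> bool" where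
  "C_operator \<Sigma> \<Delta> F \<longleftrightarrow> F \<in> signals \<Sigma> \<rightarrow> signals \<Delta> \<and>
     (\<forall>t\<ge>0. \<forall>X\<^sub>1\<in>signals \<Sigma>. \<forall>X\<^sub>2\<in>signals \<Sigma>.
        (\<forall>s\<in>{0..t}. X\<^sub>1 s = X\<^sub>2 s) \<longrightarrow> F X\<^sub>1 t = F X\<^sub>2 t)"


section \<open>Monadic second-order logic of order over the structure Rsig\<close>

text \<open>
  First- and second-order variables are two disjoint families, each indexed by \<open>nat\<close>.
  \<open>Less x y\<close> is the atom \<open>x < y\<close>, and \<open>Pred X x\<close> is the atom \<open>X(x)\<close>.
\<close>

datatype mso =
    Less nat nat
  | Pred nat nat
  | Neg mso
  | Conj mso mso
  | Disj mso mso
  | Ex1 nat mso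
  | All1 nat mso
  | Ex2 nat mso
  | All2 nat mso

primrec free1 :: "mso \<Rightarrow> nat set" where
  "free1 (Less x y) = {x, y}"
| "free1 (Pred X x) = {x}"
| "free1 (Neg \<phi>) = free1 \<phi>"
| "free1 (Conj \<phi> \<psi>) = free1 \<phi> \<union> free1 \<psi>"
| "free1 (Disj \<phi> \<psi>) = free1 \<phi> \<union> free1 \<psi>"
| "free1 (Ex1 x \<phi>) = free1 \<phi> - {x}"
| "free1 (All1 x \<phi>) = free1 \<phi> - {x}"
| "free1 (Ex2 X \<phi>) = free1 \<phi>"
| "free1 (All2 X \<phi>) = free1 \<phi>"

primrec free2 :: "mso \<Rightarrow> nat set" where
  "free2 (Less x y) = {}"
| "free2 (Pred X x) = {X}"
| "free2 (Neg \<phi>) = free2 \<phi>"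
| "free2 (Conj \<phi> \<psi>) = free2 \<phi> \<union> free2 \<psi>"
| "free2 (Disj \<phi> \<psi>) = free2 \<phi> \<union> free2 \<psi>"
| "free2 (Ex1 x \<phi>) = free2 \<phi>"
| "free2 (All1 x \<phi>) = free2 \<phi>"
| "free2 (Ex2 X \<phi>) = free2 \<phi> - {X}"
| "free2 (All2 X \<phi>) = free2 \<phi> - {X}"

primrec Rsig_sat :: "(nat \<Rightarrow> real) \<Rightarrow> (nat \<Rightarrow> real \<Rightarrow> bool) \<Rightarrow> mso \<Rightarrow> bool" where
  "Rsig_sat v V (Less x y) \<longleftrightarrow> v x < v y"
| "Rsig_sat v V (Pred X x) \<longleftrightarrow> V X (v x)"
| "Rsig_sat v V (Neg \<phi>) \<longleftrightarrow> \<not> Rsig_sat v V \<phi>"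
| "Rsig_sat v V (Conj \<phi> \<psi>) \<longleftrightarrow> Rsig_sat v V \<phi> \<and> Rsig_sat v V \<psi>"
| "Rsig_sat v V (Disj \<phi> \<psi>) \<longleftrightarrow> Rsig_sat v V \<phi> \<or> Rsig_sat v V \<psi>"
| "Rsig_sat v V (Ex1 x \<phi>) \<longleftrightarrow> (\<exists>t\<in>{0..}. Rsig_sat (v(x := t)) V \<phi>)"
| "Rsig_sat v V (All1 x \<phi>) \<longleftrightarrow> (\<forall>t\<in>{0..}. Rsig_sat (v(x := t)) V \<phi>)"
| "Rsig_sat v V (Ex2 X \<phi>) \<longleftrightarrow> (\<exists>S\<in>signals UNIV. Rsig_sat v (V(X := S)) \<phi>)"
| "Rsig_sat v V (All2 X \<phi>) \<longleftrightarrow> (\<forall>S\<in>signals UNIV. Rsig_sat v (V(X := S)) \<phi>)"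


section \<open>Coding signals over a finite alphabet by tuples of boolean signals\<close>

text \<open>
  A finite alphabet is presented by the list \<open>C\<close> of the code words of its letters: the
  letters are the numbers \<open>a < length C\<close>, and letter \<open>a\<close> is coded by the bit vector \<open>C ! a\<close>.
  Any injective coding by bit vectors of a fixed width (binary, one-hot, or the identity on
  \<open>{0,1}\<^sup>m\<close>) is an instance.
\<close>

definition is_coding :: "bool list list \<Rightarrow> bool" where
  "is_coding C \<longleftrightarrow> C \<noteq> [] \<and> distinct C \<and> (\<forall>w\<in>set C. length w = length (hd C))"

definition width :: "bool list list \<Rightarrow> nat" where
  "width C = length (hd C)"

definition alphabet :: "bool list list \<Rightarrow> nat set" where
  "alphabet C = {..<length C}"

definition component :: "bool list list \<Rightarrow> (real \<Rightarrow> nat) \<Rightarrow> nat \<Rightarrow> (real \<Rightarrow> bool)" where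
  "component C f i = (\<lambda>t\<in>{0..}. C ! f t ! i)"

text \<open>
  In a formula \<open>\<Psi>(X,Y)\<close> the second-order variables \<open>0, \<dots>, width Cin - 1\<close> stand for the
  components of \<open>X\<close>, and the next \<open>width Cout\<close> ones for the components of \<open>Y\<close>.
\<close>

definition spec_formula :: "bool list list \<Rightarrow> bool list list \<Rightarrow> mso \<Rightarrow> bool" where
  "spec_formula Cin Cout \<Psi> \<longleftrightarrow> free1 \<Psi> = {} \<and> free2 \<Psi> \<subseteq> {..<width Cin + width Cout}"

text \<open>
  The values given here to first-order variables, and to second-order variables with index at
  least \<open>width Cin + width Cout\<close>, are irrelevant for formulas satisfying \<open>spec_formula\<close>.
\<close>

definition Rsig_models ::
    "bool list list \<Rightarrow> bool list list \<Rightarrow> mso \<Rightarrow> (real \<Rightarrow> nat) \<Rightarrow> (real \<Rightarrow> nat) \<Rightarrow> bool" where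
  "Rsig_models Cin Cout \<Psi> X Y \<longleftrightarrow>
     Rsig_sat (\<lambda>_. 0)
       (\<lambda>i. if i < width Cin then component Cin X i
            else if i < width Cin + width Cout then component Cout Y (i - width Cin)
            else (\<lambda>t\<in>{0..}. False)) \<Psi>"


section \<open>Decidability\<close>

text \<open>
  Partial recursive functions: \<open>rec_computes f xs y\<close> means that \<open>f\<close> is defined on the
  arguments \<open>xs\<close> with value \<open>y\<close>.  The recursion argument of \<open>PrimRec\<close> and the search
  argument of \<open>Mu\<close> come first.
\<close>

datatype recfn =
    Zero
  | Succ
  | Proj nat
  | Comp recfn "recfn list"
  | PrimRec recfn recfn
  | Mu recfn

inductive rec_computes :: "recfn \<Rightarrow> nat list \<Rightarrow> nat \<Rightarrow> bool" where
  Zero: "rec_computes Zero xs 0"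
| Succ: "rec_computes Succ [x] (Suc x)"
| Proj: "i < length xs \<Longrightarrow> rec_computes (Proj i) xs (xs ! i)"
| Comp: "list_all2 (\<lambda>g y. rec_computes g xs y) gs ys \<Longrightarrow> rec_computes f ys z \<Longrightarrow>
         rec_computes (Comp f gs) xs z"
| PrimRec_0: "rec_computes f xs y \<Longrightarrow> rec_computes (PrimRec f g) (0 # xs) y"
| PrimRec_Suc: "rec_computes (PrimRec f g) (n # xs) r \<Longrightarrow> rec_computes g (n # r # xs) y \<Longrightarrow>
         rec_computes (PrimRec f g) (Suc n # xs) y"
| Mu: "rec_computes f (n # xs) 0 \<Longrightarrow> (\<And>m. m < n \<Longrightarrow> \<exists>y. rec_computes f (m # xs) (Suc y)) \<Longrightarrow>
         rec_computes (Mu f) xs n"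

definition decidable :: "nat set \<Rightarrow> bool" where
  "decidable A \<longleftrightarrow> (\<exists>f. \<forall>n. rec_computes f [n] (if n \<in> A then 1 else 0))"

primrec mso_encode :: "mso \<Rightarrow> nat" where
  "mso_encode (Less x y) = prod_encode (0, prod_encode (x, y))"
| "mso_encode (Pred X x) = prod_encode (1, prod_encode (X, x))"
| "mso_encode (Neg \<phi>) = prod_encode (2, mso_encode \<phi>)"
| "mso_encode (Conj \<phi> \<psi>) = prod_encode (3, prod_encode (mso_encode \<phi>, mso_encode \<psi>))"
| "mso_encode (Disj \<phi> \<psi>) = prod_encode (4, prod_encode (mso_encode \<phi>, mso_encode \<psi>))"
| "mso_encode (Ex1 x \<phi>) = prod_encode (5, prod_encode (x, mso_encode \<phi>))"
| "mso_encode (All1 x \<phi>) = prod_encode (6, prod_encode (x, mso_encode \<phi>))"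
| "mso_encode (Ex2 X \<phi>) = prod_encode (7, prod_encode (X, mso_encode \<phi>))"
| "mso_encode (All2 X \<phi>) = prod_encode (8, prod_encode (X, mso_encode \<phi>))"

definition coding_encode :: "bool list list \<Rightarrow> nat" where
  "coding_encode C = list_encode (map (\<lambda>w. list_encode (map of_bool w)) C)"

definition instance_encode :: "bool list list \<Rightarrow> bool list list \<Rightarrow> mso \<Rightarrow> nat" where
  "instance_encode Cin Cout \<Psi> =
     prod_encode (coding_encode Cin, prod_encode (coding_encode Cout, mso_encode \<Psi>))"

inductive_cases rec_computes_ZeroE: "rec_computes Zero xs y"
inductive_cases rec_computes_SuccE: "rec_computes Succ xs y"
inductive_cases rec_computes_ProjE: "rec_computes (Proj i) xs y"
inductive_cases rec_computes_CompE: "rec_computes (Comp f gs) xs y"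
inductive_cases rec_computes_PrimRec_0E: "rec_computes (PrimRec f g) (0 # xs) y"
inductive_cases rec_computes_PrimRec_SucE: "rec_computes (PrimRec f g) (Suc n # xs) y"
inductive_cases rec_computes_MuE: "rec_computes (Mu f) xs y"

lemma rec_computes_unique:
  "rec_computes f xs y \<Longrightarrow> rec_computes f xs z \<Longrightarrow> z = y"
proof (induction arbitrary: z rule: rec_computes.induct)
  case (Zero xs)
  then show ?case by (rule rec_computes_ZeroE)
next
  case (Succ x)
  then show ?case by (rule rec_computes_SuccE) simp
next
  case (Proj i xs)
  from Proj.prems show ?case by (rule rec_computes_ProjE)
next
  case (Comp xs gs ys f z')
  from Comp.prems obtain ys' where
    ys': "list_all2 (\<lambda>g y. rec_computes g xs y) gs ys'" "rec_computes f ys' z"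
    by (rule rec_computes_CompE)
  have "ys' = ys"
  proof (rule nth_equalityI)
    show "length ys' = length ys"
      using Comp.IH(1) ys'(1) by (simp add: list_all2_conv_all_nth)
    show "ys' ! i = ys ! i" if "i < length ys'" for i
      using Comp.IH(1) ys'(1) that by (simp add: list_all2_conv_all_nth)
  qed
  with ys' Comp.IH(2) show ?case by blast
next
  case (PrimRec_0 f xs y g)
  from PrimRec_0.prems have "rec_computes f xs z"
    by (rule rec_computes_PrimRec_0E)
  then show ?case by (rule PrimRec_0.IH)
next
  case (PrimRec_Suc f g n xs r y)
  from PrimRec_Suc.prems obtain r' where
    "rec_computes (PrimRec f g) (n # xs) r'" "rec_computes g (n # r' # xs) z"
    by (rule rec_computes_PrimRec_SucE)
  with PrimRec_Suc.IH show ?case by blast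
next
  case (Mu f n xs)
  from Mu.prems have z: "rec_computes f (z # xs) 0"
    "\<And>m. m < z \<Longrightarrow> \<exists>y. rec_computes f (m # xs) (Suc y)"
    by (blast elim: rec_computes_MuE)+
  show ?case
  proof (rule linorder_cases[of z n])
    assume "z < n"
    then obtain y where "\<And>w. rec_computes f (z # xs) w \<Longrightarrow> w = Suc y"
      using Mu.IH(2) by blast
    with z(1) show ?thesis by fastforce
  next
    assume "n < z"
    then obtain y where "rec_computes f (n # xs) (Suc y)"
      using z(2) by blast
    from Mu.IH(1)[OF this] show ?thesis by simp
  qed
qed

lemma mso_encode_inject: "mso_encode \<phi> = mso_encode \<psi> \<longleftrightarrow> \<phi> = \<psi>"
proof
  show "mso_encode \<phi> = mso_encode \<psi> \<Longrightarrow> \<phi> = \<psi>"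
    by (induction \<phi> arbitrary: \<psi>; case_tac \<psi>; simp)
qed simp

lemma coding_encode_inject: "coding_encode C = coding_encode D \<longleftrightarrow> C = D"
proof -
  have "inj (of_bool :: bool \<Rightarrow> nat)"
    by (rule injI) (simp add: of_bool_def split: if_splits)
  then have "inj (\<lambda>w. list_encode (map of_bool w) :: nat)"
    by (simp add: inj_def list_encode_eq inj_map_eq_map)
  then show ?thesis
    by (simp add: coding_encode_def list_encode_eq inj_map_eq_map)
qed

lemma instance_encode_inject:
  "instance_encode Cin Cout \<Psi> = instance_encode Cin' Cout' \<Psi>' \<longleftrightarrow>
     Cin = Cin' \<and> Cout = Cout' \<and> \<Psi> = \<Psi>'"
  by (simp add: instance_encode_def mso_encode_inject coding_encode_inject)

end

theory Submission
  imports Defs "HOL-Library.Ramsey" "HOL-Library.Countable_Set"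
begin

text \<open>
  Over right continuous signals, the truth of a formula on a half-open interval is captured by an element of a
  finite semigroup in which the value of a constant piece is idempotent, and the truth on the whole half line by
  a linked pair \<open>(s, e)\<close> with value \<open>s e e e \<dots>\<close>; second-order quantification corresponds to passing to sets of
  elements.

  A C-operator exists iff the output player wins the following discrete game. In every round the input
  player names a letter and the output player answers with a letter and possibly the request of a checkpoint, which
  is passed if the input does not change in the next round. The output player has to satisfy the formula if
  infinitely many checkpoints are passed; otherwise he wins iff the input changes infinitely often.
  Checkpoints are needed because a signal changes finitely often in a bounded time: an operator that retries
  a spontaneous change of the output after shorter and shorter delays cannot be interrupted forever.

  The winning condition of the game is given by a finite semigroup. Following the classes of positions of a play
  that have the same value up to now, ordered by age, turns it into a parity condition, so that one of the players wins
  with finite memory. Such a strategy has a finite certificate, whose validity is checked on linked pairs.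
  The decision procedure searches for a certificate of either player.
\<close>

section \<open>Computable functions\<close>

definition nary_computable :: "nat \<Rightarrow> (nat list \<Rightarrow> nat) \<Rightarrow> bool" where
  "nary_computable k f \<longleftrightarrow> (\<exists>r. \<forall>xs. length xs = k \<longrightarrow> rec_computes r xs (f xs))"

lemma nary_computable_cong:
  "nary_computable k f \<Longrightarrow> (\<And>xs. length xs = k \<Longrightarrow> f xs = g xs) \<Longrightarrow> nary_computable k g"
  unfolding nary_computable_def by force

lemma nary_computable_zero: "nary_computable k (\<lambda>xs. 0)"
  unfolding nary_computable_def using rec_computes.Zero by blast

lemma nary_computable_nth: "i < k \<Longrightarrow> nary_computable k (\<lambda>xs. xs ! i)"
  unfolding nary_computable_def using rec_computes.Proj by blast

lemma nary_computable_compose: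
  assumes g: "nary_computable (length fs) g" and fs: "\<forall>f\<in>set fs. nary_computable k f"
  shows "nary_computable k (\<lambda>xs. g (map (\<lambda>f. f xs) fs))"
proof -
  obtain G where G: "\<And>xs. length xs = length fs \<Longrightarrow> rec_computes G xs (g xs)"
    using g unfolding nary_computable_def by blast
  obtain H where H: "\<And>f xs. f \<in> set fs \<Longrightarrow> length xs = k \<Longrightarrow> rec_computes (H f) xs (f xs)"
    using fs unfolding nary_computable_def by metis
  have "rec_computes (Comp G (map H fs)) xs (g (map (\<lambda>f. f xs) fs))" if "length xs = k" for xs
    by (rule rec_computes.Comp[where ys = "map (\<lambda>f. f xs) fs"])
      (use that G H in \<open>auto simp: list_all2_conv_all_nth\<close>)
  then show ?thesis unfolding nary_computable_def by blast
qed

lemma nary_computable_compose1: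
  assumes "nary_computable (Suc 0) (\<lambda>ys. g (ys ! 0))" "nary_computable k f"
  shows "nary_computable k (\<lambda>xs. g (f xs))"
  using nary_computable_compose[of "[f]" "\<lambda>ys. g (ys ! 0)" k] assms by simp

lemma nary_computable_compose2:
  assumes "nary_computable (Suc (Suc 0)) (\<lambda>ys. g (ys ! 0) (ys ! 1))" "nary_computable k f\<^sub>1"
    "nary_computable k f\<^sub>2"
  shows "nary_computable k (\<lambda>xs. g (f\<^sub>1 xs) (f\<^sub>2 xs))"
  using nary_computable_compose[of "[f\<^sub>1, f\<^sub>2]" "\<lambda>ys. g (ys ! 0) (ys ! 1)" k] assms by simp

lemma nary_computable_Suc:
  assumes "nary_computable k f" shows "nary_computable k (\<lambda>xs. Suc (f xs))"
proof (rule nary_computable_compose1[OF _ assms])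
  have "rec_computes Succ xs (Suc (xs ! 0))" if "length xs = Suc 0" for xs
    using that by (cases xs) (auto intro: rec_computes.Succ)
  then show "nary_computable (Suc 0) (\<lambda>ys. Suc (ys ! 0))" unfolding nary_computable_def by blast
qed

lemma nary_computable_const: "nary_computable k (\<lambda>xs. c)"
  by (induction c) (auto intro: nary_computable_zero nary_computable_Suc)

lemma nary_computable_rec_nat:
  assumes b: "nary_computable k b" and s: "nary_computable (Suc (Suc k)) s"
  shows "nary_computable (Suc k) (\<lambda>ys. rec_nat (b (tl ys)) (\<lambda>i r. s (i # r # tl ys)) (hd ys))"
proof -
  obtain B where B: "\<And>xs. length xs = k \<Longrightarrow> rec_computes B xs (b xs)"
    using b unfolding nary_computable_def by blast
  obtain S where S: "\<And>xs. length xs = Suc (Suc k) \<Longrightarrow> rec_computes S xs (s xs)"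
    using s unfolding nary_computable_def by blast
  have rec: "rec_computes (PrimRec B S) (n # xs) (rec_nat (b xs) (\<lambda>i r. s (i # r # xs)) n)"
    if "length xs = k" for n xs
  proof (induction n)
    case 0
    show ?case using rec_computes.PrimRec_0[OF B[OF that]] by simp
  next
    case (Suc n)
    show ?case using rec_computes.PrimRec_Suc[OF Suc] S that by simp
  qed
  have "rec_computes (PrimRec B S) ys (rec_nat (b (tl ys)) (\<lambda>i r. s (i # r # tl ys)) (hd ys))"
    if "length ys = Suc k" for ys
    using rec[of "tl ys" "hd ys"] that by (cases ys) auto
  then show ?thesis unfolding nary_computable_def by blast
qed

lemma nary_computable_Least_zero:
  assumes f: "nary_computable (Suc k) f" and ex: "\<And>xs. length xs = k \<Longrightarrow> \<exists>n. f (n # xs) = 0"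
  shows "nary_computable k (\<lambda>xs. LEAST n. f (n # xs) = 0)"
proof -
  obtain F where F: "\<And>xs. length xs = Suc k \<Longrightarrow> rec_computes F xs (f xs)"
    using f unfolding nary_computable_def by blast
  have "rec_computes (Mu F) xs (LEAST n. f (n # xs) = 0)" if xs: "length xs = k" for xs
  proof (rule rec_computes.Mu)
    have "f ((LEAST n. f (n # xs) = 0) # xs) = 0" using LeastI_ex[OF ex[OF xs]] .
    then show "rec_computes F ((LEAST n. f (n # xs) = 0) # xs) 0"
      using F[of "(LEAST n. f (n # xs) = 0) # xs"] xs by simp
  next
    fix m assume "m < (LEAST n. f (n # xs) = 0)"
    then have "f (m # xs) \<noteq> 0" using not_less_Least by blast
    then show "\<exists>y. rec_computes F (m # xs) (Suc y)"
      using F[of "m # xs"] xs by (metis length_Cons not0_implies_Suc)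
  qed
  then show ?thesis unfolding nary_computable_def by blast
qed

lemma nary_computable_add:
  assumes "nary_computable k f" "nary_computable k g" shows "nary_computable k (\<lambda>xs. f xs + g xs)"
proof (rule nary_computable_compose2[OF _ assms])
  have "rec_nat b (\<lambda>i r. Suc r) a = a + b" for a b by (induction a) auto
  with nary_computable_rec_nat[of "Suc 0" "\<lambda>xs. xs ! 0" "\<lambda>xs. Suc (xs ! 1)"]
  show "nary_computable (Suc (Suc 0)) (\<lambda>ys. ys ! 0 + ys ! 1)"
    by (fastforce elim!: nary_computable_cong intro: nary_computable_nth nary_computable_Suc
        simp: length_Suc_conv)
qed

lemma nary_computable_pred:
  assumes "nary_computable k f" shows "nary_computable k (\<lambda>xs. f xs - 1)"
proof (rule nary_computable_compose1[OF _ assms])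
  have "rec_nat 0 (\<lambda>i r. i) a = a - 1" for a :: nat by (induction a) auto
  with nary_computable_rec_nat[of 0 "\<lambda>xs. 0" "\<lambda>xs. xs ! 0"]
  show "nary_computable (Suc 0) (\<lambda>ys. ys ! 0 - 1)"
    by (fastforce elim!: nary_computable_cong intro: nary_computable_nth nary_computable_zero
        simp: length_Suc_conv)
qed

lemma nary_computable_diff:
  assumes "nary_computable k f" "nary_computable k g" shows "nary_computable k (\<lambda>xs. f xs - g xs)"
proof (rule nary_computable_compose2[OF _ assms(2,1)])
  have "rec_nat b (\<lambda>i r. r - 1) a = b - a" for a b :: nat by (induction a) auto
  with nary_computable_rec_nat[of "Suc 0" "\<lambda>xs. xs ! 0" "\<lambda>xs. (xs ! 1) - 1"]
  show "nary_computable (Suc (Suc 0)) (\<lambda>ys. ys ! 1 - ys ! 0)"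
    by (fastforce elim!: nary_computable_cong intro: nary_computable_nth nary_computable_pred
        simp: length_Suc_conv)
qed

lemma nary_computable_triangle:
  assumes "nary_computable k f" shows "nary_computable k (\<lambda>xs. triangle (f xs))"
proof (rule nary_computable_compose1[OF _ assms])
  have "rec_nat 0 (\<lambda>i r. r + Suc i) a = triangle a" for a :: nat by (induction a) auto
  with nary_computable_rec_nat[of 0 "\<lambda>xs. 0" "\<lambda>xs. xs ! 1 + Suc (xs ! 0)"]
  show "nary_computable (Suc 0) (\<lambda>ys. triangle (ys ! 0))"
    by (fastforce elim!: nary_computable_cong
        intro: nary_computable_nth nary_computable_zero nary_computable_add nary_computable_Suc
        simp: length_Suc_conv)
qed

subsection \<open>Pairing\<close>

abbreviation code_pair :: "nat \<Rightarrow> nat \<Rightarrow> nat" (\<open>\<langle>_, _\<rangle>\<close>) where "\<langle>a, b\<rangle> \<equiv> prod_encode (a, b)"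

definition pfst :: "nat \<Rightarrow> nat" where "pfst z = fst (prod_decode z)"
definition psnd :: "nat \<Rightarrow> nat" where "psnd z = snd (prod_decode z)"

lemma pfst_pair [simp]: "pfst \<langle>a, b\<rangle> = a" and psnd_pair [simp]: "psnd \<langle>a, b\<rangle> = b"
  by (simp_all add: pfst_def psnd_def)

lemma pair_pfst_psnd [simp]: "\<langle>pfst z, psnd z\<rangle> = z"
  by (simp add: pfst_def psnd_def)

lemma pair_cases: obtains a b where "z = \<langle>a, b\<rangle>"
  by (metis pair_pfst_psnd)

lemma pfst_le: "pfst z \<le> z" and psnd_le: "psnd z \<le> z"
  using le_prod_encode_1[of "pfst z" "psnd z"] le_prod_encode_2[of "psnd z" "pfst z"] by simp_all

lemma triangle_mono: "m \<le> n \<Longrightarrow> triangle m \<le> triangle n"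
  by (induction n) (auto simp: le_Suc_eq)

lemma pair_mono: "a \<le> a' \<Longrightarrow> b \<le> b' \<Longrightarrow> \<langle>a, b\<rangle> \<le> \<langle>a', b'\<rangle>"
  using triangle_mono[of "a + b" "a' + b'"] by (simp add: prod_encode_def)

lemma less_pair_right: "0 < t \<Longrightarrow> b < \<langle>t, b\<rangle>"
  using triangle_mono[of b "t + b"] by (induction b) (auto simp: prod_encode_def)

lemma nary_computable_pair:
  "nary_computable k f \<Longrightarrow> nary_computable k g \<Longrightarrow> nary_computable k (\<lambda>xs. \<langle>f xs, g xs\<rangle>)"
  by (auto simp: prod_encode_def intro!: nary_computable_add nary_computable_triangle)

definition diagonal :: "nat \<Rightarrow> nat" where
  "diagonal z = (LEAST k. Suc z - triangle (Suc k) = 0)"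

lemma diagonal_pair: "diagonal \<langle>m, n\<rangle> = m + n"
  unfolding diagonal_def
proof (rule Least_equality)
  show "Suc \<langle>m, n\<rangle> - triangle (Suc (m + n)) = 0" by (simp add: prod_encode_def)
  fix k assume "Suc \<langle>m, n\<rangle> - triangle (Suc k) = 0"
  then have "triangle (m + n) < triangle (Suc k)" by (simp add: prod_encode_def)
  then show "m + n \<le> k" by (metis triangle_mono not_less not_less_eq_eq)
qed

lemma nary_computable_diagonal:
  assumes "nary_computable k f" shows "nary_computable k (\<lambda>xs. diagonal (f xs))"
proof (rule nary_computable_compose1[OF _ assms])
  have "\<exists>n. Suc z - triangle (Suc n) = 0" for z
    by (rule exI[of _ z]) (induction z; simp)
  then have "nary_computable (Suc 0)
      (\<lambda>xs. LEAST n. Suc ((n # xs) ! 1) - triangle (Suc ((n # xs) ! 0)) = 0)"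
    by (intro nary_computable_Least_zero nary_computable_diff nary_computable_Suc
        nary_computable_triangle nary_computable_nth) auto
  then show "nary_computable (Suc 0) (\<lambda>ys. diagonal (ys ! 0))"
    unfolding diagonal_def by (auto elim!: nary_computable_cong)
qed

lemma pfst_diagonal: "pfst z = z - triangle (diagonal z)"
  and psnd_diagonal: "psnd z = diagonal z - pfst z"
proof -
  obtain m n where "z = \<langle>m, n\<rangle>" by (rule pair_cases)
  then show "pfst z = z - triangle (diagonal z)" "psnd z = diagonal z - pfst z"
    by (simp_all only: diagonal_pair pfst_pair psnd_pair) (simp_all add: prod_encode_def)
qed

lemma nary_computable_pfst: "nary_computable k f \<Longrightarrow> nary_computable k (\<lambda>xs. pfst (f xs))"
  unfolding pfst_diagonal by (intro nary_computable_diff nary_computable_triangle nary_computable_diagonal)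

lemma nary_computable_psnd: "nary_computable k f \<Longrightarrow> nary_computable k (\<lambda>xs. psnd (f xs))"
  unfolding psnd_diagonal by (intro nary_computable_diff nary_computable_diagonal nary_computable_pfst)

subsection \<open>Unary computable functions and predicates\<close>

text \<open>An environment of several numbers is a single number, the iterated pairing of them; the rules
  for binders below extend the environment by one component.\<close>

definition computable :: "(nat \<Rightarrow> nat) \<Rightarrow> bool" where
  "computable f \<longleftrightarrow> nary_computable (Suc 0) (\<lambda>xs. f (xs ! 0))"

definition computable_pred :: "(nat \<Rightarrow> bool) \<Rightarrow> bool" where
  "computable_pred P \<longleftrightarrow> computable (\<lambda>x. of_bool (P x))"

named_theorems computable_intros

lemma decidable_if_computable_pred: "computable_pred (\<lambda>n. n \<in> A) \<Longrightarrow> decidable A"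
  unfolding computable_pred_def computable_def nary_computable_def decidable_def of_bool_def
  by (metis length_Cons list.size(3) nth_Cons_0)

lemma computable_compose: "computable g \<Longrightarrow> computable f \<Longrightarrow> computable (\<lambda>x. g (f x))"
  unfolding computable_def by (rule nary_computable_compose1)

lemma computable_pred_compose: "computable_pred P \<Longrightarrow> computable f \<Longrightarrow> computable_pred (\<lambda>x. P (f x))"
  unfolding computable_pred_def by (rule computable_compose)

lemma computable_id [computable_intros]: "computable (\<lambda>x. x)"
  unfolding computable_def by (rule nary_computable_nth) simp

lemma computable_const [computable_intros]: "computable (\<lambda>x. c)"
  unfolding computable_def by (rule nary_computable_const)

lemma computable_Suc [computable_intros]: "computable f \<Longrightarrow> computable (\<lambda>x. Suc (f x))"
  unfolding computable_def by (rule nary_computable_Suc)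

lemma computable_pfst [computable_intros]: "computable f \<Longrightarrow> computable (\<lambda>x. pfst (f x))"
  unfolding computable_def by (rule nary_computable_pfst)

lemma computable_psnd [computable_intros]: "computable f \<Longrightarrow> computable (\<lambda>x. psnd (f x))"
  unfolding computable_def by (rule nary_computable_psnd)

lemma computable_pair [computable_intros]:
  "computable f \<Longrightarrow> computable g \<Longrightarrow> computable (\<lambda>x. \<langle>f x, g x\<rangle>)"
  unfolding computable_def by (rule nary_computable_pair)

lemma computable_add [computable_intros]:
  "computable f \<Longrightarrow> computable g \<Longrightarrow> computable (\<lambda>x. f x + g x)"
  unfolding computable_def by (rule nary_computable_add)

lemma computable_diff [computable_intros]:
  "computable f \<Longrightarrow> computable g \<Longrightarrow> computable (\<lambda>x. f x - g x)"
  unfolding computable_def by (rule nary_computable_diff)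

lemma computable_compose2:
  assumes "computable (\<lambda>z. F (pfst z) (psnd z))" "computable f" "computable g"
  shows "computable (\<lambda>x. F (f x) (g x))"
  using computable_compose[OF assms(1) computable_pair[OF assms(2,3)]] by simp

lemma computable_compose3:
  assumes "computable (\<lambda>z. F (pfst z) (pfst (psnd z)) (psnd (psnd z)))"
    and "computable f" "computable g" "computable h"
  shows "computable (\<lambda>x. F (f x) (g x) (h x))"
  using computable_compose2[of "\<lambda>a z. F a (pfst z) (psnd z)", OF assms(1,2) computable_pair[OF assms(3,4)]]
  by simp

lemma computable_pred_compose2:
  assumes "computable_pred (\<lambda>z. P (pfst z) (psnd z))" "computable f" "computable g"
  shows "computable_pred (\<lambda>x. P (f x) (g x))"
  using computable_pred_compose[OF assms(1) computable_pair[OF assms(2,3)]] by simp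

lemma computable_rec_nat [computable_intros]:
  assumes b: "computable b" and s: "computable (\<lambda>z. s (pfst z) (pfst (psnd z)) (psnd (psnd z)))"
    and n: "computable n"
  shows "computable (\<lambda>x. rec_nat (b x) (\<lambda>i r. s x i r) (n x))"
proof -
  have "nary_computable (Suc (Suc (Suc 0))) (\<lambda>ys. s (ys ! 2) (ys ! 0) (ys ! 1))"
    using nary_computable_compose1[OF s[unfolded computable_def], of "Suc (Suc (Suc 0))"
        "\<lambda>ys. \<langle>ys ! 2, \<langle>ys ! 0, ys ! 1\<rangle>\<rangle>"]
    by (simp add: nary_computable_pair nary_computable_nth)
  then have "nary_computable (Suc (Suc 0))
      (\<lambda>ys. rec_nat (b (tl ys ! 0)) (\<lambda>i r. s (tl ys ! 0) i r) (hd ys))"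
    using nary_computable_rec_nat[OF b[unfolded computable_def], of "\<lambda>ys. s (ys ! 2) (ys ! 0) (ys ! 1)"]
    by simp
  then have "nary_computable (Suc (Suc 0)) (\<lambda>ys. rec_nat (b (ys ! 1)) (\<lambda>i r. s (ys ! 1) i r) (ys ! 0))"
    by (rule nary_computable_cong) (auto simp: length_Suc_conv)
  from nary_computable_compose2[OF this n[unfolded computable_def] nary_computable_nth[of 0]]
  show ?thesis unfolding computable_def by simp
qed

lemma computable_funpow:
  assumes "computable F" "computable f" "computable g" shows "computable (\<lambda>x. (F ^^ f x) (g x))"
proof -
  have "computable (\<lambda>x. rec_nat (g x) (\<lambda>i r. F r) (f x))"
    by (intro computable_intros assms computable_compose[OF assms(1)])
  moreover have "rec_nat b (\<lambda>i r. F r) a = (F ^^ a) b" for a b by (induction a) auto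
  ultimately show ?thesis by simp
qed

lemma computable_pred_const [computable_intros]: "computable_pred (\<lambda>x. c)"
  unfolding computable_pred_def by (rule computable_const)

lemma computable_pred_cong: "computable_pred P \<Longrightarrow> (\<And>x. P x \<longleftrightarrow> Q x) \<Longrightarrow> computable_pred Q"
  by (simp add: computable_pred_def)

lemma computable_pred_eq_zero: assumes "computable f" shows "computable_pred (\<lambda>x. f x = 0)"
proof -
  have "(of_bool (f x = 0) :: nat) = 1 - f x" for x by simp
  then show ?thesis
    using computable_diff[OF computable_const[of 1] assms] unfolding computable_pred_def by simp
qed

lemma computable_of_bool [computable_intros]: "computable_pred P \<Longrightarrow> computable (\<lambda>x. of_bool (P x))"
  by (simp add: computable_pred_def)

lemma computable_pred_not [computable_intros]: "computable_pred P \<Longrightarrow> computable_pred (\<lambda>x. \<not> P x)"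
  using computable_pred_eq_zero[OF computable_of_bool, of P] by simp

lemma computable_pred_disj [computable_intros]:
  "computable_pred P \<Longrightarrow> computable_pred Q \<Longrightarrow> computable_pred (\<lambda>x. P x \<or> Q x)"
  using computable_pred_not[OF computable_pred_eq_zero[
      OF computable_add[OF computable_of_bool[of P] computable_of_bool[of Q]]]]
  by simp

lemma computable_pred_conj [computable_intros]:
  "computable_pred P \<Longrightarrow> computable_pred Q \<Longrightarrow> computable_pred (\<lambda>x. P x \<and> Q x)"
  using computable_pred_not[OF computable_pred_disj[OF computable_pred_not[of P] computable_pred_not[of Q]]]
  by simp

lemma computable_pred_imp [computable_intros]:
  "computable_pred P \<Longrightarrow> computable_pred Q \<Longrightarrow> computable_pred (\<lambda>x. P x \<longrightarrow> Q x)"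
  using computable_pred_disj[OF computable_pred_not[of P], of Q] by simp

lemma computable_pred_iff [computable_intros]:
  "computable_pred P \<Longrightarrow> computable_pred Q \<Longrightarrow> computable_pred (\<lambda>x. P x \<longleftrightarrow> Q x)"
  unfolding iff_conv_conj_imp by (intro computable_intros)

lemma computable_pred_le [computable_intros]:
  "computable f \<Longrightarrow> computable g \<Longrightarrow> computable_pred (\<lambda>x. f x \<le> g x)"
  using computable_pred_eq_zero[OF computable_diff[of f g]] by simp

lemma computable_pred_less [computable_intros]:
  "computable f \<Longrightarrow> computable g \<Longrightarrow> computable_pred (\<lambda>x. f x < g x)"
  using computable_pred_not[OF computable_pred_le[of g f]] by (simp add: not_le)

lemma computable_pred_eq [computable_intros]:
  "computable f \<Longrightarrow> computable g \<Longrightarrow> computable_pred (\<lambda>x. f x = g x)"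
  unfolding eq_iff[of "f _"] by (intro computable_intros)

lemma computable_if [computable_intros]:
  assumes "computable_pred P" "computable f" "computable g"
  shows "computable (\<lambda>x. if P x then f x else g x)"
proof -
  have "computable (\<lambda>x. rec_nat (g x) (\<lambda>i r. f x) (of_bool (P x)))"
    by (intro computable_rec_nat assms computable_of_bool computable_compose[OF assms(2)] computable_intros)
  moreover have "rec_nat (g x) (\<lambda>i r. f x) (of_bool (P x)) = (if P x then f x else g x)" for x
    by simp
  ultimately show ?thesis by simp
qed

lemma computable_pred_if [computable_intros]:
  assumes "computable_pred P" "computable_pred Q" "computable_pred R"
  shows "computable_pred (\<lambda>x. if P x then Q x else R x)"
  by (rule computable_pred_cong[of "\<lambda>x. (P x \<longrightarrow> Q x) \<and> (\<not> P x \<longrightarrow> R x)"]) (intro computable_intros assms, auto)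

lemma computable_max [computable_intros]:
  "computable f \<Longrightarrow> computable g \<Longrightarrow> computable (\<lambda>x. max (f x) (g x))"
  unfolding max_def by (intro computable_intros)

lemma computable_mult [computable_intros]:
  assumes "computable f" "computable g" shows "computable (\<lambda>x. f x * g x)"
proof -
  have "computable (\<lambda>x. rec_nat 0 (\<lambda>i r. r + g x) (f x))"
    by (intro computable_intros assms computable_compose[OF assms(2)])
  moreover have "rec_nat 0 (\<lambda>i r. r + b) a = a * b" for a b :: nat by (induction a) auto
  ultimately show ?thesis by simp
qed

lemma computable_power [computable_intros]:
  assumes "computable f" "computable g" shows "computable (\<lambda>x. f x ^ g x)"
proof -
  have "computable (\<lambda>x. rec_nat 1 (\<lambda>i r. r * f x) (g x))"
    by (intro computable_intros assms computable_compose[OF assms(1)])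
  moreover have "rec_nat 1 (\<lambda>i r. r * a) b = a ^ b" for a b :: nat by (induction b) auto
  ultimately show ?thesis by simp
qed

lemma computable_pred_ball_less [computable_intros]:
  assumes "computable f" "computable_pred (\<lambda>z. P (pfst z) (psnd z))"
  shows "computable_pred (\<lambda>x. \<forall>k<f x. P x k)"
proof -
  have P: "computable_pred (\<lambda>z. P (pfst z) (pfst (psnd z)))"
    by (intro computable_intros computable_pred_compose2[of P, OF assms(2)])
  have "computable (\<lambda>x. rec_nat 1 (\<lambda>k r. r * of_bool (P x k)) (f x))"
    by (intro computable_intros assms(1) P)
  moreover have "rec_nat (1::nat) (\<lambda>k r. r * of_bool (P x k)) n = of_bool (\<forall>k<n. P x k)" for x n
    by (induction n) (auto simp: less_Suc_eq)
  ultimately show ?thesis by (simp add: computable_pred_def)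
qed

lemma computable_pred_bex_less [computable_intros]:
  assumes "computable f" "computable_pred (\<lambda>z. P (pfst z) (psnd z))"
  shows "computable_pred (\<lambda>x. \<exists>k<f x. P x k)"
  using computable_pred_not[OF computable_pred_ball_less[OF assms(1) computable_pred_not[OF assms(2)]]]
  by simp

lemma computable_Least [computable_intros]:
  assumes ex: "\<And>x. \<exists>n. P x n" and P: "computable_pred (\<lambda>z. P (pfst z) (psnd z))"
  shows "computable (\<lambda>x. LEAST n. P x n)"
proof -
  have "nary_computable (Suc (Suc 0)) (\<lambda>ys. of_bool (\<not> P (ys ! 1) (ys ! 0)))"
    using nary_computable_compose1[OF computable_pred_not[OF P, unfolded computable_pred_def computable_def],
        of "Suc (Suc 0)" "\<lambda>ys. \<langle>ys ! 1, ys ! 0\<rangle>"]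
    by (simp add: nary_computable_pair nary_computable_nth)
  from nary_computable_Least_zero[OF this] ex
  have "nary_computable (Suc 0) (\<lambda>xs. LEAST n. of_bool (\<not> P ((n # xs) ! 1) ((n # xs) ! 0)) = (0::nat))"
    by simp
  then show ?thesis by (simp add: computable_def)
qed

lemma div_eq_Least: "(x::nat) div y = (LEAST q. y = 0 \<or> x < Suc q * y)"
proof (rule Least_equality[symmetric])
  show "y = 0 \<or> x < Suc (x div y) * y"
    using dividend_less_div_times[of y x] by auto
  fix q assume "y = 0 \<or> x < Suc q * y"
  then show "x div y \<le> q"
    by (metis div_by_0 le0 less_mult_imp_div_less less_Suc_eq_le)
qed

lemma computable_div [computable_intros]:
  assumes "computable f" "computable g" shows "computable (\<lambda>x. f x div g x)"
proof (rule computable_compose2[OF _ assms])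
  have "\<exists>q. y = 0 \<or> x < Suc q * y" for x y :: nat
    by (rule exI[of _ x]) (cases y; simp)
  then show "computable (\<lambda>z. pfst z div psnd z)"
    unfolding div_eq_Least by (intro computable_Least computable_intros)
qed

lemma computable_mod [computable_intros]:
  "computable f \<Longrightarrow> computable g \<Longrightarrow> computable (\<lambda>x. f x mod g x)"
  unfolding modulo_nat_def by (intro computable_intros)

lemma computable_pred_dvd [computable_intros]:
  "computable f \<Longrightarrow> computable g \<Longrightarrow> computable_pred (\<lambda>x. f x dvd g x)"
  unfolding dvd_eq_mod_eq_0 by (intro computable_intros)

lemma computable_pred_set_decode [computable_intros]:
  "computable f \<Longrightarrow> computable g \<Longrightarrow> computable_pred (\<lambda>x. f x \<in> set_decode (g x))"
  unfolding set_decode_def mem_Collect_eq by (intro computable_intros)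

lemma set_decode_power_le: "a \<in> set_decode z \<Longrightarrow> 2 ^ a \<le> z"
  using subset_decode_imp_le[of "2 ^ a" z] set_encode_inverse[of "{a}"] by (simp add: set_encode_def)

lemma set_decode_less: "a \<in> set_decode z \<Longrightarrow> a < z"
  using set_decode_power_le[of a z] less_exp[of a] by linarith

lemma computable_pred_ball_set_decode [computable_intros]:
  assumes "computable f" "computable_pred (\<lambda>z. P (pfst z) (psnd z))"
  shows "computable_pred (\<lambda>x. \<forall>a\<in>set_decode (f x). P x a)"
proof -
  have "computable_pred (\<lambda>x. \<forall>a<f x. a \<in> set_decode (f x) \<longrightarrow> P x a)"
    by (intro computable_intros assms computable_compose[OF assms(1)])
  then show ?thesis by (rule computable_pred_cong) (auto dest: set_decode_less)
qed

lemma computable_pred_bex_set_decode [computable_intros]: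
  assumes "computable f" "computable_pred (\<lambda>z. P (pfst z) (psnd z))"
  shows "computable_pred (\<lambda>x. \<exists>a\<in>set_decode (f x). P x a)"
  using computable_pred_not[OF computable_pred_ball_set_decode[OF assms(1) computable_pred_not[OF assms(2)]]]
  by simp

lemma decidable_if_certified:
  assumes V: "computable_pred V" and A: "A \<subseteq> Collect V"
    and C: "\<And>b. computable_pred (\<lambda>z. C b (pfst z) (psnd z))"
    and complete: "\<And>n. V n \<Longrightarrow> \<exists>b w. C b n w"
    and sound: "\<And>n b w. V n \<Longrightarrow> C b n w \<Longrightarrow> n \<in> A \<longleftrightarrow> b"
  shows "decidable A"
proof (rule decidable_if_computable_pred)
  define w where "w n = (LEAST w. \<not> V n \<or> C True n w \<or> C False n w)" for n
  have ex: "\<exists>w. \<not> V n \<or> C True n w \<or> C False n w" for n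
    using complete[of n] by (metis (full_types))
  have "computable w" unfolding w_def
    by (intro computable_Least ex computable_intros computable_pred_compose[OF V] C)
  then have "computable_pred (\<lambda>n. V n \<and> C True n (w n))"
    by (intro computable_intros V computable_pred_compose2[OF C])
  moreover have "V n \<and> C True n (w n) \<longleftrightarrow> n \<in> A" for n
    using LeastI_ex[OF ex[of n], folded w_def] sound[of n] A by blast
  ultimately show "computable_pred (\<lambda>n. n \<in> A)" by (rule computable_pred_cong)
qed

subsection \<open>Recursion on codes\<close>

definition computable_operator :: "(nat \<Rightarrow> nat \<Rightarrow> (nat \<Rightarrow> nat \<Rightarrow> nat) \<Rightarrow> nat) \<Rightarrow> bool" where
  "computable_operator G \<longleftrightarrow>
     (\<forall>f. computable (\<lambda>z. f (pfst z) (pfst (psnd z)) (psnd (psnd z))) \<longrightarrow>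
       computable (\<lambda>z. G (pfst z) (pfst (psnd z)) (f (psnd (psnd z)))))"

lemma computable_operatorI:
  assumes "\<And>f. (\<And>e c a. computable e \<Longrightarrow> computable c \<Longrightarrow> computable a \<Longrightarrow> computable (\<lambda>x. f (e x) (c x) (a x))) \<Longrightarrow>
    computable (\<lambda>z. G (pfst z) (pfst (psnd z)) (f (psnd (psnd z))))"
  shows "computable_operator G"
  unfolding computable_operator_def using assms computable_compose3 by blast

lemma stack_history:
  fixes T v :: "nat \<Rightarrow> nat"
  assumes "\<And>i. T (Suc i) = \<langle>v i, T i\<rangle>" "j < i"
  shows "pfst ((psnd ^^ (i - Suc j)) (T i)) = v j"
proof -
  have "(psnd ^^ k) (T (k + m)) = T m" for k m
    by (induction k) (simp_all add: assms(1) funpow_Suc_right del: funpow.simps)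
  from this[of "i - Suc j" "Suc j"] show ?thesis using assms by simp
qed

text \<open>The bound \<open>2 ^ N\<close> on the arguments makes room for the sets of numbers below \<open>N\<close>. A pair of a code
  \<open>c\<close> and an argument \<open>a\<close> is looked up in the table of all previous values at position \<open>c * 2 ^ N + a\<close>.\<close>

definition table_lookup :: "nat \<Rightarrow> nat \<Rightarrow> nat \<Rightarrow> nat \<Rightarrow> nat \<Rightarrow> nat" where
  "table_lookup N i t c a =
     (if c < i div 2 ^ N \<and> a < 2 ^ N then pfst ((psnd ^^ (i - Suc (c * 2 ^ N + a))) t) else 0)"

definition table_entry :: "(nat \<Rightarrow> nat \<Rightarrow> (nat \<Rightarrow> nat \<Rightarrow> nat) \<Rightarrow> nat) \<Rightarrow> nat \<Rightarrow> nat \<Rightarrow> nat \<Rightarrow> nat" where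
  "table_entry G N i t = G (i div 2 ^ N) (i mod 2 ^ N) (table_lookup N i t)"

definition table :: "(nat \<Rightarrow> nat \<Rightarrow> (nat \<Rightarrow> nat \<Rightarrow> nat) \<Rightarrow> nat) \<Rightarrow> nat \<Rightarrow> nat \<Rightarrow> nat" where
  "table G N i = rec_nat 0 (\<lambda>i t. \<langle>table_entry G N i t, t\<rangle>) i"

lemma table_entry_eq:
  assumes F: "\<And>c a. c \<le> N \<Longrightarrow> a < 2 ^ N \<Longrightarrow>
      F c a = G c a (\<lambda>c' a'. if c' < c \<and> a' < 2 ^ N then F c' a' else 0)"
    and "c \<le> N" "a < 2 ^ N"
  shows "table_entry G N (c * 2 ^ N + a) (table G N (c * 2 ^ N + a)) = F c a"
  using assms(2,3)
proof (induction c arbitrary: a rule: less_induct)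
  case (less c)
  have Suc: "table G N (Suc i) = \<langle>table_entry G N i (table G N i), table G N i\<rangle>" for i
    by (simp add: table_def)
  have "table_lookup N (c * 2 ^ N + a) (table G N (c * 2 ^ N + a)) c' a' = F c' a'"
    if "c' < c" "a' < 2 ^ N" for c' a'
  proof -
    have "Suc c' * 2 ^ N \<le> c * 2 ^ N" using that by (intro mult_le_mono1) simp
    then have "c' * 2 ^ N + a' < c * 2 ^ N + a" using that by simp
    from stack_history[of "table G N", OF Suc this] show ?thesis
      using that less.IH[of c' a'] less.prems by (simp add: table_lookup_def)
  qed
  then have "table_lookup N (c * 2 ^ N + a) (table G N (c * 2 ^ N + a)) =
      (\<lambda>c' a'. if c' < c \<and> a' < 2 ^ N then F c' a' else 0)"
    using less.prems by (auto simp: table_lookup_def fun_eq_iff)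
  then show ?case using F[OF less.prems] less.prems by (simp add: table_entry_def)
qed

lemma computable_table_entry:
  assumes G: "computable_operator G" and "computable f" "computable g" "computable h"
  shows "computable (\<lambda>x. table_entry G (f x) (g x) (h x))"
proof (rule computable_compose3[OF _ assms(2-4)])
  have "computable (\<lambda>z. table_lookup (pfst (pfst z)) (pfst (psnd (pfst z))) (psnd (psnd (pfst z)))
      (pfst (psnd z)) (psnd (psnd z)))"
    unfolding table_lookup_def by (intro computable_intros computable_funpow)
  from G[unfolded computable_operator_def, rule_format,
      of "\<lambda>e. table_lookup (pfst e) (pfst (psnd e)) (psnd (psnd e))", OF this]
  show "computable (\<lambda>z. table_entry G (pfst z) (pfst (psnd z)) (psnd (psnd z)))"
    unfolding table_entry_def
    by (rule computable_compose3[where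
          F = "\<lambda>c a e. G c a (table_lookup (pfst e) (pfst (psnd e)) (psnd (psnd e)))"
          and h = "\<lambda>z. \<langle>pfst z, \<langle>pfst (psnd z), psnd (psnd z)\<rangle>\<rangle>", simplified])
      (intro computable_intros)+
qed

lemma computable_bounded_recursion:
  fixes F :: "nat \<Rightarrow> nat \<Rightarrow> nat"
  assumes G: "computable_operator G"
    and F: "\<And>N c a. c \<le> N \<Longrightarrow> a < 2 ^ N \<Longrightarrow>
      F c a = G c a (\<lambda>c' a'. if c' < c \<and> a' < 2 ^ N then F c' a' else 0)"
    and "computable f" "computable g"
  shows "computable (\<lambda>x. F (f x) (g x))"
proof -
  have "computable (\<lambda>z. table G (pfst z) (psnd z))"
    unfolding table_def by (intro computable_intros computable_table_entry[OF G])
  note table = computable_compose2[of "table G", OF this]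
  define N where "N x = f x + g x" for x
  have "computable (\<lambda>x. table_entry G (N x) (f x * 2 ^ N x + g x) (table G (N x) (f x * 2 ^ N x + g x)))"
    unfolding N_def by (intro computable_table_entry[OF G] table computable_intros assms(3,4))
  moreover have "f x \<le> N x \<and> g x < 2 ^ N x" for x
    using less_le_trans[OF less_exp power_increasing[of "g x" "N x" 2]] by (simp add: N_def)
  ultimately show ?thesis using table_entry_eq[of _ F G, OF F] by simp
qed

corollary computable_course_of_values:
  assumes "computable_operator (\<lambda>c _ f. G c (\<lambda>c'. f c' 0))"
    and "\<And>c. F c = G c (\<lambda>c'. if c' < c then F c' else 0)" and "computable f"
  shows "computable (\<lambda>x. F (f x))"
  using computable_bounded_recursion[OF assms(1), where F = "\<lambda>c _. F c", OF _ assms(3) computable_const[of 0]]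
    assms(2) by simp

section \<open>Products in finite semigroups\<close>

subsection \<open>Increasing sequences and the intervals between their members\<close>

definition interval_index :: "(nat \<Rightarrow> 'a::linorder) \<Rightarrow> 'a \<Rightarrow> nat" where
  "interval_index \<tau> t = (LEAST i. t < \<tau> (Suc i))"

lemma interval_index_eq:
  assumes "strict_mono \<tau>" "\<tau> i \<le> t" "t < \<tau> (Suc i)"
  shows "interval_index \<tau> t = i"
  unfolding interval_index_def
proof (rule Least_equality)
  fix j assume "t < \<tau> (Suc j)"
  with assms(2) have "\<tau> i < \<tau> (Suc j)" by simp
  with assms(1) show "i \<le> j" by (simp add: strict_mono_less)
qed (rule assms(3))

lemma interval_index_bounds:
  assumes "\<tau> 0 \<le> t" "t < \<tau> j"
  shows "\<tau> (interval_index \<tau> t) \<le> t" "t < \<tau> (Suc (interval_index \<tau> t))"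
proof -
  obtain i where "j = Suc i" using assms by (cases j) auto
  then show "t < \<tau> (Suc (interval_index \<tau> t))"
    unfolding interval_index_def using assms(2) by (auto intro: LeastI)
  show "\<tau> (interval_index \<tau> t) \<le> t"
  proof (cases "interval_index \<tau> t")
    case (Suc i)
    then have "\<not> t < \<tau> (Suc i)"
      unfolding interval_index_def using not_less_Least[of i "\<lambda>i. t < \<tau> (Suc i)"] by simp
    then show ?thesis by (simp add: Suc)
  qed (simp add: assms(1))
qed

lemma nat_interval_index_bounds:
  fixes \<kappa> :: "nat \<Rightarrow> nat"
  assumes "strict_mono \<kappa>" "\<kappa> 0 \<le> n"
  shows "\<kappa> (interval_index \<kappa> n) \<le> n" "n < \<kappa> (Suc (interval_index \<kappa> n))"
  using interval_index_bounds[of \<kappa> n "Suc n"] assms strict_mono_imp_increasing[OF assms(1), of "Suc n"]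
  by auto

lemma infinite_concat:
  fixes ws :: "nat \<Rightarrow> 'a list"
  assumes ne: "\<And>j. ws j \<noteq> []"
  obtains x \<kappa> where "\<kappa> 0 = 0" "strict_mono \<kappa>" "\<And>j. map x [\<kappa> j..<\<kappa> (Suc j)] = ws j"
proof -
  define \<kappa> where "\<kappa> j = (\<Sum>i<j. length (ws i))" for j
  have \<kappa>_Suc: "\<kappa> (Suc j) = \<kappa> j + length (ws j)" for j by (simp add: \<kappa>_def)
  have mono: "strict_mono \<kappa>" unfolding strict_mono_Suc_iff using ne by (simp add: \<kappa>_Suc)
  define x where "x n = ws (interval_index \<kappa> n) ! (n - \<kappa> (interval_index \<kappa> n))" for n
  have "x (\<kappa> j + i) = ws j ! i" if "i < length (ws j)" for i j
    using interval_index_eq[OF mono, of j "\<kappa> j + i"] that by (simp add: x_def \<kappa>_Suc)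
  then have "map x [\<kappa> j..<\<kappa> (Suc j)] = ws j" for j
    by (intro nth_equalityI) (simp_all add: \<kappa>_Suc)
  with mono show ?thesis using that[of \<kappa> x] by (simp add: \<kappa>_def)
qed

lemma range_subset_if_segments:
  assumes \<kappa>: "\<kappa> 0 = 0" "strict_mono \<kappa>" and seg: "\<And>j. set (map x [\<kappa> j..<\<kappa> (Suc j)]) \<subseteq> H"
  shows "range x \<subseteq> H"
proof
  fix y assume "y \<in> range x"
  then obtain n where n: "y = x n" by blast
  have "x n \<in> set (map x [\<kappa> (interval_index \<kappa> n)..<\<kappa> (Suc (interval_index \<kappa> n))])"
    using nat_interval_index_bounds[OF \<kappa>(2), of n] \<kappa>(1) by simp
  then show "y \<in> H" using seg n by blast
qed

lemma adjacent_if_segments: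
  assumes \<kappa>: "\<kappa> 0 = 0" "strict_mono \<kappa>"
    and seg: "\<And>j. successively P (map x [\<kappa> j..<\<kappa> (Suc j)])"
    and border: "\<And>j. P (x (\<kappa> (Suc j) - 1)) (x (\<kappa> (Suc j)))"
  shows "P (x n) (x (Suc n))"
proof -
  obtain j where j: "\<kappa> j \<le> n" "n < \<kappa> (Suc j)"
    using nat_interval_index_bounds[OF \<kappa>(2), of n] \<kappa>(1) by auto
  show ?thesis
  proof (cases "Suc n < \<kappa> (Suc j)")
    case True
    then show ?thesis using successively_nth[OF seg, of "n - \<kappa> j" j] j by (simp add: Suc_diff_le)
  next
    case False
    then show ?thesis using border[of j] j by (metis Suc_leI diff_Suc_1 le_antisym linorder_not_less)
  qed
qed

subsection \<open>Products of lists and of segments of sequences\<close>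

text \<open>The product of the empty list is a junk value.\<close>

definition list_product :: "('a \<Rightarrow> 'a \<Rightarrow> 'a) \<Rightarrow> 'a list \<Rightarrow> 'a" where
  "list_product m xs = foldl m (hd xs) (tl xs)"

definition segment_product :: "('a \<Rightarrow> 'a \<Rightarrow> 'a) \<Rightarrow> (nat \<Rightarrow> 'a) \<Rightarrow> nat \<Rightarrow> nat \<Rightarrow> 'a" where
  "segment_product m x i j = list_product m (map x [i..<j])"

inductive_set generated :: "('a \<Rightarrow> 'a \<Rightarrow> 'a) \<Rightarrow> 'a set \<Rightarrow> 'a set" for m G where
  base: "g \<in> G \<Longrightarrow> g \<in> generated m G"
| mult: "a \<in> generated m G \<Longrightarrow> b \<in> generated m G \<Longrightarrow> m a b \<in> generated m G"

lemma list_product_single [simp]: "list_product m [x] = x"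
  by (simp add: list_product_def)

lemma list_product_snoc: "xs \<noteq> [] \<Longrightarrow> list_product m (xs @ [x]) = m (list_product m xs) x"
  by (simp add: list_product_def)

lemma segment_product_single [simp]: "segment_product m x i (Suc i) = x i"
  by (simp add: segment_product_def)

lemma segment_product_Suc: "i < j \<Longrightarrow> segment_product m x i (Suc j) = m (segment_product m x i j) (x j)"
  by (simp add: segment_product_def list_product_snoc)

lemma generated_subset:
  assumes "G \<subseteq> C" "\<And>a b. a \<in> C \<Longrightarrow> b \<in> C \<Longrightarrow> m a b \<in> C"
  shows "generated m G \<subseteq> C"
proof
  fix x assume "x \<in> generated m G"
  then show "x \<in> C" by induction (use assms in auto)
qed

lemma list_product_generated:
  "xs \<noteq> [] \<Longrightarrow> set xs \<subseteq> G \<Longrightarrow> list_product m xs \<in> generated m G"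
proof (induction xs rule: rev_induct)
  case (snoc x xs)
  then show ?case by (cases "xs = []") (auto simp: list_product_snoc intro: generated.intros)
qed simp

lemma segment_product_generated: "range x \<subseteq> G \<Longrightarrow> i < j \<Longrightarrow> segment_product m x i j \<in> generated m G"
  unfolding segment_product_def by (intro list_product_generated) auto

primrec lasso :: "'a \<Rightarrow> 'a \<Rightarrow> nat \<Rightarrow> 'a" where
  "lasso s e 0 = s"
| "lasso s e (Suc i) = e"

definition linked_pair :: "('a \<Rightarrow> 'a \<Rightarrow> 'a) \<Rightarrow> 'a \<Rightarrow> 'a \<Rightarrow> bool" where
  "linked_pair m s e \<longleftrightarrow> m s e = s \<and> m e e = e"

definition factorization :: "('a \<Rightarrow> 'a \<Rightarrow> 'a) \<Rightarrow> (nat \<Rightarrow> 'a) \<Rightarrow> (nat \<Rightarrow> nat) \<Rightarrow> 'a \<Rightarrow> 'a \<Rightarrow> bool" where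
  "factorization m x \<rho> s e \<longleftrightarrow> \<rho> 0 = 0 \<and> strict_mono \<rho> \<and>
     (\<forall>i. segment_product m x (\<rho> i) (\<rho> (Suc i)) = lasso s e i) \<and> linked_pair m s e"

context semigroup
begin

lemma list_product_append:
  "xs \<noteq> [] \<Longrightarrow> ys \<noteq> [] \<Longrightarrow>
     list_product (\<^bold>*) (xs @ ys) = list_product (\<^bold>*) xs \<^bold>* list_product (\<^bold>*) ys"
proof (induction ys rule: rev_induct)
  case (snoc y ys)
  then show ?case
    by (cases "ys = []") (simp_all add: list_product_snoc assoc flip: append_assoc)
qed simp

lemma segment_product_split:
  assumes "i < j" "j < k"
  shows "segment_product (\<^bold>*) x i k = segment_product (\<^bold>*) x i j \<^bold>* segment_product (\<^bold>*) x j k"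
proof -
  have "[i..<k] = [i..<j] @ [j..<k]" using assms upt_add_eq_append[of i j "k - j"] by simp
  then show ?thesis using assms by (simp add: segment_product_def list_product_append)
qed

lemma generated_is_list_product:
  "s \<in> generated (\<^bold>*) G \<Longrightarrow> \<exists>xs. xs \<noteq> [] \<and> set xs \<subseteq> G \<and> list_product (\<^bold>*) xs = s"
proof (induction rule: generated.induct)
  case (base g)
  then show ?case by (intro exI[of _ "[g]"]) simp
next
  case (mult a b)
  then obtain xs ys where "xs \<noteq> []" "ys \<noteq> []" "set xs \<subseteq> G" "set ys \<subseteq> G"
    "list_product (\<^bold>*) xs = a" "list_product (\<^bold>*) ys = b" by blast
  then show ?case by (intro exI[of _ "xs @ ys"]) (simp add: list_product_append)
qed

lemma sequence_with_segment_products: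
  fixes e :: "nat \<Rightarrow> 'a"
  assumes "\<And>j. e j \<in> generated (\<^bold>*) G"
  obtains x \<kappa> where "range x \<subseteq> G" "\<kappa> 0 = 0" "strict_mono \<kappa>"
    "\<And>j. segment_product (\<^bold>*) x (\<kappa> j) (\<kappa> (Suc j)) = e j"
proof -
  have "\<exists>xs. xs \<noteq> [] \<and> set xs \<subseteq> G \<and> list_product (\<^bold>*) xs = e j" for j
    using generated_is_list_product[OF assms] .
  then obtain ws where ws: "\<And>j. ws j \<noteq> []" "\<And>j. set (ws j) \<subseteq> G" "\<And>j. list_product (\<^bold>*) (ws j) = e j"
    by metis
  obtain x \<kappa> where \<kappa>: "\<kappa> 0 = 0" "strict_mono \<kappa>" and x: "\<And>j. map x [\<kappa> j..<\<kappa> (Suc j)] = ws j"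
    by (rule infinite_concat[of ws, OF ws(1)]) blast
  show ?thesis
  proof (rule that[OF _ \<kappa>])
    show "range x \<subseteq> G" by (rule range_subset_if_segments[OF \<kappa>]) (simp only: x ws(2))
    show "segment_product (\<^bold>*) x (\<kappa> j) (\<kappa> (Suc j)) = e j" for j
      by (simp only: segment_product_def x ws(3))
  qed
qed

lemma segment_product_segments:
  assumes "strict_mono \<kappa>" "\<And>j. z j = segment_product (\<^bold>*) x (\<kappa> j) (\<kappa> (Suc j))" "i < j"
  shows "segment_product (\<^bold>*) z i j = segment_product (\<^bold>*) x (\<kappa> i) (\<kappa> j)"
  using assms(3)
proof (induction j)
  case (Suc j)
  show ?case
  proof (cases "i = j")
    case False
    with Suc have "i < j" by simp
    moreover from this have "\<kappa> i < \<kappa> j" "\<kappa> j < \<kappa> (Suc j)" using assms(1) by (auto simp: strict_mono_less)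
    ultimately show ?thesis using Suc.IH by (simp add: segment_product_Suc assms(2) segment_product_split)
  qed (use assms(2) in simp)
qed simp

lemma factorization_segments:
  assumes "strict_mono \<kappa>" "\<kappa> 0 = 0" "\<And>j. z j = segment_product (\<^bold>*) x (\<kappa> j) (\<kappa> (Suc j))"
    and "factorization (\<^bold>*) z \<rho> s e"
  shows "factorization (\<^bold>*) x (\<lambda>i. \<kappa> (\<rho> i)) s e"
proof -
  have "strict_mono \<rho>" using assms(4) by (simp add: factorization_def)
  then have "segment_product (\<^bold>*) x (\<kappa> (\<rho> i)) (\<kappa> (\<rho> (Suc i))) = segment_product (\<^bold>*) z (\<rho> i) (\<rho> (Suc i))" for i
    using segment_product_segments[of \<kappa> z x "\<rho> i" "\<rho> (Suc i)"] assms(1,3) by (simp add: strict_mono_less)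
  then show ?thesis
    using assms(1,2,4) by (simp add: factorization_def strict_mono_def)
qed

end

subsection \<open>Factorizations by Ramsey's theorem\<close>

lemma infinite_homogeneous_set:
  fixes c :: "nat \<Rightarrow> nat \<Rightarrow> 'c"
  assumes "finite K" and c: "\<And>i j. i < j \<Longrightarrow> c i j \<in> K"
  obtains Y k where "infinite Y" "\<And>i j. i \<in> Y \<Longrightarrow> j \<in> Y \<Longrightarrow> i < j \<Longrightarrow> c i j = k"
proof -
  obtain f :: "'c \<Rightarrow> nat" and n where f: "f ` K = {i. i < n}" "inj_on f K"
    using finite_imp_inj_to_nat_seg[OF \<open>finite K\<close>] by auto
  define d where "d Z = f (c (Min Z) (Max Z))" for Z
  have d: "d {i, j} = f (c i j)" if "i < j" for i j
    using that by (simp add: d_def min_def max_def)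
  then have "d {i, j} < n" if "i < j" for i j using f(1) c[OF that] that by auto
  then have "\<forall>i\<in>UNIV. \<forall>j\<in>UNIV. i \<noteq> j \<longrightarrow> d {i, j} < n" by (metis insert_commute nat_neq_iff)
  from Ramsey2[OF infinite_UNIV_nat this] obtain Y t where Y: "infinite Y"
    and t: "\<forall>i\<in>Y. \<forall>j\<in>Y. i \<noteq> j \<longrightarrow> d {i, j} = t" by auto
  have "c i j = inv_into K f t" if "i \<in> Y" "j \<in> Y" "i < j" for i j
    using t d[OF that(3)] that inv_into_f_f[OF f(2) c[OF that(3)]] by force
  with Y show ?thesis by (rule that)
qed

locale finite_semigroup = semigroup mul for mul :: "'a \<Rightarrow> 'a \<Rightarrow> 'a" (infixl \<open>\<^bold>*\<close> 70) +
  fixes C :: "'a set"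
  assumes finite_carrier: "finite C" and closed: "a \<in> C \<Longrightarrow> b \<in> C \<Longrightarrow> a \<^bold>* b \<in> C"
begin

lemma generated_subset_carrier: "G \<subseteq> C \<Longrightarrow> generated (\<^bold>*) G \<subseteq> C"
  by (rule generated_subset) (auto intro: closed)

lemma segment_product_carrier: "range x \<subseteq> C \<Longrightarrow> i < j \<Longrightarrow> segment_product (\<^bold>*) x i j \<in> C"
  using segment_product_generated[of x C i j] generated_subset_carrier[of C] by blast

lemma factorization_exists_state:
  assumes x: "range x \<subseteq> C" and Q: "finite Q" "\<And>i. q i \<in> Q"
  obtains \<rho> s e p where "factorization (\<^bold>*) x \<rho> s e" "\<And>i. q (\<rho> (Suc i)) = p"
proof -
  define c where "c i j = (segment_product (\<^bold>*) x i j, q i)" for i j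
  have "c i j \<in> C \<times> Q" if "i < j" for i j
    using segment_product_carrier[OF x that] Q(2) by (simp add: c_def)
  then obtain Y k where Y: "infinite Y" and k: "\<And>i j. i \<in> Y \<Longrightarrow> j \<in> Y \<Longrightarrow> i < j \<Longrightarrow> c i j = k"
    by (rule infinite_homogeneous_set[OF finite_cartesian_product[OF finite_carrier Q(1)], of c]) blast+
  define \<rho> where "\<rho> i = (if i = 0 then 0 else enumerate Y i)" for i
  have Y_less: "enumerate Y i < enumerate Y (Suc i)" for i using Y by (simp add: enumerate_mono)
  have "0 < enumerate Y (Suc 0)" using Y_less[of 0] by linarith
  then have \<rho>: "strict_mono \<rho>" unfolding strict_mono_Suc_iff \<rho>_def using Y_less by simp
  obtain e p where ep: "k = (e, p)" by (cases k)
  have Y_product: "segment_product (\<^bold>*) x i j = e" if "i \<in> Y" "j \<in> Y" "i < j" for i j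
    using k[OF that] ep by (simp add: c_def)
  have Y_state: "q (enumerate Y i) = p" for i
    using k[of "enumerate Y i" "enumerate Y (Suc i)"] Y Y_less ep by (simp add: c_def enumerate_in_set)
  have Y_segment: "segment_product (\<^bold>*) x (enumerate Y i) (enumerate Y j) = e" if "i < j" for i j
    using Y that by (intro Y_product) (simp_all add: enumerate_in_set enumerate_mono)
  have ee: "e \<^bold>* e = e"
    using segment_product_split[OF Y_less Y_less, of x 0] Y_segment[of 0 1] Y_segment[of 1 2] Y_segment[of 0 2]
    by (simp add: numeral_2_eq_2)
  define s where "s = segment_product (\<^bold>*) x 0 (enumerate Y 1)"
  have "s \<^bold>* e = s"
  proof (cases "enumerate Y 0 = 0")
    case True
    then show ?thesis using Y_segment[of 0 1] ee by (simp add: s_def)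
  next
    case False
    then have "s = segment_product (\<^bold>*) x 0 (enumerate Y 0) \<^bold>* e"
      using segment_product_split[OF _ Y_less, of 0 0 x] Y_segment[of 0 1] by (simp add: s_def)
    then show ?thesis by (simp add: assoc ee)
  qed
  moreover have "segment_product (\<^bold>*) x (\<rho> i) (\<rho> (Suc i)) = lasso s e i" for i
    using Y_segment[of i "Suc i"] by (cases i) (simp_all add: \<rho>_def s_def)
  ultimately have "factorization (\<^bold>*) x \<rho> s e"
    using \<rho> ee by (simp add: factorization_def linked_pair_def \<rho>_def)
  then show ?thesis using that[of \<rho> s e p] Y_state by (simp add: \<rho>_def)
qed

lemma factorization_exists:
  assumes "range x \<subseteq> C"
  obtains \<rho> s e where "factorization (\<^bold>*) x \<rho> s e"
  using factorization_exists_state[OF assms, of "{()}" "\<lambda>_. ()"] by auto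

end

section \<open>Right continuous signals\<close>

subsection \<open>Functions with finitely many steps in bounded time\<close>

definition step_on :: "real set \<Rightarrow> (real \<Rightarrow> 'a) \<Rightarrow> bool" where
  "step_on S f \<longleftrightarrow> (\<forall>t\<in>S. \<exists>\<epsilon>>0. \<exists>a. \<forall>s\<in>S \<inter> {t..<t+\<epsilon>}. f s = a) \<and>
     (\<forall>t. \<exists>\<epsilon>>0. \<exists>a. \<forall>s\<in>S \<inter> {t-\<epsilon>..<t}. f s = a)"

lemma step_on_right:
  assumes "step_on S f" "t \<in> S"
  obtains \<epsilon> a where "\<epsilon> > 0" "\<And>s. s \<in> S \<inter> {t..<t+\<epsilon>} \<Longrightarrow> f s = a"
  using assms unfolding step_on_def by meson

lemma step_on_left:
  assumes "step_on S f"
  obtains \<epsilon> a where "\<epsilon> > 0" "\<And>s. s \<in> S \<inter> {t-\<epsilon>..<t} \<Longrightarrow> f s = a"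
  using assms unfolding step_on_def by meson

lemma step_on_const: "step_on S (\<lambda>_. c)"
  unfolding step_on_def using zero_less_one by blast

lemma step_on_cong:
  assumes "step_on S f" "\<And>t. t \<in> S \<Longrightarrow> f t = g t" shows "step_on S g"
proof -
  have "(\<forall>s\<in>S \<inter> T. g s = a) \<longleftrightarrow> (\<forall>s\<in>S \<inter> T. f s = a)" for T a using assms(2) by auto
  with assms(1) show ?thesis unfolding step_on_def by simp
qed

lemma step_on_subset: "step_on S f \<Longrightarrow> T \<subseteq> S \<Longrightarrow> step_on T f"
  unfolding step_on_def by (meson Int_mono order_refl subsetD)

lemma step_on_compose: "step_on S f \<Longrightarrow> step_on S (\<lambda>t. h (f t))"
  unfolding step_on_def by metis

lemma step_on_if_less:
  assumes f: "step_on (S \<inter> {..<m}) f" and g: "step_on (S \<inter> {m..}) g"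
  shows "step_on S (\<lambda>t. if t < m then f t else g t)"
  unfolding step_on_def
proof (intro conjI ballI allI)
  fix t assume t: "t \<in> S"
  show "\<exists>\<epsilon>>0. \<exists>a. \<forall>s\<in>S \<inter> {t..<t+\<epsilon>}. (if s < m then f s else g s) = a"
  proof (cases "t < m")
    case True
    with t have "t \<in> S \<inter> {..<m}" by simp
    then obtain \<epsilon> a where "\<epsilon> > 0" "\<And>s. s \<in> S \<inter> {..<m} \<inter> {t..<t+\<epsilon>} \<Longrightarrow> f s = a"
      using step_on_right[OF f] by blast
    then show ?thesis using True by (intro exI[of _ "min \<epsilon> (m - t)"] conjI exI[of _ a]) auto
  next
    case False
    with t have "t \<in> S \<inter> {m..}" by simp
    then obtain \<epsilon> a where "\<epsilon> > 0" "\<And>s. s \<in> S \<inter> {m..} \<inter> {t..<t+\<epsilon>} \<Longrightarrow> g s = a"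
      using step_on_right[OF g] by blast
    then show ?thesis using False by (intro exI[of _ \<epsilon>] conjI exI[of _ a]) auto
  qed
next
  fix t
  show "\<exists>\<epsilon>>0. \<exists>a. \<forall>s\<in>S \<inter> {t-\<epsilon>..<t}. (if s < m then f s else g s) = a"
  proof (cases "t \<le> m")
    case True
    obtain \<epsilon> a where "\<epsilon> > 0" "\<And>s. s \<in> S \<inter> {..<m} \<inter> {t-\<epsilon>..<t} \<Longrightarrow> f s = a"
      by (rule step_on_left[OF f, of t]) blast
    then show ?thesis using True by (intro exI[of _ \<epsilon>] conjI exI[of _ a]) auto
  next
    case False
    obtain \<epsilon> a where "\<epsilon> > 0" "\<And>s. s \<in> S \<inter> {m..} \<inter> {t-\<epsilon>..<t} \<Longrightarrow> g s = a"
      by (rule step_on_left[OF g, of t]) blast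
    then show ?thesis using False by (intro exI[of _ "min \<epsilon> (t - m)"] conjI exI[of _ a]) auto
  qed
qed

lemma step_on_interval_induct [consumes 2, case_names const join]:
  assumes f: "step_on {u..<v} f" and "u < v"
    and const: "\<And>c d a. u \<le> c \<Longrightarrow> c < d \<Longrightarrow> d \<le> v \<Longrightarrow> (\<And>t. t \<in> {c..<d} \<Longrightarrow> f t = a) \<Longrightarrow> P c d"
    and join: "\<And>c m d. c < m \<Longrightarrow> m < d \<Longrightarrow> P c m \<Longrightarrow> P m d \<Longrightarrow> P c d"
  shows "P u v"
proof -
  let ?P = "\<lambda>c d. u \<le> c \<and> d \<le> v \<and> c < d \<longrightarrow> P c d"
  have "?P u v"
  proof (rule Bolzano[where P = ?P])
    show "u \<le> v" using \<open>u < v\<close> by simp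
    show "?P c d" if "?P c m" "?P m d" "c \<le> m" "m \<le> d" for c m d
    proof (cases "c = m \<or> m = d")
      case False
      then show ?thesis using that join[of c m d] by simp
    qed (use that in auto)
  next
    fix x assume x: "u \<le> x" "x \<le> v"
    obtain \<delta> a where \<delta>: "\<delta> > 0" "\<And>s. s \<in> {u..<v} \<inter> {x-\<delta>..<x} \<Longrightarrow> f s = a"
      by (rule step_on_left[OF f, of x]) blast
    obtain \<epsilon> b where \<epsilon>: "\<epsilon> > 0" "\<And>s. s \<in> {u..<v} \<inter> {x..<x+\<epsilon>} \<Longrightarrow> f s = b"
    proof (cases "x < v")
      case True
      with x have "x \<in> {u..<v}" by simp
      then show ?thesis using step_on_right[OF f] that by blast
    qed (use that[of 1] in auto)
    have "?P c d" if "c \<le> x" "x \<le> d" "d - c < min \<delta> \<epsilon>" for c d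
    proof (intro impI, elim conjE)
      assume cd: "u \<le> c" "d \<le> v" "c < d"
      have left: "P c x" if "c < x"
        by (rule const[of _ _ a]) (use \<open>x \<le> d\<close> \<open>d - c < _\<close> cd that in \<open>auto intro!: \<delta>(2)\<close>)
      have right: "P x d" if "x < d"
        by (rule const[of _ _ b]) (use \<open>c \<le> x\<close> \<open>d - c < _\<close> cd that in \<open>auto intro!: \<epsilon>(2)\<close>)
      consider "c = x" | "x = d" | "c < x" "x < d"
        using \<open>c \<le> x\<close> \<open>x \<le> d\<close> by (auto simp: order_less_le)
      then show "P c d" by cases (use left right cd join[of c x d] in auto)
    qed
    then show "\<exists>e>0. \<forall>c d. c \<le> x \<and> x \<le> d \<and> d - c < e \<longrightarrow> ?P c d"
      using \<delta>(1) \<epsilon>(1) by (intro exI[of _ "min \<delta> \<epsilon>"]) auto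
  qed
  with \<open>u < v\<close> show ?thesis by simp
qed

lemma step_on_eventually_constant:
  fixes \<tau> :: "nat \<Rightarrow> real"
  assumes f: "step_on {0..} f" and \<tau>: "strict_mono \<tau>" "0 \<le> \<tau> 0" "bdd_above (range \<tau>)"
  shows "\<forall>\<^sub>\<infinity>i. f (\<tau> (Suc i)) = f (\<tau> i)"
proof -
  define T where "T = (SUP i. \<tau> i)"
  have less_T: "\<tau> i < T" for i
  proof -
    have "\<tau> i < \<tau> (Suc i)" using \<tau>(1) by (simp add: strict_mono_less)
    also have "\<dots> \<le> T" unfolding T_def using \<tau>(3) by (intro cSUP_upper) auto
    finally show ?thesis .
  qed
  obtain \<epsilon> a where \<epsilon>: "\<epsilon> > 0" "\<And>s. s \<in> {0..} \<inter> {T-\<epsilon>..<T} \<Longrightarrow> f s = a"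
    by (rule step_on_left[OF f, of T]) blast
  obtain N where "T - \<epsilon> < \<tau> N"
    using less_cSUP_iff[of UNIV \<tau> "T - \<epsilon>"] \<tau>(3) \<epsilon>(1) by (auto simp: T_def)
  have "f (\<tau> i) = a" if "N \<le> i" for i
  proof (rule \<epsilon>(2))
    have "\<tau> N \<le> \<tau> i" "\<tau> 0 \<le> \<tau> i" using \<tau>(1) that by (simp_all add: strict_mono_less_eq)
    then show "\<tau> i \<in> {0..} \<inter> {T-\<epsilon>..<T}" using \<open>T - \<epsilon> < \<tau> N\<close> \<tau>(2) less_T[of i] by simp
  qed
  then show ?thesis unfolding MOST_nat_le by (intro exI[of _ N]) simp
qed

subsection \<open>The next change of a function\<close>

definition next_change :: "(real \<Rightarrow> 'a) \<Rightarrow> real \<Rightarrow> real \<Rightarrow> real" where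
  "next_change f t p = Inf ({s. t < s \<and> f s \<noteq> f t} \<union> {p})"

lemma next_change_le: "t < p \<Longrightarrow> next_change f t p \<le> p"
  unfolding next_change_def by (rule cInf_lower) (auto intro!: bdd_belowI[of _ t])

lemma next_change_le_change: "t < p \<Longrightarrow> t < s \<Longrightarrow> f s \<noteq> f t \<Longrightarrow> next_change f t p \<le> s"
  unfolding next_change_def by (rule cInf_lower) (auto intro!: bdd_belowI[of _ t])

lemma le_next_change: "c \<le> p \<Longrightarrow> (\<And>s. t < s \<Longrightarrow> f s \<noteq> f t \<Longrightarrow> c \<le> s) \<Longrightarrow> c \<le> next_change f t p"
  unfolding next_change_def by (rule cInf_greatest) auto

lemma const_before_next_change: "t < p \<Longrightarrow> s \<in> {t..<next_change f t p} \<Longrightarrow> f s = f t"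
  using next_change_le_change[of t p s f] by (cases "s = t") auto

lemma next_change_greater:
  assumes "step_on {0..} f" "0 \<le> t" "t < p"
  shows "t < next_change f t p"
proof -
  have "t \<in> {0..}" using assms(2) by simp
  then obtain \<epsilon> a where \<epsilon>: "\<epsilon> > 0" "\<And>s. s \<in> {0..} \<inter> {t..<t+\<epsilon>} \<Longrightarrow> f s = a"
    using step_on_right[OF assms(1)] by blast
  have "min p (t + \<epsilon>) \<le> next_change f t p"
  proof (rule le_next_change)
    fix s assume "t < s" "f s \<noteq> f t"
    then have "\<not> s < t + \<epsilon>" using \<epsilon>(2)[of s] \<epsilon>(2)[of t] \<epsilon>(1) assms(2) by auto
    then show "min p (t + \<epsilon>) \<le> s" by simp
  qed simp
  then show ?thesis using \<epsilon>(1) assms(3) by linarith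
qed

lemma next_change_neq:
  assumes "step_on {0..} f" "0 \<le> t" "t < p" and less: "next_change f t p < p"
  shows "f (next_change f t p) \<noteq> f t"
proof
  assume eq: "f (next_change f t p) = f t"
  have "next_change f t p \<in> {0..}" using next_change_greater[OF assms(1-3)] assms(2) by simp
  then obtain \<epsilon> a where \<epsilon>: "\<epsilon> > 0"
    "\<And>s. s \<in> {0..} \<inter> {next_change f t p..<next_change f t p+\<epsilon>} \<Longrightarrow> f s = a"
    using step_on_right[OF assms(1)] by blast
  have "min p (next_change f t p + \<epsilon>) \<le> next_change f t p"
  proof (rule le_next_change)
    fix s assume s: "t < s" "f s \<noteq> f t"
    then have "next_change f t p \<le> s" by (rule next_change_le_change[OF assms(3)])
    moreover have "s \<notin> {next_change f t p..<next_change f t p+\<epsilon>}"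
      using \<epsilon>(2)[of s] \<epsilon>(2)[of "next_change f t p"] \<epsilon>(1) s assms(2) eq \<open>next_change f t p \<in> {0..}\<close> by auto
    ultimately show "min p (next_change f t p + \<epsilon>) \<le> s" by simp
  qed simp
  then show False using \<epsilon>(1) less by linarith
qed

lemma next_change_cong:
  assumes agree: "\<And>s. s \<in> {t..<q} \<Longrightarrow> f s = g s" and "t < q" "t < p" "next_change f t p < q"
  shows "next_change g t p = next_change f t p"
proof -
  have le: "next_change g t p \<le> next_change f t p"
    if "next_change f t p < q" "\<And>s. s \<in> {t..<q} \<Longrightarrow> f s = g s" for f g :: "real \<Rightarrow> 'a"
  proof -
    have "min (next_change g t p) q \<le> next_change f t p"
    proof (rule le_next_change)
      show "min (next_change g t p) q \<le> p" using next_change_le[OF assms(3), of g] by simp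
      fix s assume "t < s" "f s \<noteq> f t"
      then show "min (next_change g t p) q \<le> s"
        using that(2)[of s] that(2)[of t] assms(2) next_change_le_change[OF assms(3), of s g]
        by (cases "s < q") auto
    qed
    with that(1) show ?thesis by linarith
  qed
  from le[OF assms(4) agree] le[of g f] assms show ?thesis by fastforce
qed

subsection \<open>Time partitions\<close>

definition time_partition :: "(nat \<Rightarrow> real) \<Rightarrow> bool" where
  "time_partition \<kappa> \<longleftrightarrow> \<kappa> 0 = 0 \<and> strict_mono \<kappa> \<and> \<not> bdd_above (range \<kappa>)"

lemma time_partition_less: "time_partition \<kappa> \<Longrightarrow> i < j \<Longrightarrow> \<kappa> i < \<kappa> j"
  by (simp add: time_partition_def strict_mono_less)

lemma time_partition_nonneg: "time_partition \<kappa> \<Longrightarrow> 0 \<le> \<kappa> i"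
  using strict_mono_leD[of \<kappa> 0 i] by (simp add: time_partition_def)

lemma time_partition_interval:
  assumes "time_partition \<kappa>" "0 \<le> t"
  shows "t \<in> {\<kappa> (interval_index \<kappa> t)..<\<kappa> (Suc (interval_index \<kappa> t))}"
proof -
  obtain j where "t < \<kappa> j" using assms(1) by (auto simp: time_partition_def bdd_above_def not_le)
  then show ?thesis using interval_index_bounds[of \<kappa> t j] assms by (simp add: time_partition_def)
qed

lemma time_partition_subsequence:
  assumes \<kappa>: "time_partition \<kappa>" and \<rho>: "\<rho> 0 = 0" "strict_mono \<rho>"
  shows "time_partition (\<lambda>i. \<kappa> (\<rho> i))"
proof -
  have le: "\<kappa> i \<le> \<kappa> (\<rho> i)" for i
    using \<kappa> strict_mono_imp_increasing[OF \<rho>(2), of i] by (simp add: time_partition_def strict_mono_less_eq)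
  have "\<not> bdd_above (range (\<lambda>i. \<kappa> (\<rho> i)))"
  proof
    assume "bdd_above (range (\<lambda>i. \<kappa> (\<rho> i)))"
    then obtain M where "\<kappa> (\<rho> i) \<le> M" for i by (auto simp: bdd_above_def)
    then have "\<kappa> i \<le> M" for i using le[of i] order_trans by blast
    then show False using \<kappa> bdd_aboveI2[of UNIV \<kappa> M] by (simp add: time_partition_def)
  qed
  then show ?thesis using assms by (simp add: time_partition_def strict_mono_def)
qed

lemma time_partition_real: "time_partition real"
proof -
  have "\<exists>n. M < real n" for M by (rule reals_Archimedean2)
  then show ?thesis by (auto simp: time_partition_def strict_mono_def bdd_above_def not_le)
qed

lemma step_on_time_partition:
  assumes \<kappa>: "time_partition \<kappa>" and f: "\<And>i. step_on {\<kappa> i..<\<kappa> (Suc i)} f"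
  shows "step_on {0..} f"
  unfolding step_on_def
proof (intro conjI ballI allI)
  fix t :: real assume "t \<in> {0..}"
  then obtain i where i: "t \<in> {\<kappa> i..<\<kappa> (Suc i)}" using time_partition_interval[OF \<kappa>] by auto
  obtain \<epsilon> a where "\<epsilon> > 0" "\<And>s. s \<in> {\<kappa> i..<\<kappa> (Suc i)} \<inter> {t..<t+\<epsilon>} \<Longrightarrow> f s = a"
    by (rule step_on_right[OF f i]) blast
  then show "\<exists>\<epsilon>>0. \<exists>a. \<forall>s\<in>{0..} \<inter> {t..<t+\<epsilon>}. f s = a"
    using i by (intro exI[of _ "min \<epsilon> (\<kappa> (Suc i) - t)"] conjI exI[of _ a]) (auto simp: min_def split: if_splits)
next
  fix t :: real
  show "\<exists>\<epsilon>>0. \<exists>a. \<forall>s\<in>{0..} \<inter> {t-\<epsilon>..<t}. f s = a"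
  proof (cases "0 < t")
    case True
    obtain i where i: "\<kappa> i < t" "t \<le> \<kappa> (Suc i)"
    proof -
      define j where "j = interval_index \<kappa> t"
      have j: "\<kappa> j \<le> t" "t < \<kappa> (Suc j)" using time_partition_interval[OF \<kappa>, of t] True by (auto simp: j_def)
      show ?thesis
      proof (cases "\<kappa> j = t")
        case eq: True
        then obtain i where "j = Suc i" using \<kappa> True by (cases j) (auto simp: time_partition_def)
        then show ?thesis using that[of i] eq time_partition_less[OF \<kappa>, of i j] by simp
      qed (use j that[of j] in simp)
    qed
    obtain \<epsilon> a where "\<epsilon> > 0" "\<And>s. s \<in> {\<kappa> i..<\<kappa> (Suc i)} \<inter> {t-\<epsilon>..<t} \<Longrightarrow> f s = a"
      by (rule step_on_left[OF f, of i t]) blast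
    then show ?thesis
      using i by (intro exI[of _ "min \<epsilon> (t - \<kappa> i)"] conjI exI[of _ a]) (auto simp: min_def split: if_splits)
  qed (intro exI[of _ 1], auto)
qed

lemma time_partition_by_changes:
  assumes f: "step_on {0..} f"
  obtains \<tau> where "time_partition \<tau>" "\<And>i t. t \<in> {\<tau> i..<\<tau> (Suc i)} \<Longrightarrow> f t = f (\<tau> i)"
proof -
  define \<tau> where "\<tau> i = ((\<lambda>t. next_change f t (t + 1)) ^^ i) 0" for i :: nat
  have \<tau>_0: "\<tau> 0 = 0" and \<tau>_Suc: "\<tau> (Suc i) = next_change f (\<tau> i) (\<tau> i + 1)" for i
    by (simp_all add: \<tau>_def)
  have pos: "0 \<le> \<tau> i" for i
  proof (induction i)
    case (Suc i)
    then show ?case using next_change_greater[OF f, of "\<tau> i" "\<tau> i + 1"] by (simp add: \<tau>_Suc)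
  qed (simp add: \<tau>_0)
  have mono: "strict_mono \<tau>"
    unfolding strict_mono_Suc_iff using next_change_greater[OF f pos] by (simp add: \<tau>_Suc)
  have "\<not> bdd_above (range \<tau>)"
  proof
    assume bdd: "bdd_above (range \<tau>)"
    obtain N where N: "\<And>i. N \<le> i \<Longrightarrow> f (\<tau> (Suc i)) = f (\<tau> i)"
      using step_on_eventually_constant[OF f mono pos bdd] unfolding MOST_nat_le by blast
    have "\<tau> (Suc i) = \<tau> i + 1" if "N \<le> i" for i
      using next_change_neq[OF f pos, of i "\<tau> i + 1"] N[OF that] next_change_le[of "\<tau> i" "\<tau> i + 1" f]
      by (auto simp: \<tau>_Suc order_less_le)
    then have far: "\<tau> (N + k) = \<tau> N + real k" for k by (induction k) auto
    obtain M where "\<tau> i \<le> M" for i using bdd by (auto simp: bdd_above_def)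
    moreover obtain k :: nat where "M - \<tau> N < real k" using reals_Archimedean2 by blast
    ultimately show False using far[of k] by (smt (verit))
  qed
  with \<tau>_0 mono have "time_partition \<tau>" by (simp add: time_partition_def)
  then show ?thesis
  proof (rule that)
    show "f t = f (\<tau> i)" if "t \<in> {\<tau> i..<\<tau> (Suc i)}" for i t
      using const_before_next_change[of "\<tau> i" "\<tau> i + 1" t f] that by (simp add: \<tau>_Suc)
  qed
qed

lemma signals_iff: "f \<in> signals \<Sigma> \<longleftrightarrow> f \<in> {0..} \<rightarrow>\<^sub>E \<Sigma> \<and> step_on {0..} f"
proof
  assume f: "f \<in> signals \<Sigma>"
  then have "\<exists>\<tau>. time_partition \<tau> \<and> (\<forall>i. \<exists>a. \<forall>t\<in>{\<tau> i..<\<tau> (Suc i)}. f t = a)"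
    by (simp add: signals_def time_partition_def)
  then obtain \<tau> where \<tau>: "time_partition \<tau>" and "\<And>i. \<exists>a. \<forall>t\<in>{\<tau> i..<\<tau> (Suc i)}. f t = a"
    by blast
  then have "step_on {\<tau> i..<\<tau> (Suc i)} f" for i
    by (metis step_on_cong[OF step_on_const])
  then have "step_on {0..} f" by (rule step_on_time_partition[OF \<tau>])
  with f show "f \<in> {0..} \<rightarrow>\<^sub>E \<Sigma> \<and> step_on {0..} f" by (simp add: signals_def)
next
  assume f: "f \<in> {0..} \<rightarrow>\<^sub>E \<Sigma> \<and> step_on {0..} f"
  then obtain \<tau> where "time_partition \<tau>" "\<And>i t. t \<in> {\<tau> i..<\<tau> (Suc i)} \<Longrightarrow> f t = f (\<tau> i)"
    using time_partition_by_changes by blast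
  then have "\<exists>\<tau>. time_partition \<tau> \<and> (\<forall>i. \<exists>a. \<forall>t\<in>{\<tau> i..<\<tau> (Suc i)}. f t = a)" by blast
  with f show "f \<in> signals \<Sigma>" by (simp add: signals_def time_partition_def)
qed

definition glue :: "(nat \<Rightarrow> real) \<Rightarrow> (nat \<Rightarrow> real \<Rightarrow> 'a) \<Rightarrow> real \<Rightarrow> 'a" where
  "glue \<kappa> f = (\<lambda>t\<in>{0..}. f (interval_index \<kappa> t) t)"

lemma glue_eq: "time_partition \<kappa> \<Longrightarrow> t \<in> {\<kappa> i..<\<kappa> (Suc i)} \<Longrightarrow> glue \<kappa> f t = f i t"
  using time_partition_nonneg[of \<kappa> i] interval_index_eq[of \<kappa> i t]
  by (simp add: glue_def time_partition_def)

lemma glue_signal: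
  assumes \<kappa>: "time_partition \<kappa>" and f: "\<And>i. step_on {\<kappa> i..<\<kappa> (Suc i)} (f i)" "\<And>i t. f i t \<in> \<Sigma>"
  shows "glue \<kappa> f \<in> signals \<Sigma>"
proof -
  have "step_on {\<kappa> i..<\<kappa> (Suc i)} (glue \<kappa> f)" for i
    by (rule step_on_cong[OF f(1)]) (simp add: glue_eq[OF \<kappa>])
  then have "step_on {0..} (glue \<kappa> f)" by (rule step_on_time_partition[OF \<kappa>])
  then show ?thesis using f(2) by (auto simp: signals_iff glue_def)
qed

section \<open>Monadic logic of signals and finite semigroups\<close>

subsection \<open>Signal formulas\<close>

text \<open>\<open>First x y z\<close> says that \<open>x \<or> y\<close> holds somewhere and that \<open>z\<close> holds at the first such point.
  A first-order variable becomes a signal variable that stands for the first point at which the signal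
  is true.\<close>

datatype sig_form = First nat nat nat | Nand sig_form sig_form | ExS nat sig_form

primrec free_vars :: "sig_form \<Rightarrow> nat set" where
  "free_vars (First x y z) = {x, y, z}"
| "free_vars (Nand \<phi> \<psi>) = free_vars \<phi> \<union> free_vars \<psi>"
| "free_vars (ExS X \<phi>) = free_vars \<phi> - {X}"

definition first_at :: "(real \<Rightarrow> bool) \<Rightarrow> real \<Rightarrow> bool" where
  "first_at S t \<longleftrightarrow> 0 \<le> t \<and> S t \<and> (\<forall>s. 0 \<le> s \<and> s < t \<longrightarrow> \<not> S s)"

primrec sig_sat :: "(nat \<Rightarrow> real \<Rightarrow> bool) \<Rightarrow> sig_form \<Rightarrow> bool" where
  "sig_sat V (First x y z) \<longleftrightarrow> (\<exists>t. first_at (\<lambda>t. V x t \<or> V y t) t \<and> V z t)"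
| "sig_sat V (Nand \<phi> \<psi>) \<longleftrightarrow> \<not> (sig_sat V \<phi> \<and> sig_sat V \<psi>)"
| "sig_sat V (ExS X \<phi>) \<longleftrightarrow> (\<exists>S\<in>signals UNIV. sig_sat (V(X := S)) \<phi>)"

lemma first_at_unique: "first_at S t \<Longrightarrow> first_at S t' \<Longrightarrow> t = t'"
  unfolding first_at_def by (metis linorder_neqE_linordered_idom)

subsection \<open>The semigroup of a signal formula\<close>

primrec form_mult :: "sig_form \<Rightarrow> nat \<Rightarrow> nat \<Rightarrow> nat" where
  "form_mult (First x y z) = (\<lambda>a b. if a = 0 then b else a)"
| "form_mult (Nand \<phi> \<psi>) =
     (\<lambda>a b. \<langle>form_mult \<phi> (pfst a) (pfst b), form_mult \<psi> (psnd a) (psnd b)\<rangle>)"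
| "form_mult (ExS X \<phi>) =
     (\<lambda>a b. set_encode ((\<lambda>(c, d). form_mult \<phi> c d) ` (set_decode a \<times> set_decode b)))"

primrec form_value :: "sig_form \<Rightarrow> nat set \<Rightarrow> nat" where
  "form_value (First x y z) L = (if x \<in> L \<or> y \<in> L then if z \<in> L then 1 else 2 else 0)"
| "form_value (Nand \<phi> \<psi>) L = \<langle>form_value \<phi> L, form_value \<psi> L\<rangle>"
| "form_value (ExS X \<phi>) L =
     set_encode (generated (form_mult \<phi>) {form_value \<phi> (insert X L), form_value \<phi> (L - {X})})"

primrec form_carrier :: "sig_form \<Rightarrow> nat set" where
  "form_carrier (First x y z) = {0, 1, 2}"
| "form_carrier (Nand \<phi> \<psi>) = prod_encode ` (form_carrier \<phi> \<times> form_carrier \<psi>)"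
| "form_carrier (ExS X \<phi>) = set_encode ` Pow (form_carrier \<phi>)"

primrec form_accepts :: "sig_form \<Rightarrow> nat \<Rightarrow> nat \<Rightarrow> bool" where
  "form_accepts (First x y z) = (\<lambda>s e. s = 1)"
| "form_accepts (Nand \<phi> \<psi>) =
     (\<lambda>s e. \<not> (form_accepts \<phi> (pfst s) (pfst e) \<and> form_accepts \<psi> (psnd s) (psnd e)))"
| "form_accepts (ExS X \<phi>) =
     (\<lambda>s e. \<exists>a\<in>set_decode s. \<exists>b\<in>set_decode e. linked_pair (form_mult \<phi>) a b \<and> form_accepts \<phi> a b)"

lemma finite_form_carrier: "finite (form_carrier \<phi>)"
  by (induction \<phi>) auto

lemma form_mult_assoc: "form_mult \<phi> (form_mult \<phi> a b) c = form_mult \<phi> a (form_mult \<phi> b c)"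
proof (induction \<phi> arbitrary: a b c)
  case (ExS X \<phi>)
  have "(\<lambda>(c, d). form_mult \<phi> c d) ` ((\<lambda>(c, d). form_mult \<phi> c d) ` (A \<times> B) \<times> C) =
    (\<lambda>(c, d). form_mult \<phi> c d) ` (A \<times> (\<lambda>(c, d). form_mult \<phi> c d) ` (B \<times> C))" (is "?L = ?R") for A B C
  proof (intro set_eqI iffI)
    fix x assume "x \<in> ?L"
    then obtain p q r where "x = form_mult \<phi> (form_mult \<phi> p q) r" "p \<in> A" "q \<in> B" "r \<in> C" by auto
    then show "x \<in> ?R" using ExS by force
  next
    fix x assume "x \<in> ?R"
    then obtain p q r where "x = form_mult \<phi> p (form_mult \<phi> q r)" "p \<in> A" "q \<in> B" "r \<in> C" by auto
    then show "x \<in> ?L" using ExS[symmetric] by force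
  qed
  then show ?case by simp
qed auto

lemma form_mult_carrier:
  "a \<in> form_carrier \<phi> \<Longrightarrow> b \<in> form_carrier \<phi> \<Longrightarrow> form_mult \<phi> a b \<in> form_carrier \<phi>"
proof (induction \<phi> arbitrary: a b)
  case (ExS X \<phi>)
  then obtain A B where AB: "A \<subseteq> form_carrier \<phi>" "B \<subseteq> form_carrier \<phi>" "a = set_encode A" "b = set_encode B"
    by auto
  then have "finite A" "finite B" using finite_form_carrier finite_subset by metis+
  then have "(\<lambda>(c, d). form_mult \<phi> c d) ` (set_decode a \<times> set_decode b) \<subseteq> form_carrier \<phi>"
    using AB ExS.IH by auto
  then show ?case by auto
qed auto

lemma finite_semigroup_form_mult: "finite_semigroup (form_mult \<phi>) (form_carrier \<phi>)"
  by unfold_locales (auto intro: form_mult_assoc finite_form_carrier form_mult_carrier)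

lemma form_value_carrier: "form_value \<phi> L \<in> form_carrier \<phi>"
proof (induction \<phi> arbitrary: L)
  case (ExS X \<phi>)
  have "generated (form_mult \<phi>) {form_value \<phi> (insert X L), form_value \<phi> (L - {X})} \<subseteq> form_carrier \<phi>"
    by (rule generated_subset) (use ExS form_mult_carrier in auto)
  then show ?case by auto
qed auto

lemma set_decode_form_value_ExS:
  "set_decode (form_value (ExS X \<phi>) L) =
     generated (form_mult \<phi>) {form_value \<phi> (insert X L), form_value \<phi> (L - {X})}"
proof -
  have "generated (form_mult \<phi>) {form_value \<phi> (insert X L), form_value \<phi> (L - {X})} \<subseteq> form_carrier \<phi>"
    by (rule generated_subset) (use form_value_carrier form_mult_carrier in auto)
  then show ?thesis using finite_form_carrier finite_subset by (simp only: form_value.simps) fastforce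
qed

subsection \<open>Values of signals on bounded intervals\<close>

inductive interval_value :: "sig_form \<Rightarrow> (nat \<Rightarrow> real \<Rightarrow> bool) \<Rightarrow> real \<Rightarrow> real \<Rightarrow> nat \<Rightarrow> bool" for \<phi> V where
  const: "u < v \<Longrightarrow> (\<And>t X. t \<in> {u..<v} \<Longrightarrow> X \<in> free_vars \<phi> \<Longrightarrow> V X t \<longleftrightarrow> X \<in> L) \<Longrightarrow>
    interval_value \<phi> V u v (form_value \<phi> L)"
| concat: "interval_value \<phi> V u m a \<Longrightarrow> interval_value \<phi> V m v b \<Longrightarrow>
    interval_value \<phi> V u v (form_mult \<phi> a b)"

lemma interval_value_less: "interval_value \<phi> V u v a \<Longrightarrow> u < v"
  by (induction rule: interval_value.induct) auto

lemma interval_value_carrier: "interval_value \<phi> V u v a \<Longrightarrow> a \<in> form_carrier \<phi>"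
  by (induction rule: interval_value.induct) (auto intro: form_value_carrier form_mult_carrier)

lemma interval_value_cong:
  "interval_value \<phi> V u v a \<Longrightarrow>
     (\<And>t X. t \<in> {u..<v} \<Longrightarrow> X \<in> free_vars \<phi> \<Longrightarrow> V X t = W X t) \<Longrightarrow> interval_value \<phi> W u v a"
proof (induction rule: interval_value.induct)
  case (const u v L)
  then show ?case by (intro interval_value.const) auto
next
  case (concat u m a v b)
  have "u < m" "m < v" using concat.hyps interval_value_less by auto
  then show ?case using concat by (intro interval_value.concat[of _ _ _ m]) auto
qed

lemma interval_value_segment:
  assumes "\<And>i. interval_value \<phi> V (\<kappa> i) (\<kappa> (Suc i)) (x i)" "i < j"
  shows "interval_value \<phi> V (\<kappa> i) (\<kappa> j) (segment_product (form_mult \<phi>) x i j)"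
  using assms(2)
proof (induction j)
  case (Suc j)
  then show ?case
    using assms(1) by (cases "i = j") (auto simp: segment_product_Suc intro: interval_value.concat)
qed simp

lemma interval_value_First:
  assumes "interval_value (First x y z) V u v a"
  defines "P \<equiv> \<lambda>t. V x t \<or> V y t"
  shows "if a = 0 then \<forall>t\<in>{u..<v}. \<not> P t
     else \<exists>t\<in>{u..<v}. P t \<and> (\<forall>s\<in>{u..<t}. \<not> P s) \<and> (a = 1 \<longleftrightarrow> V z t)"
  using assms(1)
proof (induction rule: interval_value.induct)
  case (const u v L)
  then have "P t \<longleftrightarrow> x \<in> L \<or> y \<in> L" "V z t \<longleftrightarrow> z \<in> L" if "t \<in> {u..<v}" for t
    using that by (auto simp: P_def)
  then show ?case using const.hyps(1) by (auto intro!: bexI[of _ u])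
next
  case (concat u m a v b)
  have less: "u < m" "m < v" using concat.hyps interval_value_less by auto
  show ?case
  proof (cases "a = 0")
    case True
    then have a: "\<not> P t" if "u \<le> t" "t < m" for t using concat.IH(1) that by auto
    show ?thesis
    proof (cases "b = 0")
      case b: True
      have "\<not> P t" if "t \<in> {u..<v}" for t using a[of t] concat.IH(2) b that by (cases "t < m") auto
      then show ?thesis using True b by simp
    next
      case False
      then obtain t where t: "t \<in> {m..<v}" "P t" "\<forall>s\<in>{m..<t}. \<not> P s" "b = 1 \<longleftrightarrow> V z t"
        using concat.IH(2) by auto
      have "\<not> P s" if "s \<in> {u..<t}" for s using a[of s] t(3) that by (cases "s < m") auto
      then show ?thesis using True False t less by (auto intro!: bexI[of _ t])
    qed
  next
    case False
    then obtain t where "t \<in> {u..<m}" "P t" "\<forall>s\<in>{u..<t}. \<not> P s" "a = 1 \<longleftrightarrow> V z t"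
      using concat.IH(1) by auto
    then show ?thesis using False less by (auto intro!: bexI[of _ t])
  qed
qed

lemma interval_value_Nand:
  "interval_value (Nand \<phi> \<psi>) V u v a \<Longrightarrow>
     interval_value \<phi> V u v (pfst a) \<and> interval_value \<psi> V u v (psnd a)"
proof (induction rule: interval_value.induct)
  case (const u v L)
  then show ?case by (auto intro!: interval_value.const)
next
  case (concat u m a v b)
  then show ?case by (auto intro: interval_value.concat)
qed

lemma interval_value_ExS_D:
  assumes "interval_value (ExS X \<phi>) V u v A" "step_on {u..<v} S"
  shows "\<exists>a\<in>set_decode A. interval_value \<phi> (V(X := S)) u v a"
  using assms
proof (induction rule: interval_value.induct)
  case (const u v L)
  from \<open>step_on {u..<v} S\<close> \<open>u < v\<close> show ?case
    unfolding set_decode_form_value_ExS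
  proof (induction rule: step_on_interval_induct)
    case (const c d B)
    have "interval_value \<phi> (V(X := S)) c d (form_value \<phi> (if B then insert X L else L - {X}))"
      using const \<open>\<And>t Y. t \<in> {u..<v} \<Longrightarrow> Y \<in> free_vars (ExS X \<phi>) \<Longrightarrow> V Y t \<longleftrightarrow> Y \<in> L\<close>
      by (intro interval_value.const) auto
    then show ?case by (rule bexI) (simp add: generated.base)
  next
    case (join c m d)
    then show ?case by (meson generated.mult interval_value.concat)
  qed
next
  case (concat u m a v b)
  have "u < m" "m < v" using concat.hyps interval_value_less by auto
  then have "step_on {u..<m} S" "step_on {m..<v} S"
    using concat.prems step_on_subset[of "{u..<v}" S] by auto
  then obtain c d where "c \<in> set_decode a" "d \<in> set_decode b"
    and "interval_value \<phi> (V(X := S)) u m c" "interval_value \<phi> (V(X := S)) m v d"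
    using concat.IH by blast
  moreover from this have "form_mult \<phi> c d \<in> set_decode (form_mult (ExS X \<phi>) a b)" by auto
  ultimately show ?case using interval_value.concat by blast
qed

lemma interval_value_concat_witness:
  assumes S: "step_on {u..<m} S" "interval_value \<phi> (V(X := S)) u m a"
    and T: "step_on {m..<v} T" "interval_value \<phi> (V(X := T)) m v b"
  shows "\<exists>R. step_on {u..<v} R \<and> interval_value \<phi> (V(X := R)) u v (form_mult \<phi> a b)"
proof (intro exI conjI)
  let ?R = "\<lambda>t. if t < m then S t else T t"
  have "{u..<v} \<inter> {..<m} \<subseteq> {u..<m}" "{u..<v} \<inter> {m..} \<subseteq> {m..<v}" by auto
  then show "step_on {u..<v} ?R"
    using S(1) T(1) by (intro step_on_if_less) (auto elim: step_on_subset)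
  have "interval_value \<phi> (V(X := ?R)) u m a" by (rule interval_value_cong[OF S(2)]) simp
  moreover have "interval_value \<phi> (V(X := ?R)) m v b" by (rule interval_value_cong[OF T(2)]) simp
  ultimately show "interval_value \<phi> (V(X := ?R)) u v (form_mult \<phi> a b)" by (rule interval_value.concat)
qed

lemma interval_value_generated_witness:
  assumes "a \<in> generated (form_mult \<phi>) {form_value \<phi> (insert X L), form_value \<phi> (L - {X})}"
    "u < v" "\<And>t Y. t \<in> {u..<v} \<Longrightarrow> Y \<in> free_vars (ExS X \<phi>) \<Longrightarrow> V Y t \<longleftrightarrow> Y \<in> L"
  shows "\<exists>S. step_on {u..<v} S \<and> interval_value \<phi> (V(X := S)) u v a"
  using assms
proof (induction arbitrary: u v rule: generated.induct)
  case (base g)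
  define B where "B \<longleftrightarrow> g = form_value \<phi> (insert X L)"
  then have g: "g = form_value \<phi> (if B then insert X L else L - {X})" using base by auto
  have "interval_value \<phi> (V(X := (\<lambda>_. B))) u v g"
    unfolding g using base.prems by (intro interval_value.const) auto
  then show ?case by (intro exI[of _ "\<lambda>_. B"] conjI step_on_const)
next
  case (mult a b)
  define m where "m = (u + v) / 2"
  have m: "u < m" "m < v" using mult.prems by (auto simp: m_def)
  have "\<exists>S. step_on {u..<m} S \<and> interval_value \<phi> (V(X := S)) u m a"
    by (rule mult.IH(1)[OF m(1)]) (use mult.prems(2) m(2) in auto)
  moreover have "\<exists>T. step_on {m..<v} T \<and> interval_value \<phi> (V(X := T)) m v b"
    by (rule mult.IH(2)[OF m(2)]) (use mult.prems(2) m(1) in auto)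
  ultimately show ?case using interval_value_concat_witness by blast
qed

lemma interval_value_ExS_I:
  assumes "interval_value (ExS X \<phi>) V u v A" "a \<in> set_decode A"
  shows "\<exists>S. step_on {u..<v} S \<and> interval_value \<phi> (V(X := S)) u v a"
  using assms
proof (induction arbitrary: a rule: interval_value.induct)
  case (const u v L)
  then show ?case unfolding set_decode_form_value_ExS by (intro interval_value_generated_witness)
next
  case (concat u m A v B)
  then obtain c d where "c \<in> set_decode A" "d \<in> set_decode B" "a = form_mult \<phi> c d" by auto
  then show ?case using concat.IH interval_value_concat_witness by blast
qed

subsection \<open>Values of signals on the half line\<close>

definition signal_value :: "sig_form \<Rightarrow> (nat \<Rightarrow> real \<Rightarrow> bool) \<Rightarrow> nat \<Rightarrow> nat \<Rightarrow> bool" where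
  "signal_value \<phi> V s e \<longleftrightarrow> linked_pair (form_mult \<phi>) s e \<and>
     (\<exists>\<kappa>. time_partition \<kappa> \<and> (\<forall>i. interval_value \<phi> V (\<kappa> i) (\<kappa> (Suc i)) (lasso s e i)))"

lemma signal_value_if_factorization:
  assumes \<kappa>: "time_partition \<kappa>" and x: "\<And>i. interval_value \<phi> V (\<kappa> i) (\<kappa> (Suc i)) (x i)"
    and f: "factorization (form_mult \<phi>) x \<rho> s e"
  shows "signal_value \<phi> V s e"
proof -
  have \<rho>: "\<rho> 0 = 0" "strict_mono \<rho>" using f by (simp_all add: factorization_def)
  have "interval_value \<phi> V (\<kappa> (\<rho> i)) (\<kappa> (\<rho> (Suc i))) (lasso s e i)" for i
    using interval_value_segment[of \<phi> V \<kappa> x "\<rho> i" "\<rho> (Suc i)"] x f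
    by (simp add: factorization_def strict_mono_less)
  then show ?thesis
    using f time_partition_subsequence[OF \<kappa> \<rho>] by (auto simp: signal_value_def factorization_def)
qed

lemma signal_value_First:
  assumes "signal_value (First x y z) V s e"
  shows "sig_sat V (First x y z) \<longleftrightarrow> s = 1"
proof -
  let ?P = "\<lambda>t. V x t \<or> V y t"
  obtain \<kappa> where \<kappa>: "time_partition \<kappa>"
    and val: "\<And>i. interval_value (First x y z) V (\<kappa> i) (\<kappa> (Suc i)) (lasso s e i)"
    using assms by (auto simp: signal_value_def)
  have \<kappa>_0: "\<kappa> 0 = 0" using \<kappa> by (simp add: time_partition_def)
  show ?thesis
  proof (cases "s = 0")
    case True
    then have "e = 0" using assms by (simp add: signal_value_def linked_pair_def)
    then have "lasso s e i = 0" for i using True by (cases i) simp_all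
    then have "\<not> ?P t" if "0 \<le> t" for t
      using time_partition_interval[OF \<kappa> that] interval_value_First[OF val[of "interval_index \<kappa> t"]] by auto
    then show ?thesis using True by (auto simp: first_at_def)
  next
    case False
    then obtain t where t: "0 \<le> t" "?P t" "\<forall>r\<in>{0..<t}. \<not> ?P r" and z: "s = 1 \<longleftrightarrow> V z t"
      using interval_value_First[OF val[of 0]] \<kappa>_0 by auto
    then have "first_at ?P t" by (auto simp: first_at_def)
    then show ?thesis using first_at_unique[of ?P] z by auto
  qed
qed

lemma signal_value_Nand:
  assumes "signal_value (Nand \<phi> \<psi>) V s e"
  shows "signal_value \<phi> V (pfst s) (pfst e)" "signal_value \<psi> V (psnd s) (psnd e)"
proof -
  obtain \<kappa> where "time_partition \<kappa>" and val: "\<And>i. interval_value (Nand \<phi> \<psi>) V (\<kappa> i) (\<kappa> (Suc i)) (lasso s e i)"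
    using assms by (auto simp: signal_value_def)
  moreover have "pfst (lasso s e i) = lasso (pfst s) (pfst e) i"
    "psnd (lasso s e i) = lasso (psnd s) (psnd e) i" for i
    by (cases i; simp)+
  moreover have "linked_pair (form_mult \<phi>) (pfst s) (pfst e)" "linked_pair (form_mult \<psi>) (psnd s) (psnd e)"
    using assms unfolding signal_value_def linked_pair_def form_mult.simps by (metis pfst_pair psnd_pair)+
  ultimately show "signal_value \<phi> V (pfst s) (pfst e)" "signal_value \<psi> V (psnd s) (psnd e)"
    using interval_value_Nand[OF val] unfolding signal_value_def by metis+
qed

lemma lasso_segment_product:
  "linked_pair m s e \<Longrightarrow> i < j \<Longrightarrow> segment_product m (lasso s e) i j = lasso s e i"
proof (induction j)
  case (Suc j)
  then show ?case by (cases "i = j"; cases i; cases j) (simp_all add: segment_product_Suc linked_pair_def)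
qed simp

lemma segment_product_in_set_decode:
  assumes "\<And>i. x i \<in> set_decode (A i)" "i < j"
  shows "segment_product (form_mult \<phi>) x i j \<in> set_decode (segment_product (form_mult (ExS X \<phi>)) A i j)"
  using assms(2)
proof (induction j)
  case (Suc j)
  then show ?case using assms(1)
    by (cases "i = j") (auto simp: segment_product_Suc intro!: image_eqI[of _ _ "(_, _)"])
qed simp

lemma signal_value_ExS_D:
  assumes A: "signal_value (ExS X \<phi>) V s e" and S: "step_on {0..} S"
  obtains a b where "a \<in> set_decode s" "b \<in> set_decode e" "signal_value \<phi> (V(X := S)) a b"
proof -
  interpret finite_semigroup "form_mult \<phi>" "form_carrier \<phi>" by (rule finite_semigroup_form_mult)
  have linked: "linked_pair (form_mult (ExS X \<phi>)) s e" using A by (simp add: signal_value_def)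
  obtain \<kappa> where \<kappa>: "time_partition \<kappa>"
    and val: "\<And>i. interval_value (ExS X \<phi>) V (\<kappa> i) (\<kappa> (Suc i)) (lasso s e i)"
    using A by (auto simp: signal_value_def)
  have "step_on {\<kappa> i..<\<kappa> (Suc i)} S" for i
    by (rule step_on_subset[OF S]) (use time_partition_nonneg[OF \<kappa>, of i] in auto)
  then have "\<exists>a. a \<in> set_decode (lasso s e i) \<and> interval_value \<phi> (V(X := S)) (\<kappa> i) (\<kappa> (Suc i)) a" for i
    using interval_value_ExS_D[OF val] by blast
  then obtain x where x: "\<And>i. x i \<in> set_decode (lasso s e i)"
    "\<And>i. interval_value \<phi> (V(X := S)) (\<kappa> i) (\<kappa> (Suc i)) (x i)" by metis
  then have "range x \<subseteq> form_carrier \<phi>" using interval_value_carrier by blast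
  then obtain \<rho> a b where f: "factorization (form_mult \<phi>) x \<rho> a b" by (rule factorization_exists)
  then have \<rho>: "\<rho> 0 = 0" "0 < \<rho> 1" "\<rho> 1 < \<rho> 2"
    unfolding factorization_def by (metis strict_monoD zero_less_one one_less_numeral_iff semiring_norm(76))+
  have ab: "a = segment_product (form_mult \<phi>) x 0 (\<rho> 1)" "b = segment_product (form_mult \<phi>) x (\<rho> 1) (\<rho> 2)"
    using f unfolding factorization_def by (metis One_nat_def Suc_1 lasso.simps)+
  have "a \<in> set_decode (lasso s e 0)" "b \<in> set_decode (lasso s e (\<rho> 1))"
    unfolding ab using segment_product_in_set_decode[of x "lasso s e", OF x(1)] \<rho>
    by (metis lasso_segment_product[OF linked])+
  then have "a \<in> set_decode s" "b \<in> set_decode e" using \<rho>(2) by (auto simp: gr0_conv_Suc)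
  then show ?thesis using that signal_value_if_factorization[OF \<kappa> x(2) f] by blast
qed

lemma signal_value_ExS_I:
  assumes A: "signal_value (ExS X \<phi>) V s e"
    and ab: "a \<in> set_decode s" "b \<in> set_decode e" "linked_pair (form_mult \<phi>) a b"
  obtains S where "S \<in> signals UNIV" "signal_value \<phi> (V(X := S)) a b"
proof -
  obtain \<kappa> where \<kappa>: "time_partition \<kappa>"
    and val: "\<And>i. interval_value (ExS X \<phi>) V (\<kappa> i) (\<kappa> (Suc i)) (lasso s e i)"
    using A by (auto simp: signal_value_def)
  have "lasso a b i \<in> set_decode (lasso s e i)" for i using ab by (cases i) auto
  then have "\<exists>S. step_on {\<kappa> i..<\<kappa> (Suc i)} S \<and> interval_value \<phi> (V(X := S)) (\<kappa> i) (\<kappa> (Suc i)) (lasso a b i)" for i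
    using interval_value_ExS_I[OF val] by blast
  then obtain f where f: "\<And>i. step_on {\<kappa> i..<\<kappa> (Suc i)} (f i)"
    "\<And>i. interval_value \<phi> (V(X := f i)) (\<kappa> i) (\<kappa> (Suc i)) (lasso a b i)" by metis
  have "interval_value \<phi> (V(X := glue \<kappa> f)) (\<kappa> i) (\<kappa> (Suc i)) (lasso a b i)" for i
    using f(2)[of i] by (rule interval_value_cong) (simp add: glue_eq[OF \<kappa>])
  then have "signal_value \<phi> (V(X := glue \<kappa> f)) a b"
    unfolding signal_value_def using \<kappa> ab(3) by blast
  then show ?thesis using that glue_signal[OF \<kappa> f(1)] by blast
qed

theorem sig_sat_iff_form_accepts:
  assumes "\<And>X. step_on {0..} (V X)" "signal_value \<phi> V s e"
  shows "sig_sat V \<phi> \<longleftrightarrow> form_accepts \<phi> s e"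
  using assms
proof (induction \<phi> arbitrary: V s e)
  case (First x y z)
  then show ?case using signal_value_First by simp
next
  case (Nand \<phi> \<psi>)
  note signal_value_Nand[OF Nand.prems(2)]
  then show ?case using Nand.IH[OF Nand.prems(1)] by simp
next
  case (ExS X \<phi>)
  have IH: "sig_sat (V(X := S)) \<phi> \<longleftrightarrow> form_accepts \<phi> a b"
    if "S \<in> signals UNIV" "signal_value \<phi> (V(X := S)) a b" for S a b
  proof (rule ExS.IH[OF _ that(2)])
    show "step_on {0..} ((V(X := S)) Y)" for Y using ExS.prems(1) that(1) by (simp add: signals_iff)
  qed
  show ?case
  proof
    assume "sig_sat V (ExS X \<phi>)"
    then obtain S where S: "S \<in> signals UNIV" "sig_sat (V(X := S)) \<phi>" by auto
    then have "step_on {0..} S" by (simp add: signals_iff)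
    then obtain a b where "a \<in> set_decode s" "b \<in> set_decode e" "signal_value \<phi> (V(X := S)) a b"
      using signal_value_ExS_D[OF ExS.prems(2)] by blast
    then show "form_accepts (ExS X \<phi>) s e"
      using IH S unfolding form_accepts.simps signal_value_def by blast
  next
    assume "form_accepts (ExS X \<phi>) s e"
    then obtain a b where ab: "a \<in> set_decode s" "b \<in> set_decode e" "linked_pair (form_mult \<phi>) a b"
      "form_accepts \<phi> a b" by auto
    then obtain S where "S \<in> signals UNIV" "signal_value \<phi> (V(X := S)) a b"
      using signal_value_ExS_I[OF ExS.prems(2)] by blast
    then show "sig_sat V (ExS X \<phi>)" using IH ab(4) by auto
  qed
qed

subsection \<open>Translation of the logic of Rsig\<close>

abbreviation Not_form :: "sig_form \<Rightarrow> sig_form" where "Not_form \<phi> \<equiv> Nand \<phi> \<phi>"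
abbreviation Ex_point :: "nat \<Rightarrow> sig_form \<Rightarrow> sig_form" where
  "Ex_point x \<phi> \<equiv> ExS x (Not_form (Nand (First x x x) \<phi>))"

primrec signal_form :: "mso \<Rightarrow> sig_form" where
  "signal_form (Less x y) = Not_form (First (2*x+1) (2*y+1) (2*y+1))"
| "signal_form (Pred X x) = First (2*x+1) (2*x+1) (2*X)"
| "signal_form (Neg \<phi>) = Not_form (signal_form \<phi>)"
| "signal_form (Conj \<phi> \<psi>) = Not_form (Nand (signal_form \<phi>) (signal_form \<psi>))"
| "signal_form (Disj \<phi> \<psi>) = Nand (Not_form (signal_form \<phi>)) (Not_form (signal_form \<psi>))"
| "signal_form (Ex1 x \<phi>) = Ex_point (2*x+1) (signal_form \<phi>)"
| "signal_form (All1 x \<phi>) = Not_form (Ex_point (2*x+1) (Not_form (signal_form \<phi>)))"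
| "signal_form (Ex2 X \<phi>) = ExS (2*X) (signal_form \<phi>)"
| "signal_form (All2 X \<phi>) = Not_form (ExS (2*X) (Not_form (signal_form \<phi>)))"

lemma free_vars_signal_form:
  "free_vars (signal_form \<phi>) = (\<lambda>X. 2*X) ` free2 \<phi> \<union> (\<lambda>x. 2*x+1) ` free1 \<phi>"
  by (induction \<phi>) (auto; presburger)+

lemma first_at_step_signal:
  assumes "0 \<le> t"
  shows "(\<lambda>s\<in>{0..}. t \<le> s) \<in> signals UNIV" "first_at (\<lambda>s\<in>{0..}. t \<le> s) t"
proof -
  have "step_on {0..} (\<lambda>s. if s < t then False else True)"
    by (intro step_on_if_less step_on_const)
  then have "step_on {0..} (\<lambda>s\<in>{0..}. t \<le> s)" by (rule step_on_cong) auto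
  then show "(\<lambda>s\<in>{0..}. t \<le> s) \<in> signals UNIV" by (simp add: signals_iff)
  show "first_at (\<lambda>s\<in>{0..}. t \<le> s) t" using assms by (auto simp: first_at_def)
qed

lemma sig_sat_Ex_point:
  assumes "\<And>S t. first_at S t \<Longrightarrow> sig_sat (W(x := S)) \<phi> \<longleftrightarrow> P t"
  shows "sig_sat W (Ex_point x \<phi>) \<longleftrightarrow> (\<exists>t\<in>{0..}. P t)"
proof -
  have "sig_sat W (Ex_point x \<phi>) \<longleftrightarrow> (\<exists>S\<in>signals UNIV. (\<exists>t. first_at S t) \<and> sig_sat (W(x := S)) \<phi>)"
    by (auto simp: first_at_def)
  also have "\<dots> \<longleftrightarrow> (\<exists>t\<in>{0..}. P t)"
  proof
    assume "\<exists>S\<in>signals UNIV. (\<exists>t. first_at S t) \<and> sig_sat (W(x := S)) \<phi>"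
    then obtain S t where "first_at S t" "sig_sat (W(x := S)) \<phi>" by blast
    then show "\<exists>t\<in>{0..}. P t" using assms by (auto simp: first_at_def intro!: bexI[of _ t])
  next
    assume "\<exists>t\<in>{0..}. P t"
    then obtain t where "0 \<le> t" "P t" by auto
    then show "\<exists>S\<in>signals UNIV. (\<exists>t. first_at S t) \<and> sig_sat (W(x := S)) \<phi>"
      using first_at_step_signal[of t] assms by blast
  qed
  finally show ?thesis .
qed

lemma odd_neq_even: "2 * y \<noteq> Suc (2 * x)" "Suc (2 * x) \<noteq> 2 * y"
  by presburger+

lemma sig_sat_less:
  assumes x: "first_at (W x) s" and y: "first_at (W y) t"
  shows "sig_sat W (Not_form (First x y y)) \<longleftrightarrow> s < t"
proof -
  let ?P = "\<lambda>r. W x r \<or> W y r"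
  have min: "first_at ?P (min s t)" using x y unfolding first_at_def min_def by auto
  have "(\<exists>r. first_at ?P r \<and> W y r) \<longleftrightarrow> W y (min s t)" using first_at_unique[OF min] min by blast
  also have "\<dots> \<longleftrightarrow> t \<le> s" using x y unfolding first_at_def min_def by auto
  finally show ?thesis by (auto simp: not_le)
qed

lemma Rsig_sat_iff_sig_sat:
  assumes "\<And>X. W (2*X) = V X" "\<And>x. first_at (W (2*x+1)) (v x)"
  shows "Rsig_sat v V \<phi> \<longleftrightarrow> sig_sat W (signal_form \<phi>)"
  using assms
proof (induction \<phi> arbitrary: v V W)
  case (Less x y)
  show ?case using sig_sat_less[of W "2*x+1" "v x" "2*y+1" "v y"] Less.prems(2) by simp
next
  case (Pred X x)
  have x: "first_at (W (2*x+1)) (v x)" using Pred by blast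
  have "(\<exists>t. first_at (W (2*x+1)) t \<and> W (2*X) t) \<longleftrightarrow> W (2*X) (v x)"
    using first_at_unique[OF x] x by blast
  then show ?case using Pred by simp
next
  case (Ex1 x \<phi>)
  have "sig_sat (W(2*x+1 := S)) (signal_form \<phi>) \<longleftrightarrow> Rsig_sat (v(x := t)) V \<phi>" if "first_at S t" for t S
    by (rule Ex1.IH[symmetric]) (use Ex1.prems that odd_neq_even in auto)
  from sig_sat_Ex_point[OF this] show ?case by simp
next
  case (All1 x \<phi>)
  have "sig_sat (W(2*x+1 := S)) (signal_form \<phi>) \<longleftrightarrow> Rsig_sat (v(x := t)) V \<phi>" if "first_at S t" for t S
    by (rule All1.IH[symmetric]) (use All1.prems that odd_neq_even in auto)
  then have "sig_sat W (Ex_point (2*x+1) (Not_form (signal_form \<phi>))) \<longleftrightarrow> (\<exists>t\<in>{0..}. \<not> Rsig_sat (v(x := t)) V \<phi>)"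
    by (intro sig_sat_Ex_point) simp
  then show ?case by simp
next
  case (Ex2 X \<phi>)
  have "Rsig_sat v (V(X := S)) \<phi> \<longleftrightarrow> sig_sat (W(2*X := S)) (signal_form \<phi>)" for S
    by (rule Ex2.IH) (use Ex2.prems odd_neq_even in auto)
  then show ?case by simp
next
  case (All2 X \<phi>)
  have "Rsig_sat v (V(X := S)) \<phi> \<longleftrightarrow> sig_sat (W(2*X := S)) (signal_form \<phi>)" for S
    by (rule All2.IH) (use All2.prems odd_neq_even in auto)
  then show ?case by simp
next
  case (Neg \<phi>)
  show ?case using Neg.IH[OF Neg.prems] by simp
next
  case (Conj \<phi> \<psi>)
  show ?case using Conj.IH(1)[OF Conj.prems] Conj.IH(2)[OF Conj.prems] by simp
next
  case (Disj \<phi> \<psi>)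
  show ?case using Disj.IH(1)[OF Disj.prems] Disj.IH(2)[OF Disj.prems] by simp
qed

subsection \<open>Specifications and pairs of signals\<close>

definition letter :: "bool list list \<Rightarrow> bool list list \<Rightarrow> nat \<Rightarrow> nat \<Rightarrow> nat set" where
  "letter Cin Cout a b = {2 * i |i. i < width Cin \<and> Cin ! a ! i} \<union>
     {2 * (width Cin + j) |j. j < width Cout \<and> Cout ! b ! j}"

definition signal_valuation ::
    "bool list list \<Rightarrow> bool list list \<Rightarrow> (real \<Rightarrow> nat) \<Rightarrow> (real \<Rightarrow> nat) \<Rightarrow> nat \<Rightarrow> real \<Rightarrow> bool" where
  "signal_valuation Cin Cout X Y Z =
     (if odd Z then (\<lambda>_. True)
      else if Z div 2 < width Cin then component Cin X (Z div 2)
      else if Z div 2 < width Cin + width Cout then component Cout Y (Z div 2 - width Cin)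
      else (\<lambda>t\<in>{0..}. False))"

lemma Rsig_models_iff_sig_sat:
  "Rsig_models Cin Cout \<Psi> X Y \<longleftrightarrow> sig_sat (signal_valuation Cin Cout X Y) (signal_form \<Psi>)"
  unfolding Rsig_models_def
  by (rule Rsig_sat_iff_sig_sat) (auto simp: signal_valuation_def first_at_def)

lemma step_on_signal_valuation:
  assumes X: "X \<in> signals \<Sigma>" and Y: "Y \<in> signals \<Delta>"
  shows "step_on {0..} (signal_valuation Cin Cout X Y Z)"
proof -
  have "step_on {0..} (component C f i)" if "step_on {0..} f" for C f i
    using step_on_compose[OF that, of "\<lambda>c. C ! c ! i"] by (rule step_on_cong) (simp add: component_def)
  moreover have "step_on {0..} (\<lambda>t\<in>{0..}. False)" by (rule step_on_cong[OF step_on_const[of _ False]]) simp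
  ultimately show ?thesis using X Y by (simp add: signal_valuation_def signals_iff step_on_const)
qed

lemma signal_valuation_iff_letter:
  assumes "spec_formula Cin Cout \<Psi>" "Z \<in> free_vars (signal_form \<Psi>)" "0 \<le> t" "X t = a" "Y t = b"
  shows "signal_valuation Cin Cout X Y Z t \<longleftrightarrow> Z \<in> letter Cin Cout a b"
proof -
  obtain j where j: "Z = 2 * j" "j < width Cin + width Cout"
    using assms(1,2) by (auto simp: free_vars_signal_form spec_formula_def)
  have "(\<exists>k. j = width Cin + k \<and> k < width Cout \<and> Cout ! b ! k) \<longleftrightarrow>
      \<not> j < width Cin \<and> Cout ! b ! (j - width Cin)"
    using j(2) by (auto intro!: exI[of _ "j - width Cin"])
  then have "2 * j \<in> letter Cin Cout a b \<longleftrightarrow>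
      (if j < width Cin then Cin ! a ! j else Cout ! b ! (j - width Cin))"
    unfolding letter_def Un_iff mem_Collect_eq mult_cancel1 by auto
  then show ?thesis using j assms(3-5) by (auto simp: signal_valuation_def component_def)
qed

theorem Rsig_models_iff_form_accepts:
  assumes spec: "spec_formula Cin Cout \<Psi>"
    and X: "X \<in> signals \<Sigma>" and Y: "Y \<in> signals \<Delta>" and \<kappa>: "time_partition \<kappa>"
    and XY: "\<And>i t. t \<in> {\<kappa> i..<\<kappa> (Suc i)} \<Longrightarrow> X t = a i \<and> Y t = b i"
    and f: "factorization (form_mult (signal_form \<Psi>))
      (\<lambda>i. form_value (signal_form \<Psi>) (letter Cin Cout (a i) (b i))) \<rho> s e"
  shows "Rsig_models Cin Cout \<Psi> X Y \<longleftrightarrow> form_accepts (signal_form \<Psi>) s e"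
  unfolding Rsig_models_iff_sig_sat
proof (rule sig_sat_iff_form_accepts[OF step_on_signal_valuation[OF X Y]],
    rule signal_value_if_factorization[OF \<kappa> _ f], rule interval_value.const)
  show "\<kappa> i < \<kappa> (Suc i)" for i using \<kappa> by (simp add: time_partition_less)
  show "signal_valuation Cin Cout X Y Z t \<longleftrightarrow> Z \<in> letter Cin Cout (a i) (b i)"
    if "t \<in> {\<kappa> i..<\<kappa> (Suc i)}" "Z \<in> free_vars (signal_form \<Psi>)" for i t Z
  proof (rule signal_valuation_iff_letter[OF spec that(2)])
    show "0 \<le> t" using that(1) time_partition_nonneg[OF \<kappa>, of i] by simp
  qed (use XY[OF that(1)] in auto)
qed

section \<open>Positional determinacy of finite parity games\<close>

definition least_recurrent :: "(nat \<Rightarrow> nat) \<Rightarrow> nat" where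
  "least_recurrent c = (LEAST k. \<exists>\<^sub>\<infinity>i. c i = k)"

lemma INFM_add_iff: "(\<exists>\<^sub>\<infinity>i. P (N + i)) \<longleftrightarrow> (\<exists>\<^sub>\<infinity>i. P i)" for N :: nat
proof (induction N)
  case (Suc N)
  have "(\<exists>\<^sub>\<infinity>i. P (N + Suc i)) \<longleftrightarrow> (\<exists>\<^sub>\<infinity>i. P (N + i))"
    using MOST_Suc_iff[of "\<lambda>i. \<not> P (N + i)"] unfolding not_INFM[symmetric] by blast
  with Suc show ?case by simp
qed simp

lemma least_recurrent_shift: "least_recurrent (\<lambda>i. c (N + i)) = least_recurrent c"
  by (simp add: least_recurrent_def INFM_add_iff[of "\<lambda>i. c i = _"])

lemma least_recurrent_double: "least_recurrent (\<lambda>n. c (n div 2)) = least_recurrent c"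
proof -
  have "(\<exists>\<^sub>\<infinity>i. c (i div 2) = k) \<longleftrightarrow> (\<exists>\<^sub>\<infinity>i. c i = k)" for k
    unfolding INFM_nat_le
  proof (intro iffI allI)
    fix n assume "\<forall>n. \<exists>i\<ge>n. c (i div 2) = k"
    then obtain i where "2 * n \<le> i" "c (i div 2) = k" by blast
    then show "\<exists>i\<ge>n. c i = k" by (intro exI[of _ "i div 2"]) auto
  next
    fix n assume "\<forall>n. \<exists>i\<ge>n. c i = k"
    then obtain i where "n \<le> i" "c i = k" by blast
    then show "\<exists>i\<ge>n. c (i div 2) = k" by (intro exI[of _ "2 * i"]) auto
  qed
  then show ?thesis by (simp add: least_recurrent_def)
qed

lemma least_recurrent_eq:
  assumes "\<exists>\<^sub>\<infinity>i. c i = k" "\<And>i. k \<le> c i"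
  shows "least_recurrent c = k"
  unfolding least_recurrent_def by (rule Least_equality) (use assms in \<open>auto dest: INFM_EX\<close>)

lemma least_recurrent_bounded:
  assumes "\<And>i. c i \<le> M"
  shows "\<exists>\<^sub>\<infinity>i. c i = least_recurrent c" "\<forall>\<^sub>\<infinity>i. least_recurrent c \<le> c i"
proof -
  have "\<exists>\<^sub>\<infinity>i. \<exists>k\<in>{..M}. c i = k" using assms by simp
  then have "\<exists>k. \<exists>\<^sub>\<infinity>i. c i = k" unfolding INFM_finite_Bex_distrib[OF finite_atMost] by blast
  then show "\<exists>\<^sub>\<infinity>i. c i = least_recurrent c" unfolding least_recurrent_def by (rule LeastI_ex)
  have "\<not> (\<exists>\<^sub>\<infinity>i. c i = k)" if "k < least_recurrent c" for k
    using that unfolding least_recurrent_def by (rule not_less_Least)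
  then have "\<not> (\<exists>\<^sub>\<infinity>i. \<exists>k\<in>{..<least_recurrent c}. c i = k)"
    unfolding INFM_finite_Bex_distrib[OF finite_lessThan] by blast
  then show "\<forall>\<^sub>\<infinity>i. least_recurrent c \<le> c i" by (simp add: not_less)
qed

definition path :: "('v \<times> 'v) set \<Rightarrow> (nat \<Rightarrow> 'v) \<Rightarrow> bool" where
  "path F p \<longleftrightarrow> (\<forall>i. (p i, p (Suc i)) \<in> F)"

text \<open>The colour of a path is its least recurrent colour, and \<open>good\<close> tells whether the player \<open>True\<close>
  or the player \<open>False\<close> wins the paths of a given colour.\<close>

locale parity_game =
  fixes E :: "('v \<times> 'v) set" and own :: "'v \<Rightarrow> bool" and col :: "'v \<Rightarrow> nat" and good :: "nat \<Rightarrow> bool"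
begin

definition arena :: "'v set \<Rightarrow> bool" where
  "arena U \<longleftrightarrow> (\<forall>v\<in>U. \<exists>u\<in>U. (v, u) \<in> E)"

definition path_winner :: "(nat \<Rightarrow> 'v) \<Rightarrow> bool" where
  "path_winner p = good (least_recurrent (\<lambda>i. col (p i)))"

definition dominion :: "'v set \<Rightarrow> bool \<Rightarrow> 'v set \<Rightarrow> ('v \<times> 'v) set \<Rightarrow> bool" where
  "dominion U pl D F \<longleftrightarrow> D \<subseteq> U \<and> F \<subseteq> E \<inter> D \<times> D \<and>
     (\<forall>v\<in>D. own v = pl \<longrightarrow> (\<exists>u. (v, u) \<in> F)) \<and>
     (\<forall>v\<in>D. own v \<noteq> pl \<longrightarrow> (\<forall>u\<in>U. (v, u) \<in> E \<longrightarrow> (v, u) \<in> F)) \<and>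
     (\<forall>p. path F p \<longrightarrow> path_winner p = pl)"

lemma path_winner_shift: "path_winner (\<lambda>i. p (N + i)) = path_winner p"
  using least_recurrent_shift[of "\<lambda>i. col (p i)" N] by (simp add: path_winner_def)

lemma dominion_subset: "dominion U pl D F \<Longrightarrow> D \<subseteq> U"
  and dominion_moves: "dominion U pl D F \<Longrightarrow> F \<subseteq> E \<inter> D \<times> D"
  and dominion_own: "dominion U pl D F \<Longrightarrow> v \<in> D \<Longrightarrow> own v = pl \<Longrightarrow> \<exists>u. (v, u) \<in> F"
  and dominion_other: "dominion U pl D F \<Longrightarrow> v \<in> D \<Longrightarrow> own v \<noteq> pl \<Longrightarrow> u \<in> U \<Longrightarrow> (v, u) \<in> E \<Longrightarrow> (v, u) \<in> F"
  and dominion_path: "dominion U pl D F \<Longrightarrow> path F p \<Longrightarrow> path_winner p = pl"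
  unfolding dominion_def by blast+

lemma dominionI:
  assumes "D \<subseteq> U" "F \<subseteq> E \<inter> D \<times> D" "\<And>p. path F p \<Longrightarrow> path_winner p = pl"
    and "\<And>v. v \<in> D \<Longrightarrow> own v = pl \<Longrightarrow> \<exists>u. (v, u) \<in> F"
    and "\<And>v u. v \<in> D \<Longrightarrow> own v \<noteq> pl \<Longrightarrow> u \<in> U \<Longrightarrow> (v, u) \<in> E \<Longrightarrow> (v, u) \<in> F"
  shows "dominion U pl D F"
  unfolding dominion_def using assms by blast

lemma dominion_empty: "dominion U pl {} {}"
  by (simp add: dominion_def path_def)

lemma dominion_path_tail:
  assumes "dominion U pl D F" "\<And>i. (p (N + i), p (Suc (N + i))) \<in> F"
  shows "path_winner p = pl"
  using dominion_path[OF assms(1), of "\<lambda>i. p (N + i)"] assms(2) path_winner_shift[of p N]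
  by (simp add: path_def)

subsection \<open>Attractors\<close>

primrec attractor_level :: "bool \<Rightarrow> 'v set \<Rightarrow> 'v set \<Rightarrow> nat \<Rightarrow> 'v set" where
  "attractor_level pl U Z 0 = Z"
| "attractor_level pl U Z (Suc n) = attractor_level pl U Z n \<union>
     {v \<in> U. own v = pl \<and> (\<exists>u\<in>attractor_level pl U Z n. (v, u) \<in> E)} \<union>
     {v \<in> U. own v \<noteq> pl \<and> (\<forall>u\<in>U. (v, u) \<in> E \<longrightarrow> u \<in> attractor_level pl U Z n)}"

definition attractor :: "bool \<Rightarrow> 'v set \<Rightarrow> 'v set \<Rightarrow> 'v set" where
  "attractor pl U Z = (\<Union>n. attractor_level pl U Z n)"

definition attractor_rank :: "bool \<Rightarrow> 'v set \<Rightarrow> 'v set \<Rightarrow> 'v \<Rightarrow> nat" where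
  "attractor_rank pl U Z v = (LEAST n. v \<in> attractor_level pl U Z n)"

definition attractor_moves :: "bool \<Rightarrow> 'v set \<Rightarrow> 'v set \<Rightarrow> ('v \<times> 'v) set" where
  "attractor_moves pl U Z = {(v, u) \<in> E. v \<in> attractor pl U Z - Z \<and> u \<in> attractor pl U Z \<and>
     attractor_rank pl U Z u < attractor_rank pl U Z v}"

lemma attractor_level_mono: "m \<le> n \<Longrightarrow> attractor_level pl U Z m \<subseteq> attractor_level pl U Z n"
  by (rule lift_Suc_mono_le[of "attractor_level pl U Z"]) auto

lemma attractor_levelI: "v \<in> attractor_level pl U Z n \<Longrightarrow> v \<in> attractor pl U Z"
  unfolding attractor_def by blast

lemma attractor_level_rank: "v \<in> attractor pl U Z \<Longrightarrow> v \<in> attractor_level pl U Z (attractor_rank pl U Z v)"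
  unfolding attractor_def attractor_rank_def by (auto intro: LeastI)

lemma attractor_rank_le: "v \<in> attractor_level pl U Z n \<Longrightarrow> attractor_rank pl U Z v \<le> n"
  unfolding attractor_rank_def by (rule Least_le)

lemma subset_attractor: "Z \<subseteq> attractor pl U Z"
  unfolding attractor_def using attractor_level.simps(1) by blast

lemma attractor_subset: assumes "Z \<subseteq> U" shows "attractor pl U Z \<subseteq> U"
proof -
  have "attractor_level pl U Z n \<subseteq> U" for n by (induction n) (use assms in auto)
  then show ?thesis unfolding attractor_def by blast
qed

lemma attractor_own:
  assumes "v \<in> U - attractor pl U Z" "own v = pl" "(v, u) \<in> E"
  shows "u \<notin> attractor pl U Z"
proof
  assume "u \<in> attractor pl U Z"
  then have "v \<in> attractor_level pl U Z (Suc (attractor_rank pl U Z u))"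
    using assms attractor_level_rank by auto
  then show False using assms(1) attractor_levelI by blast
qed

lemma attractor_other:
  assumes "finite U" "v \<in> U - attractor pl U Z" "own v \<noteq> pl"
  shows "\<exists>u\<in>U - attractor pl U Z. (v, u) \<in> E"
proof (rule ccontr)
  assume none: "\<not> ?thesis"
  define N where "N = Max (insert 0 (attractor_rank pl U Z ` U))"
  have "u \<in> attractor_level pl U Z N" if "u \<in> U" "(v, u) \<in> E" for u
  proof -
    have "u \<in> attractor_level pl U Z (attractor_rank pl U Z u)"
      using none that by (intro attractor_level_rank) blast
    moreover have "attractor_rank pl U Z u \<le> N" unfolding N_def using assms(1) that by (intro Max_ge) auto
    ultimately show ?thesis using attractor_level_mono by blast
  qed
  then have "v \<in> attractor_level pl U Z (Suc N)" using assms by auto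
  then show False using assms(2) attractor_levelI by blast
qed

lemma arena_minus_attractor: "finite U \<Longrightarrow> arena U \<Longrightarrow> arena (U - attractor pl U Z)"
  unfolding arena_def by (metis DiffD1 DiffI attractor_other attractor_own)

lemma attractor_moves_exist:
  assumes "v \<in> attractor pl U Z - Z"
  shows "own v = pl \<Longrightarrow> \<exists>u. (v, u) \<in> attractor_moves pl U Z"
    and "own v \<noteq> pl \<Longrightarrow> u \<in> U \<Longrightarrow> (v, u) \<in> E \<Longrightarrow> (v, u) \<in> attractor_moves pl U Z"
proof -
  have v: "v \<in> attractor_level pl U Z (attractor_rank pl U Z v)"
    using assms attractor_level_rank by blast
  then obtain n where n: "attractor_rank pl U Z v = Suc n"
    using assms by (cases "attractor_rank pl U Z v") auto
  have "v \<notin> attractor_level pl U Z n" using attractor_rank_le[of v pl U Z n] n by auto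
  then have step: "own v = pl \<and> (\<exists>u\<in>attractor_level pl U Z n. (v, u) \<in> E) \<or>
      own v \<noteq> pl \<and> (\<forall>u\<in>U. (v, u) \<in> E \<longrightarrow> u \<in> attractor_level pl U Z n)"
    using v n by auto
  have move: "(v, u) \<in> attractor_moves pl U Z" if "u \<in> attractor_level pl U Z n" "(v, u) \<in> E" for u
    using that assms attractor_rank_le[OF that(1)] attractor_levelI[OF that(1)] n
    by (auto simp: attractor_moves_def)
  show "own v = pl \<Longrightarrow> \<exists>u. (v, u) \<in> attractor_moves pl U Z" using step move by blast
  show "own v \<noteq> pl \<Longrightarrow> u \<in> U \<Longrightarrow> (v, u) \<in> E \<Longrightarrow> (v, u) \<in> attractor_moves pl U Z"
    using step move by blast
qed

lemma attractor_reach: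
  assumes p: "path F p"
    and F: "\<And>v u. v \<in> attractor pl U Z - Z \<Longrightarrow> (v, u) \<in> F \<Longrightarrow> (v, u) \<in> attractor_moves pl U Z"
  shows "p i \<in> attractor pl U Z \<Longrightarrow> \<exists>j\<ge>i. p j \<in> Z"
proof (induction "attractor_rank pl U Z (p i)" arbitrary: i rule: less_induct)
  case less
  show ?case
  proof (cases "p i \<in> Z")
    case False
    then have "(p i, p (Suc i)) \<in> attractor_moves pl U Z" using less.prems p F unfolding path_def by blast
    then have "attractor_rank pl U Z (p (Suc i)) < attractor_rank pl U Z (p i)" "p (Suc i) \<in> attractor pl U Z"
      by (auto simp: attractor_moves_def)
    then obtain j where "Suc i \<le> j" "p j \<in> Z" using less.hyps by blast
    then show ?thesis using Suc_leD by blast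
  qed auto
qed

subsection \<open>Dominions from smaller dominions\<close>

lemma dominion_outside_attractor:
  assumes D: "dominion (U - attractor pl U Z) (\<not> pl) D F"
  shows "dominion U (\<not> pl) D F"
proof (rule dominionI)
  fix v u assume v: "v \<in> D" "own v \<noteq> (\<not> pl)" and u: "u \<in> U" "(v, u) \<in> E"
  have "v \<in> U - attractor pl U Z" using v(1) dominion_subset[OF D] by blast
  then have "u \<in> U - attractor pl U Z" using attractor_own v(2) u by blast
  then show "(v, u) \<in> F" using dominion_other[OF D] v u(2) by blast
qed (use D in \<open>auto simp: dominion_def\<close>)

lemma dominion_attractor:
  assumes D: "dominion U pl D F"
  shows "dominion U pl (attractor pl U D) (F \<union> attractor_moves pl U D)"
proof -
  let ?A = "attractor pl U D" and ?F = "F \<union> attractor_moves pl U D"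
  note sub = dominion_subset[OF D] dominion_moves[OF D]
  have moves: "?F \<subseteq> E \<inter> ?A \<times> ?A"
    using sub subset_attractor[of D pl U] by (auto simp: attractor_moves_def)
  show ?thesis
  proof (rule dominionI[OF attractor_subset[OF sub(1)] moves])
    fix p assume p: "path ?F p"
    have "p 0 \<in> ?A" using p moves by (auto simp: path_def)
    then obtain N where N: "p N \<in> D"
      using attractor_reach[OF p, of pl U D 0] sub(2) by blast
    have inD: "(p (N + i), p (Suc (N + i))) \<in> F \<and> p (N + i) \<in> D" for i
    proof (induction i)
      case 0
      then show ?case using N p by (auto simp: path_def attractor_moves_def)
    next
      case (Suc i)
      then have "p (Suc (N + i)) \<in> D" using sub(2) by blast
      then show ?case using p by (auto simp: path_def attractor_moves_def)
    qed
    then show "path_winner p = pl" using dominion_path_tail[OF D] by blast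
  next
    show "\<exists>u. (v, u) \<in> ?F" if "v \<in> ?A" "own v = pl" for v
      using that dominion_own[OF D] attractor_moves_exist(1)[of v pl U D] by (cases "v \<in> D") auto
    show "(v, u) \<in> ?F" if "v \<in> ?A" "own v \<noteq> pl" "u \<in> U" "(v, u) \<in> E" for v u
      using that dominion_other[OF D] attractor_moves_exist(2)[of v pl U D u] by (cases "v \<in> D") auto
  qed
qed

lemma dominion_union:
  assumes B: "dominion U pl B F" and D: "dominion (U - B) pl D G"
  shows "dominion U pl (B \<union> D) (F \<union> G \<union> {(v, u) \<in> E. v \<in> D \<and> own v \<noteq> pl \<and> u \<in> B})" (is "dominion U pl _ ?F")
proof -
  note B_sub = dominion_subset[OF B] dominion_moves[OF B]
  note D_sub = dominion_subset[OF D] dominion_moves[OF D]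
  have from_B: "(p n, p (Suc n)) \<in> F" if "path ?F p" "p n \<in> B" for p n
    using that D_sub unfolding path_def by blast
  show ?thesis
  proof (rule dominionI)
    show "B \<union> D \<subseteq> U" "?F \<subseteq> E \<inter> (B \<union> D) \<times> (B \<union> D)" using B_sub D_sub by blast+
    show "path_winner p = pl" if p: "path ?F p" for p
    proof (cases "\<exists>N. p N \<in> B")
      case True
      then obtain N where N: "p N \<in> B" by blast
      have "p (N + i) \<in> B \<and> (p (N + i), p (Suc (N + i))) \<in> F" for i
      proof (induction i)
        case (Suc i)
        then have "p (Suc (N + i)) \<in> B" using B_sub by blast
        then show ?case using from_B[OF p] by simp
      qed (use N from_B[OF p] in simp)
      then show ?thesis using dominion_path_tail[OF B] by blast
    next
      case False
      then have "(p i, p (Suc i)) \<in> G" for i using p B_sub unfolding path_def by blast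
      then show ?thesis using dominion_path[OF D] by (simp add: path_def)
    qed
    show "\<exists>u. (v, u) \<in> ?F" if "v \<in> B \<union> D" "own v = pl" for v
      using that dominion_own[OF B, of v] dominion_own[OF D, of v] by blast
    show "(v, u) \<in> ?F" if "v \<in> B \<union> D" "own v \<noteq> pl" "u \<in> U" "(v, u) \<in> E" for v u
      using that dominion_other[OF B, of v u] dominion_other[OF D, of v u]
      by (cases "v \<in> B"; cases "u \<in> B") simp_all
  qed
qed

lemma path_winner_least_colour:
  assumes p: "path F p" and least: "\<And>i. c \<le> col (p i)" and Z: "\<And>v. v \<in> Z \<Longrightarrow> col v = c"
    and F: "\<And>v u. v \<in> attractor pl U Z - Z \<Longrightarrow> (v, u) \<in> F \<Longrightarrow> (v, u) \<in> attractor_moves pl U Z"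
    and recurrent: "\<exists>\<^sub>\<infinity>i. p i \<in> attractor pl U Z"
  shows "path_winner p = good c"
proof -
  have "\<exists>\<^sub>\<infinity>j. col (p j) = c"
    unfolding INFM_nat_le
  proof
    fix n
    obtain i where "n \<le> i" "p i \<in> attractor pl U Z" using recurrent unfolding INFM_nat_le by blast
    then obtain j where "i \<le> j" "p j \<in> Z" using attractor_reach[OF p F] by blast
    then show "\<exists>j\<ge>n. col (p j) = c" using \<open>n \<le> i\<close> Z by (intro exI[of _ j]) simp
  qed
  then have "least_recurrent (\<lambda>i. col (p i)) = c" using least by (rule least_recurrent_eq)
  then show ?thesis by (simp add: path_winner_def)
qed

lemma dominion_least_colour:
  assumes "arena U" and least: "\<And>v. v \<in> U \<Longrightarrow> c \<le> col v" and "good c = pl"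
  defines "Z \<equiv> {v \<in> U. col v = c}"
  assumes D: "dominion (U - attractor pl U Z) pl (U - attractor pl U Z) F"
  shows "dominion U pl U (F \<union> attractor_moves pl U Z \<union> {(v, u) \<in> E. v \<in> Z \<and> u \<in> U} \<union>
    {(v, u) \<in> E. v \<in> U - attractor pl U Z \<and> own v \<noteq> pl \<and> u \<in> attractor pl U Z})" (is "dominion U pl U ?F")
proof -
  let ?A = "attractor pl U Z"
  have "Z \<subseteq> U" by (auto simp: Z_def)
  then have A: "Z \<subseteq> ?A" "?A \<subseteq> U" by (simp_all add: subset_attractor attractor_subset)
  note F = dominion_moves[OF D]
  have moves: "?F \<subseteq> E \<inter> U \<times> U" using F A \<open>Z \<subseteq> U\<close> by (auto simp: attractor_moves_def)
  show ?thesis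
  proof (rule dominionI[OF order_refl moves])
    fix p assume p: "path ?F p"
    show "path_winner p = pl"
    proof (cases "\<exists>\<^sub>\<infinity>i. p i \<in> ?A")
      case True
      have "p i \<in> U" for i using p moves unfolding path_def by blast
      with least have "path_winner p = good c"
        by (intro path_winner_least_colour[OF p _ _ _ True]) (use F in \<open>auto simp: Z_def\<close>)
      then show ?thesis using \<open>good c = pl\<close> by simp
    next
      case False
      then obtain N where N: "\<And>i. N \<le> i \<Longrightarrow> p i \<notin> ?A" by (auto simp: MOST_nat_le)
      have "(p (N + i), p (Suc (N + i))) \<in> F" for i
        using p N[of "N + i"] N[of "Suc (N + i)"] A(1) by (auto simp: path_def attractor_moves_def)
      then show ?thesis by (rule dominion_path_tail[OF D])
    qed
  next
    show "\<exists>u. (v, u) \<in> ?F" if v: "v \<in> U" "own v = pl" for v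
      using \<open>arena U\<close> v attractor_moves_exist(1)[of v pl U Z] dominion_own[OF D, of v] unfolding arena_def by blast
    show "(v, u) \<in> ?F" if v: "v \<in> U" "own v \<noteq> pl" "u \<in> U" "(v, u) \<in> E" for v u
      using v attractor_moves_exist(2)[of v pl U Z u] dominion_other[OF D, of v u] by blast
  qed
qed

subsection \<open>Determinacy\<close>

definition determined :: "'v set \<Rightarrow> bool" where
  "determined U \<longleftrightarrow> (\<exists>D F. (\<forall>pl. dominion U pl (D pl) (F pl)) \<and> (\<Union>pl. D pl) = U)"

lemma determinedI:
  assumes "dominion U pl D F" "dominion U (\<not> pl) D' F'" "D \<union> D' = U"
  shows "determined U"
  unfolding determined_def
  using assms by (intro exI[of _ "\<lambda>q. if q = pl then D else D'"] exI[of _ "\<lambda>q. if q = pl then F else F'"]) auto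

lemma determined_if_dominion_attractor:
  assumes D: "dominion U pl D F" and rest: "determined (U - attractor pl U D)"
  shows "determined U"
proof -
  define B where "B = attractor pl U D"
  have B: "dominion U pl B (F \<union> attractor_moves pl U D)" unfolding B_def by (rule dominion_attractor[OF D])
  obtain D' F' where D': "\<And>q. dominion (U - B) q (D' q) (F' q)" "(\<Union>q. D' q) = U - B"
    using rest unfolding determined_def B_def by blast
  have "dominion U (\<not> pl) (D' (\<not> pl)) (F' (\<not> pl))"
    using D'(1)[unfolded B_def] by (rule dominion_outside_attractor)
  moreover have "(B \<union> D' pl) \<union> D' (\<not> pl) = U"
    using D'(2) dominion_subset[OF B] by (cases pl) (auto simp: UNIV_bool)
  ultimately show ?thesis using determinedI[OF dominion_union[OF B D'(1)]] by blast
qed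

text \<open>Zielonka's recursive algorithm\<close>

theorem parity_determined: "finite U \<Longrightarrow> arena U \<Longrightarrow> determined U"
proof (induction U rule: finite_psubset_induct)
  case (psubset U)
  show ?case
  proof (cases "U = {}")
    case True
    then show ?thesis by (intro determinedI[OF dominion_empty dominion_empty]) simp
  next
    case False
    define c where "c = Min (col ` U)"
    define pl where "pl = good c"
    define Z where "Z = {v \<in> U. col v = c}"
    define U' where "U' = U - attractor pl U Z"
    have least: "c \<le> col v" if "v \<in> U" for v unfolding c_def using psubset.hyps that by simp
    have "c \<in> col ` U" unfolding c_def using False psubset.hyps by (intro Min_in) auto
    then have "U' \<subset> U" using subset_attractor[of Z pl U] by (auto simp: U'_def Z_def)
    moreover have "arena U'" unfolding U'_def using psubset by (intro arena_minus_attractor)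
    ultimately have "determined U'" by (rule psubset.IH)
    then obtain D F where D: "\<And>q. dominion U' q (D q) (F q)" "(\<Union>q. D q) = U'"
      unfolding determined_def by blast
    show ?thesis
    proof (cases "D (\<not> pl) = {}")
      case True
      then have "D pl = U'" using D(2) by (cases pl) (auto simp: UNIV_bool)
      with D(1)[of pl] have "dominion U' pl U' (F pl)" by simp
      from dominion_least_colour[OF psubset.prems least pl_def[symmetric] this[unfolded U'_def Z_def]]
      show ?thesis using determinedI[OF _ dominion_empty] by blast
    next
      case False
      have W: "dominion U (\<not> pl) (D (\<not> pl)) (F (\<not> pl))"
        using dominion_outside_attractor[OF D(1)[unfolded U'_def]] .
      then have "U - attractor (\<not> pl) U (D (\<not> pl)) \<subset> U"
        using False subset_attractor[of "D (\<not> pl)" "\<not> pl" U] dominion_subset[OF W] by blast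
      moreover have "arena (U - attractor (\<not> pl) U (D (\<not> pl)))" using psubset by (intro arena_minus_attractor)
      ultimately show ?thesis using determined_if_dominion_attractor[OF W] psubset.IH by blast
    qed
  qed
qed

end

section \<open>Reduction of semigroup conditions to parity conditions\<close>

subsection \<open>First occurrences\<close>

definition first_occurrences :: "('i \<Rightarrow> 'k) \<Rightarrow> 'i list \<Rightarrow> 'i list" where
  "first_occurrences h = foldl (\<lambda>is i. if h i \<in> h ` set is then is else is @ [i]) []"

lemma first_occurrences_Nil [simp]: "first_occurrences h [] = []"
  by (simp add: first_occurrences_def)

lemma first_occurrences_snoc:
  "first_occurrences h (ys @ [y]) =
     (if h y \<in> h ` set (first_occurrences h ys) then first_occurrences h ys else first_occurrences h ys @ [y])"
  by (simp add: first_occurrences_def)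

lemma first_occurrences_map: "first_occurrences id (map h ys) = map h (first_occurrences h ys)"
  by (induction ys rule: rev_induct) (auto simp: first_occurrences_snoc)

lemma first_occurrences_append: "\<exists>zs. first_occurrences h (ys @ ws) = first_occurrences h ys @ zs"
proof (induction ws rule: rev_induct)
  case (snoc w ws)
  then show ?case using first_occurrences_snoc[of h "ys @ ws" w] by auto
qed simp

lemma first_occurrences_take: "\<exists>zs. first_occurrences h ys = first_occurrences h (take j ys) @ zs"
  using first_occurrences_append[of h "take j ys" "drop j ys"] by simp

lemma distinct_first_occurrences: "distinct (map h (first_occurrences h ys))"
  by (induction ys rule: rev_induct) (auto simp: first_occurrences_snoc)

lemma set_first_occurrences: "set (first_occurrences h ys) \<subseteq> set ys"
  by (induction ys rule: rev_induct) (auto simp: first_occurrences_snoc)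

lemma image_first_occurrences: "h ` set (first_occurrences h ys) = h ` set ys"
  by (induction ys rule: rev_induct) (auto simp: first_occurrences_snoc)

lemma sorted_first_occurrences: "sorted_wrt (<) ys \<Longrightarrow> sorted_wrt (<) (first_occurrences h ys)"
proof (induction ys rule: rev_induct)
  case (snoc y ys)
  then show ?case using set_first_occurrences[of h ys] by (auto simp: first_occurrences_snoc sorted_wrt_append)
qed simp

lemma first_occurrences_coarser:
  assumes "\<And>x y. x \<in> set ys \<Longrightarrow> y \<in> set ys \<Longrightarrow> h x = h y \<Longrightarrow> h' x = h' y"
  shows "first_occurrences h' (first_occurrences h ys) = first_occurrences h' ys"
  using assms
proof (induction ys rule: rev_induct)
  case (snoc y ys)
  then have IH: "first_occurrences h' (first_occurrences h ys) = first_occurrences h' ys" by simp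
  show ?case
  proof (cases "h y \<in> h ` set (first_occurrences h ys)")
    case True
    then obtain z where "z \<in> set ys" "h y = h z" unfolding image_first_occurrences by blast
    then have "h' y \<in> h' ` set ys" using snoc.prems[of y z] by auto
    then show ?thesis using True IH by (simp add: first_occurrences_snoc image_first_occurrences)
  next
    case False
    then show ?thesis using IH by (simp add: first_occurrences_snoc)
  qed
qed simp

definition absorbs :: "('i \<Rightarrow> 'k) \<Rightarrow> 'i list \<Rightarrow> nat \<Rightarrow> bool" where
  "absorbs h ys q \<longleftrightarrow> (\<exists>j<length ys. q < length (first_occurrences h (take j ys)) \<and>
     h (first_occurrences h (take j ys) ! q) = h (ys ! j))"

lemma absorbs_map: "absorbs id (map h ys) q \<longleftrightarrow> absorbs h ys q"
  unfolding absorbs_def by (auto simp: take_map first_occurrences_map)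

lemma absorbs_length: "absorbs h ys q \<Longrightarrow> q < length (first_occurrences h ys)"
  unfolding absorbs_def using first_occurrences_take[of h ys] by (metis length_append trans_less_add1)

lemma first_occurrences_take_if_not_absorbs:
  assumes "\<And>q'. q' < q \<Longrightarrow> \<not> absorbs h ys q'" "n \<le> Suc q"
  shows "first_occurrences h (take n ys) = take n ys"
  using assms(2)
proof (induction n)
  case (Suc n)
  then have IH: "first_occurrences h (take n ys) = take n ys" by simp
  show ?case
  proof (cases "n < length ys")
    case True
    have "h (ys ! n) \<notin> h ` set (take n ys)"
    proof
      assume "h (ys ! n) \<in> h ` set (take n ys)"
      then obtain q' where q': "q' < n" "h (ys ! q') = h (ys ! n)"
        using True by (auto simp: in_set_conv_nth)
      then have "absorbs h ys q'" unfolding absorbs_def using IH True by (intro exI[of _ n]) simp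
      then show False using assms(1)[of q'] q'(1) Suc.prems by simp
    qed
    then show ?thesis
      using IH True first_occurrences_snoc[of h "take n ys" "ys ! n"] by (simp add: take_Suc_conv_app_nth)
  qed (use IH in simp)
qed simp

lemma first_occurrences_nth_if_not_absorbs:
  assumes "\<And>q'. q' < q \<Longrightarrow> \<not> absorbs h ys q'" "q < length ys"
  shows "q < length (first_occurrences h ys)" "first_occurrences h ys ! q = ys ! q"
proof -
  obtain zs where "first_occurrences h ys = take (Suc q) ys @ zs"
    using first_occurrences_take[of h ys "Suc q"]
      first_occurrences_take_if_not_absorbs[of q h ys "Suc q"] assms(1)
    by auto
  then show "q < length (first_occurrences h ys)" "first_occurrences h ys ! q = ys ! q"
    using assms(2) by (auto simp: nth_append)
qed

lemma first_occurrences_eq_if_not_absorbs: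
  "(\<And>q. \<not> absorbs h ys q) \<Longrightarrow> first_occurrences h ys = ys"
  using first_occurrences_take_if_not_absorbs[of "length ys" h ys "length ys"] by simp

lemma absorbsE:
  assumes "absorbs h ys q" and sorted: "sorted_wrt (<) (ys :: nat list)"
  obtains r where "r \<in> set ys" "r \<notin> set (first_occurrences h ys)"
    "h r = h (first_occurrences h ys ! q)" "first_occurrences h ys ! q < r"
proof -
  let ?i = "first_occurrences h ys ! q"
  obtain j where j: "j < length ys" "q < length (first_occurrences h (take j ys))"
    and eq: "h (first_occurrences h (take j ys) ! q) = h (ys ! j)"
    using assms(1) unfolding absorbs_def by blast
  obtain zs where "first_occurrences h ys = first_occurrences h (take j ys) @ zs"
    using first_occurrences_take by blast
  then have i: "?i = first_occurrences h (take j ys) ! q" using j(2) by (simp add: nth_append)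
  have "?i \<in> set (take j ys)"
    unfolding i using set_first_occurrences[of h "take j ys"] nth_mem[OF j(2)] by blast
  moreover have "sorted_wrt (<) (take j ys @ ys ! j # drop (Suc j) ys)"
    using sorted id_take_nth_drop[OF j(1)] by metis
  ultimately have less: "?i < ys ! j" by (simp add: sorted_wrt_append)
  have "ys ! j \<notin> set (first_occurrences h ys)"
  proof
    assume "ys ! j \<in> set (first_occurrences h ys)"
    moreover have "?i \<in> set (first_occurrences h ys)" using absorbs_length[OF assms(1)] by simp
    moreover have "inj_on h (set (first_occurrences h ys))"
      using distinct_first_occurrences[of h ys] by (simp add: distinct_map)
    ultimately have "?i = ys ! j" using eq i by (metis inj_onD)
    with less show False by simp
  qed
  then show ?thesis using that[of "ys ! j"] j(1) eq i less by simp
qed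

subsection \<open>The deterministic automaton of a finite semigroup\<close>

context finite_semigroup
begin

text \<open>The representatives are the oldest members of the classes of positions \<open>i < k\<close> with the same product
  of \<open>x i, \<dots>, x (k - 1)\<close>, and the profile lists these products. The profile is the state of a deterministic
  automaton whose colour is the age rank of the oldest class that absorbs another one.\<close>

definition representatives :: "(nat \<Rightarrow> 'a) \<Rightarrow> nat \<Rightarrow> nat list" where
  "representatives x k = first_occurrences (\<lambda>i. segment_product (\<^bold>*) x i k) [0..<k]"

definition profile :: "(nat \<Rightarrow> 'a) \<Rightarrow> nat \<Rightarrow> 'a list" where
  "profile x k = map (\<lambda>i. segment_product (\<^bold>*) x i k) (representatives x k)"

definition extended_profile :: "'a \<Rightarrow> 'a list \<Rightarrow> 'a list" where
  "extended_profile g ps = map (\<lambda>v. v \<^bold>* g) ps @ [g]"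

definition next_profile :: "'a \<Rightarrow> 'a list \<Rightarrow> 'a list" where
  "next_profile g ps = first_occurrences id (extended_profile g ps)"

definition profile_colour :: "'a \<Rightarrow> 'a list \<Rightarrow> nat" where
  "profile_colour g ps = (let q = (LEAST q. absorbs id (extended_profile g ps) q) in
     if \<exists>q. absorbs id (extended_profile g ps) q
     then q * card (C \<times> C) + to_nat_on (C \<times> C) (hd (next_profile g ps), next_profile g ps ! q)
     else card C * card (C \<times> C))"

definition colour :: "(nat \<Rightarrow> 'a) \<Rightarrow> nat \<Rightarrow> nat" where
  "colour x k = profile_colour (x k) (profile x k)"

definition absorbs_at :: "(nat \<Rightarrow> 'a) \<Rightarrow> nat \<Rightarrow> nat \<Rightarrow> bool" where
  "absorbs_at x k q \<longleftrightarrow> absorbs (\<lambda>i. segment_product (\<^bold>*) x i (Suc k)) (representatives x k @ [k]) q"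

lemma representatives_0 [simp]: "representatives x 0 = []"
  by (simp add: representatives_def)

lemma profile_0 [simp]: "profile x 0 = []"
  by (simp add: profile_def)

lemma representatives_Suc:
  "representatives x (Suc k) =
     first_occurrences (\<lambda>i. segment_product (\<^bold>*) x i (Suc k)) (representatives x k @ [k])"
proof -
  let ?h = "\<lambda>k i. segment_product (\<^bold>*) x i k"
  have "first_occurrences (?h (Suc k)) (representatives x k) = first_occurrences (?h (Suc k)) [0..<k]"
    unfolding representatives_def by (rule first_occurrences_coarser) (simp add: segment_product_Suc)
  then show ?thesis by (simp add: representatives_def[of x "Suc k"] first_occurrences_snoc)
qed

lemma representatives_less: "i \<in> set (representatives x k) \<Longrightarrow> i < k"
  using set_first_occurrences[of "\<lambda>i. segment_product (\<^bold>*) x i k" "[0..<k]"]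
  by (auto simp: representatives_def)

lemma sorted_representatives: "sorted_wrt (<) (representatives x k @ [k])"
  using representatives_less[of _ x k] sorted_first_occurrences[OF sorted_wrt_upt[of 0 k]]
  by (auto simp: sorted_wrt_append representatives_def)

lemma hd_representatives: "representatives x (Suc k) \<noteq> []" "hd (representatives x (Suc k)) = 0"
proof -
  let ?h = "\<lambda>i. segment_product (\<^bold>*) x i (Suc k)"
  have "[0..<Suc k] = [0] @ [1..<Suc k]" by (simp add: upt_conv_Cons)
  then obtain zs where "representatives x (Suc k) = first_occurrences ?h [0] @ zs"
    unfolding representatives_def using first_occurrences_append by metis
  moreover have "first_occurrences ?h [0] = [0]" using first_occurrences_snoc[of ?h "[]" 0] by simp
  ultimately show "representatives x (Suc k) \<noteq> []" "hd (representatives x (Suc k)) = 0" by simp_all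
qed

lemma extended_profile_eq:
  "extended_profile (x k) (profile x k) =
     map (\<lambda>i. segment_product (\<^bold>*) x i (Suc k)) (representatives x k @ [k])"
  by (auto simp: extended_profile_def profile_def segment_product_Suc representatives_less)

lemma profile_Suc: "profile x (Suc k) = next_profile (x k) (profile x k)"
  by (simp add: next_profile_def extended_profile_eq first_occurrences_map representatives_Suc
      profile_def[of x "Suc k"] del: list.map map_append)

lemma absorbs_extended_profile:
  "absorbs id (extended_profile (x k) (profile x k)) q \<longleftrightarrow> absorbs_at x k q"
  by (simp only: extended_profile_eq absorbs_map absorbs_at_def)

lemma absorbs_at_length: "absorbs_at x k q \<Longrightarrow> q < length (representatives x (Suc k))"
  unfolding absorbs_at_def representatives_Suc by (rule absorbs_length)

lemma distinct_profile: "distinct (profile x k)"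
  unfolding profile_def representatives_def by (rule distinct_first_occurrences)

lemma profile_cong: "(\<And>i. i < k \<Longrightarrow> x i = y i) \<Longrightarrow> profile x k = profile y k"
  by (induction k) (simp_all add: profile_Suc)

lemma absorbed_never_returns:
  assumes "i \<in> set (representatives x l)" "i < k" "k \<le> l"
  shows "i \<in> set (representatives x k)"
  using assms(3,1)
proof (induction l rule: dec_induct)
  case (step l)
  then have "i \<in> set (representatives x l @ [l])"
    using set_first_occurrences unfolding representatives_Suc by fast
  then show ?case using step assms(2) by auto
qed

lemma representative_stable:
  assumes "q < length (representatives x k)" and "\<And>l q'. k \<le> l \<Longrightarrow> q' < q \<Longrightarrow> \<not> absorbs_at x l q'"
    and "k \<le> l"
  shows "q < length (representatives x l) \<and> representatives x l ! q = representatives x k ! q"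
  using assms(3)
proof (induction l rule: dec_induct)
  case (step l)
  let ?h = "\<lambda>i. segment_product (\<^bold>*) x i (Suc l)"
  have q: "\<not> absorbs ?h (representatives x l @ [l]) q'" if "q' < q" for q'
    using assms(2)[OF step.hyps(1) that] by (simp add: absorbs_at_def)
  have "q < length (representatives x l @ [l])" using step.IH by simp
  with q have "q < length (representatives x (Suc l)) \<and>
      representatives x (Suc l) ! q = (representatives x l @ [l]) ! q"
    unfolding representatives_Suc using first_occurrences_nth_if_not_absorbs[of q ?h] by blast
  then show ?case using step.IH by (simp add: nth_append)
qed (simp add: assms(1))

lemma absorbs_atE:
  assumes "absorbs_at x k q"
  obtains r where "representatives x (Suc k) ! q < r" "r \<le> k" "r \<notin> set (representatives x (Suc k))"
    "r < k \<Longrightarrow> r \<in> set (representatives x k)"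
    "segment_product (\<^bold>*) x r (Suc k) = segment_product (\<^bold>*) x (representatives x (Suc k) ! q) (Suc k)"
proof -
  obtain r where "r \<in> set (representatives x k @ [k])" "r \<notin> set (representatives x (Suc k))"
    "segment_product (\<^bold>*) x r (Suc k) = segment_product (\<^bold>*) x (representatives x (Suc k) ! q) (Suc k)"
    "representatives x (Suc k) ! q < r"
    using absorbsE[OF assms[unfolded absorbs_at_def] sorted_representatives] unfolding representatives_Suc by blast
  then show ?thesis using that[of r] representatives_less[of r x k] by auto
qed

end

subsection \<open>Recurrent merges\<close>

context finite_semigroup
begin

definition recurrently_merged :: "(nat \<Rightarrow> 'a) \<Rightarrow> nat \<Rightarrow> 'a \<Rightarrow> 'a \<Rightarrow> bool" where
  "recurrently_merged x i t f \<longleftrightarrow> (\<forall>n. \<exists>r\<ge>n. \<exists>k>r. i < r \<and> segment_product (\<^bold>*) x r k = f \<and>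
     segment_product (\<^bold>*) x i k = f \<and> segment_product (\<^bold>*) x 0 k = t)"

context
  fixes x :: "nat \<Rightarrow> 'a"
  assumes x: "range x \<subseteq> C"
begin

lemma set_profile: "set (profile x k) \<subseteq> C"
  using representatives_less[of _ x k] segment_product_carrier[OF x] by (auto simp: profile_def)

lemma length_profile: "length (profile x k) \<le> card C"
  using distinct_card[OF distinct_profile[of x k]] card_mono[OF finite_carrier set_profile[of k]] by simp

lemma profile_pair:
  assumes "q < length (profile x (Suc k))"
  shows "(hd (profile x (Suc k)), profile x (Suc k) ! q) \<in> C \<times> C"
proof -
  have "profile x (Suc k) \<noteq> []" using assms by auto
  then show ?thesis using set_profile[of "Suc k"] nth_mem[OF assms] hd_in_set by blast
qed

lemma to_nat_on_less: "p \<in> C \<times> C \<Longrightarrow> to_nat_on (C \<times> C) p < card (C \<times> C)"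
  using to_nat_on_finite[of "C \<times> C"] finite_carrier unfolding bij_betw_def by blast

lemma colour_absorbing:
  assumes "absorbs_at x k q'"
  obtains q where "q \<le> q'" "absorbs_at x k q" "colour x k < card C * card (C \<times> C)"
    "colour x k div card (C \<times> C) = q"
    "colour x k mod card (C \<times> C) = to_nat_on (C \<times> C) (hd (profile x (Suc k)), profile x (Suc k) ! q)"
proof -
  define q where "q = (LEAST q. absorbs_at x k q)"
  define p where "p = to_nat_on (C \<times> C) (hd (profile x (Suc k)), profile x (Suc k) ! q)"
  have q: "absorbs_at x k q" "q \<le> q'" unfolding q_def using assms by (rule LeastI, rule Least_le)
  have colour: "colour x k = q * card (C \<times> C) + p"
    using assms
      by (auto simp: colour_def profile_colour_def Let_def absorbs_extended_profile profile_Suc p_def q_def)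
  have "q < length (profile x (Suc k))" using absorbs_at_length[OF q(1)] by (simp add: profile_def)
  then have p: "p < card (C \<times> C)" and "q < card C"
    unfolding p_def using to_nat_on_less[OF profile_pair] length_profile[of "Suc k"] by auto
  then have "Suc q * card (C \<times> C) \<le> card C * card (C \<times> C)" by (intro mult_le_mono1) simp
  then have "colour x k < card C * card (C \<times> C)" using p colour by simp
  moreover have "colour x k div card (C \<times> C) = q" "colour x k mod card (C \<times> C) = p"
    unfolding colour using p by simp_all
  ultimately show ?thesis using that q by (simp add: p_def)
qed

lemma colour_not_absorbing: "(\<And>q. \<not> absorbs_at x k q) \<Longrightarrow> colour x k = card C * card (C \<times> C)"
  by (simp add: colour_def profile_colour_def Let_def absorbs_extended_profile)

lemma colour_le: "colour x k \<le> card C * card (C \<times> C)"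
  using colour_absorbing[of k] colour_not_absorbing[of k] by (metis less_imp_le order_refl)

lemma absorption_recurrent: "\<exists>\<^sub>\<infinity>k. \<exists>q. absorbs_at x k q"
proof (rule ccontr)
  assume "\<not> ?thesis"
  then obtain n where n: "\<And>k q. n \<le> k \<Longrightarrow> \<not> absorbs_at x k q" by (auto simp: MOST_nat_le)
  have "representatives x (Suc k) = representatives x k @ [k]" if "n \<le> k" for k
    unfolding representatives_Suc
    using first_occurrences_eq_if_not_absorbs n[OF that] unfolding absorbs_at_def by blast
  then have "length (profile x (n + m)) = length (profile x n) + m" for m
    by (induction m) (simp_all add: profile_def)
  from this[of "Suc (card C)"] show False using length_profile[of "n + Suc (card C)"] by simp
qed

lemma least_colour_less: "least_recurrent (colour x) < card C * card (C \<times> C)"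
proof -
  have "\<forall>\<^sub>\<infinity>k. least_recurrent (colour x) \<le> colour x k" by (rule least_recurrent_bounded(2)[OF colour_le])
  then obtain k q where "least_recurrent (colour x) \<le> colour x k" "absorbs_at x k q"
    using INFM_EX[OF INFM_conjI[OF absorption_recurrent]] by blast
  then show ?thesis using colour_absorbing le_less_trans by metis
qed

lemma infinitely_many_absorbed:
  assumes K: "infinite K" and r: "\<And>k. k \<in> K \<Longrightarrow> r k \<le> k \<and> r k \<notin> set (representatives x (Suc k)) \<and>
    (r k < k \<longrightarrow> r k \<in> set (representatives x k))"
  shows "\<exists>k\<in>K. n \<le> r k"
proof -
  have "r k \<noteq> r l" if "k \<in> K" "l \<in> K" "k < l" for k l
    using absorbed_never_returns[of "r k" x l "Suc k"] r[OF that(1)] r[OF that(2)] that(3) by auto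
  then have "inj_on r K" by (rule linorder_inj_onI) auto
  then have "infinite (r ` K)" using K finite_image_iff by blast
  then show ?thesis unfolding infinite_nat_iff_unbounded_le by blast
qed

lemma no_absorption_below_least_colour:
  "\<forall>\<^sub>\<infinity>k. \<forall>q<least_recurrent (colour x) div card (C \<times> C). \<not> absorbs_at x k q"
proof (rule MOST_mono[OF least_recurrent_bounded(2)[OF colour_le]], intro allI impI notI)
  fix k q assume le: "least_recurrent (colour x) \<le> colour x k"
    and less: "q < least_recurrent (colour x) div card (C \<times> C)" and "absorbs_at x k q"
  then obtain q' where "q' \<le> q" "colour x k div card (C \<times> C) = q'" using colour_absorbing by blast
  with div_le_mono[OF le, of "card (C \<times> C)"] less show False by linarith
qed

lemma absorbs_at_least_colour:
  assumes tf: "(t, f) \<in> C \<times> C" "to_nat_on (C \<times> C) (t, f) = least_recurrent (colour x) mod card (C \<times> C)"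
    and k: "colour x k = least_recurrent (colour x)" and q: "q = least_recurrent (colour x) div card (C \<times> C)"
  shows "absorbs_at x k q" "hd (profile x (Suc k)) = t" "profile x (Suc k) ! q = f"
proof -
  obtain q' where "absorbs_at x k q'"
    using colour_not_absorbing[of k] least_colour_less k by (metis less_irrefl)
  then show absorbs: "absorbs_at x k q" using colour_absorbing[of k] k q by metis
  have eq: "to_nat_on (C \<times> C) (hd (profile x (Suc k)), profile x (Suc k) ! q) = to_nat_on (C \<times> C) (t, f)"
    using colour_absorbing[OF \<open>absorbs_at x k q'\<close>] k q tf(2) by metis
  have "q < length (profile x (Suc k))" using absorbs_at_length[OF absorbs] by (simp add: profile_def)
  from profile_pair[OF this] have "(hd (profile x (Suc k)), profile x (Suc k) ! q) = (t, f)"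
    using eq tf(1) finite_carrier by (simp add: countable_finite)
  then show "hd (profile x (Suc k)) = t" "profile x (Suc k) ! q = f" by simp_all
qed

text \<open>The representative with the rank given by the least recurrent colour eventually does not change, and
  it absorbs infinitely many positions, since an absorbed position never becomes a representative again.\<close>

lemma recurrently_merged_exists:
  assumes tf: "(t, f) \<in> C \<times> C" "to_nat_on (C \<times> C) (t, f) = least_recurrent (colour x) mod card (C \<times> C)"
  obtains i where "recurrently_merged x i t f"
proof -
  define m where "m = least_recurrent (colour x)"
  define q where "q = m div card (C \<times> C)"
  note at_m = absorbs_at_least_colour[OF tf, folded m_def, OF _ q_def]
  have recurrent: "\<exists>\<^sub>\<infinity>k. colour x k = m"
    unfolding m_def by (rule least_recurrent_bounded(1)[OF colour_le])
  obtain N where below: "\<And>k q'. N \<le> k \<Longrightarrow> q' < q \<Longrightarrow> \<not> absorbs_at x k q'"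
    using no_absorption_below_least_colour unfolding MOST_nat_le q_def m_def by blast
  obtain k\<^sub>0 where k\<^sub>0: "N \<le> k\<^sub>0" "colour x k\<^sub>0 = m" using recurrent unfolding INFM_nat_le by blast
  define i where "i = representatives x (Suc k\<^sub>0) ! q"
  have stable: "q < length (representatives x (Suc k))" "representatives x (Suc k) ! q = i" if "k\<^sub>0 \<le> k" for k
    using representative_stable[OF absorbs_at_length[OF at_m(1)[OF k\<^sub>0(2)]], of "Suc k"] below k\<^sub>0(1) that
    by (auto simp: i_def)
  have at_m_product: "segment_product (\<^bold>*) x i (Suc k) = f" "segment_product (\<^bold>*) x 0 (Suc k) = t"
    if "k\<^sub>0 \<le> k" "colour x k = m" for k
    using at_m(2,3)[OF that(2)] stable[OF that(1)] hd_representatives[of x k]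
    by (simp_all add: profile_def hd_map)
  define K where "K = {k. k\<^sub>0 \<le> k \<and> colour x k = m}"
  have "\<exists>r. i < r \<and> r \<le> k \<and> r \<notin> set (representatives x (Suc k)) \<and>
      (r < k \<longrightarrow> r \<in> set (representatives x k)) \<and> segment_product (\<^bold>*) x r (Suc k) = f" if "k \<in> K" for k
    using absorbs_atE[OF at_m(1)] stable(2) at_m_product(1) that unfolding K_def mem_Collect_eq by metis
  then obtain r where r: "\<And>k. k \<in> K \<Longrightarrow> i < r k \<and> r k \<le> k \<and> r k \<notin> set (representatives x (Suc k)) \<and>
      (r k < k \<longrightarrow> r k \<in> set (representatives x k)) \<and> segment_product (\<^bold>*) x (r k) (Suc k) = f" by metis
  have "infinite K"
    unfolding K_def infinite_nat_iff_unbounded_le using recurrent unfolding INFM_nat_le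
    by (metis (mono_tags, lifting) mem_Collect_eq nat_le_linear order.trans)
  have "recurrently_merged x i t f" unfolding recurrently_merged_def
  proof
    fix n
    obtain k where "k \<in> K" "n \<le> r k" using infinitely_many_absorbed[OF \<open>infinite K\<close>, of r n] r by blast
    then show "\<exists>r\<ge>n. \<exists>k>r. i < r \<and> segment_product (\<^bold>*) x r k = f \<and>
        segment_product (\<^bold>*) x i k = f \<and> segment_product (\<^bold>*) x 0 k = t"
      using r[of k] at_m_product[of k] by (intro exI[of _ "r k"] conjI exI[of _ "Suc k"]) (auto simp: K_def)
  qed
  then show ?thesis by (rule that)
qed

end

end

subsection \<open>The winning colours\<close>

context finite_semigroup
begin

definition merge_pair :: "'a set \<Rightarrow> 'a \<Rightarrow> 'a \<Rightarrow> 'a \<Rightarrow> bool" where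
  "merge_pair H t f e \<longleftrightarrow> t \<in> generated (\<^bold>*) H \<and> f \<in> generated (\<^bold>*) H \<and>
     (\<exists>g\<in>generated (\<^bold>*) H. e = g \<^bold>* f) \<and> f \<^bold>* e = f \<and> t \<^bold>* e = t"

lemma merge_pair_mult:
  assumes "merge_pair H t f e" "merge_pair H t f e'"
  shows "e \<^bold>* e' = e"
proof -
  obtain g where "e = g \<^bold>* f" "f \<^bold>* e' = f" using assms by (auto simp: merge_pair_def)
  then show ?thesis by (simp add: assoc)
qed

lemma merge_pair_generated: "merge_pair H t f e \<Longrightarrow> t \<in> generated (\<^bold>*) H \<and> e \<in> generated (\<^bold>*) H"
  unfolding merge_pair_def by (blast intro: generated.mult)

lemma recurrently_merged_checkpoints:
  assumes "recurrently_merged x i t f"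
  obtains \<kappa> where "\<kappa> 0 = 0" "strict_mono \<kappa>"
    "\<And>j. i < \<kappa> (Suc j) \<and> segment_product (\<^bold>*) x 0 (\<kappa> (Suc j)) = t \<and>
        segment_product (\<^bold>*) x i (\<kappa> (Suc j)) = f"
    "\<And>j. \<exists>r. \<kappa> j < r \<and> r < \<kappa> (Suc j) \<and> segment_product (\<^bold>*) x r (\<kappa> (Suc j)) = f"
proof -
  have "\<exists>k. \<exists>r\<ge>n. r < k \<and> i < r \<and> segment_product (\<^bold>*) x r k = f \<and>
      segment_product (\<^bold>*) x i k = f \<and> segment_product (\<^bold>*) x 0 k = t" for n
    using assms unfolding recurrently_merged_def by blast
  then obtain k where k: "\<And>n. \<exists>r\<ge>n. r < k n \<and> i < r \<and> segment_product (\<^bold>*) x r (k n) = f \<and>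
      segment_product (\<^bold>*) x i (k n) = f \<and> segment_product (\<^bold>*) x 0 (k n) = t" by metis
  define \<kappa> where "\<kappa> = rec_nat 0 (\<lambda>_ n. k (Suc n))"
  have \<kappa>: "\<kappa> 0 = 0" "\<kappa> (Suc j) = k (Suc (\<kappa> j))" for j by (simp_all add: \<kappa>_def)
  show ?thesis
  proof (rule that[of \<kappa>])
    show "\<kappa> 0 = 0" by (rule \<kappa>(1))
    show "\<exists>r. \<kappa> j < r \<and> r < \<kappa> (Suc j) \<and> segment_product (\<^bold>*) x r (\<kappa> (Suc j)) = f" for j
      using k[of "Suc (\<kappa> j)"] by (auto simp: \<kappa>(2) Suc_le_eq)
    then show "strict_mono \<kappa>" unfolding strict_mono_Suc_iff by (meson order.strict_trans)
    show "i < \<kappa> (Suc j) \<and> segment_product (\<^bold>*) x 0 (\<kappa> (Suc j)) = t \<and>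
        segment_product (\<^bold>*) x i (\<kappa> (Suc j)) = f" for j
      using k[of "Suc (\<kappa> j)"] by (auto simp: \<kappa>(2))
  qed
qed

lemma recurrently_merged_factorization:
  assumes x: "range x \<subseteq> H" "H \<subseteq> C" and merged: "recurrently_merged x i t f"
  obtains \<rho> e where "factorization (\<^bold>*) x \<rho> t e" "merge_pair H t f e"
proof -
  obtain \<kappa> where \<kappa>: "\<kappa> 0 = 0" "strict_mono \<kappa>"
    and at_\<kappa>: "\<And>j. i < \<kappa> (Suc j) \<and> segment_product (\<^bold>*) x 0 (\<kappa> (Suc j)) = t \<and>
        segment_product (\<^bold>*) x i (\<kappa> (Suc j)) = f"
    and merge: "\<And>j. \<exists>r. \<kappa> j < r \<and> r < \<kappa> (Suc j) \<and> segment_product (\<^bold>*) x r (\<kappa> (Suc j)) = f"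
    using recurrently_merged_checkpoints[OF merged] by metis
  define z where "z j = segment_product (\<^bold>*) x (\<kappa> j) (\<kappa> (Suc j))" for j
  have "range z \<subseteq> C"
    unfolding z_def using segment_product_carrier x \<kappa>(2) by (auto simp: strict_mono_less)
  then obtain \<rho> s e where z: "factorization (\<^bold>*) z \<rho> s e" by (rule factorization_exists)
  have fac: "factorization (\<^bold>*) x (\<lambda>j. \<kappa> (\<rho> j)) s e" by (rule factorization_segments[OF \<kappa>(2,1) z_def z])
  have "strict_mono \<rho>" using z by (simp add: factorization_def)
  then have "\<rho> 0 < \<rho> 1" "\<rho> 1 < \<rho> 2" by (simp_all add: strict_mono_less del: One_nat_def)
  then obtain a b where ab: "\<rho> 1 = Suc a" "\<rho> 2 = Suc b" "Suc a \<le> b"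
    by (cases "\<rho> 1"; cases "\<rho> 2") auto
  have s: "s = segment_product (\<^bold>*) x 0 (\<kappa> (Suc a))" and e: "e = segment_product (\<^bold>*) x (\<kappa> (Suc a)) (\<kappa> (Suc b))"
    using fac ab unfolding factorization_def
    by (metis One_nat_def \<kappa>(1) lasso.simps(1), metis One_nat_def Suc_1 lasso.simps(2))
  have "s = t" using at_\<kappa>[of a] by (simp add: s)
  obtain r where r: "\<kappa> b < r" "r < \<kappa> (Suc b)" "segment_product (\<^bold>*) x r (\<kappa> (Suc b)) = f" using merge by blast
  have less: "\<kappa> (Suc a) < r" using r(1) ab(3) \<kappa>(2) by (meson le_less_trans strict_mono_less_eq)
  have "e = segment_product (\<^bold>*) x (\<kappa> (Suc a)) r \<^bold>* f"
    unfolding e by (simp add: segment_product_split[OF less r(2)] r(3))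
  moreover have "f \<^bold>* e = f"
    using segment_product_split[of i "\<kappa> (Suc a)" "\<kappa> (Suc b)" x] at_\<kappa> less r(2) by (simp add: e)
  moreover have "t \<^bold>* e = t" using fac \<open>s = t\<close> by (simp add: factorization_def linked_pair_def)
  moreover have "segment_product (\<^bold>*) x j k \<in> generated (\<^bold>*) H" if "j < k" for j k
    by (rule segment_product_generated[OF x(1) that])
  ultimately have "merge_pair H t f e"
    unfolding merge_pair_def using less r at_\<kappa> by (metis gr_implies_not_zero neq0_conv)
  then show ?thesis using that fac \<open>s = t\<close> by blast
qed

definition factorization_invariant :: "'a set \<Rightarrow> ('a \<Rightarrow> 'a \<Rightarrow> bool) \<Rightarrow> bool" where
  "factorization_invariant H acc \<longleftrightarrow> (\<forall>x \<rho> s e \<rho>' s' e'. range x \<subseteq> H \<longrightarrow>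
     factorization (\<^bold>*) x \<rho> s e \<longrightarrow> factorization (\<^bold>*) x \<rho>' s' e' \<longrightarrow> acc s e = acc s' e')"

text \<open>The sequence \<open>t e\<^sub>1 e\<^sub>2 e\<^sub>1 e\<^sub>2 \<dots>\<close> has factorizations of both kinds.\<close>

lemma merge_pairs_agree:
  assumes inv: "factorization_invariant H acc"
    and e\<^sub>1: "merge_pair H t f e\<^sub>1" and e\<^sub>2: "merge_pair H t f e\<^sub>2"
  shows "acc t e\<^sub>1 = acc t e\<^sub>2"
proof -
  define z where "z j = (if j = 0 then t else if odd j then e\<^sub>1 else e\<^sub>2)" for j :: nat
  have mult: "e\<^sub>1 \<^bold>* e\<^sub>1 = e\<^sub>1" "e\<^sub>2 \<^bold>* e\<^sub>2 = e\<^sub>2" "e\<^sub>1 \<^bold>* e\<^sub>2 = e\<^sub>1" "e\<^sub>2 \<^bold>* e\<^sub>1 = e\<^sub>2"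
    "t \<^bold>* e\<^sub>1 = t" "t \<^bold>* e\<^sub>2 = t"
    using merge_pair_mult[OF e\<^sub>1 e\<^sub>1] merge_pair_mult[OF e\<^sub>2 e\<^sub>2]
      merge_pair_mult[OF e\<^sub>1 e\<^sub>2] merge_pair_mult[OF e\<^sub>2 e\<^sub>1] e\<^sub>1 e\<^sub>2
    unfolding merge_pair_def by blast+
  have z_even: "z (2 * i) = (if i = 0 then t else e\<^sub>2)" and z_odd: "z (Suc (2 * i)) = e\<^sub>1" for i
    by (simp_all add: z_def)
  have two_factors: "segment_product (\<^bold>*) z j (Suc (Suc j)) = z j \<^bold>* z (Suc j)" for j
    by (simp add: segment_product_Suc)
  have "z j \<in> generated (\<^bold>*) H" for j
    using merge_pair_generated e\<^sub>1 e\<^sub>2 by (simp add: z_def)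
  then obtain x \<kappa> where x: "range x \<subseteq> H" "\<kappa> 0 = 0" "strict_mono \<kappa>"
    "\<And>j. segment_product (\<^bold>*) x (\<kappa> j) (\<kappa> (Suc j)) = z j"
    by (rule sequence_with_segment_products[of z H]) blast
  have "segment_product (\<^bold>*) z (2 * i - 1) (2 * Suc i - 1) = lasso t e\<^sub>1 i" for i
    using two_factors[of "2 * i - 1"] mult by (cases i) (simp_all add: z_def)
  then have "factorization (\<^bold>*) z (\<lambda>i. 2 * i - 1) t e\<^sub>1"
    using mult by (auto simp: factorization_def linked_pair_def strict_mono_Suc_iff)
  moreover have "segment_product (\<^bold>*) z (2 * i) (Suc (Suc (2 * i))) = lasso t e\<^sub>2 i" for i
    unfolding two_factors z_even z_odd using mult by (cases i) simp_all
  then have "factorization (\<^bold>*) z (\<lambda>i. 2 * i) t e\<^sub>2"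
    using mult by (simp add: factorization_def linked_pair_def strict_mono_def)
  ultimately show ?thesis
    using inv x(1) factorization_segments[OF x(3,2) x(4)[symmetric]] unfolding factorization_invariant_def by metis
qed

definition good_colour :: "'a set \<Rightarrow> ('a \<Rightarrow> 'a \<Rightarrow> bool) \<Rightarrow> nat \<Rightarrow> bool" where
  "good_colour H acc m \<longleftrightarrow> (\<exists>t f e. (t, f) \<in> C \<times> C \<and> to_nat_on (C \<times> C) (t, f) = m mod card (C \<times> C) \<and>
     merge_pair H t f e \<and> acc t e)"

theorem good_colour_iff_acc:
  assumes H: "H \<subseteq> C" and inv: "factorization_invariant H acc"
    and x: "range x \<subseteq> H" and fac: "factorization (\<^bold>*) x \<rho> s e"
  shows "good_colour H acc (least_recurrent (colour x)) \<longleftrightarrow> acc s e"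
proof -
  define m where "m = least_recurrent (colour x)"
  have index: "bij_betw (to_nat_on (C \<times> C)) (C \<times> C) {..<card (C \<times> C)}"
    by (rule to_nat_on_finite) (simp add: finite_carrier)
  have xC: "range x \<subseteq> C" using x H by blast
  then have "0 < card (C \<times> C)" using finite_carrier by (auto simp: card_gt_0_iff)
  then have "m mod card (C \<times> C) \<in> to_nat_on (C \<times> C) ` (C \<times> C)" using index by (simp add: bij_betw_def)
  then obtain t f where tf: "(t, f) \<in> C \<times> C" "to_nat_on (C \<times> C) (t, f) = m mod card (C \<times> C)" by auto
  obtain i where "recurrently_merged x i t f" using recurrently_merged_exists[OF xC tf[unfolded m_def]] .
  then obtain \<rho>' e' where e': "factorization (\<^bold>*) x \<rho>' t e'" "merge_pair H t f e'"
    by (rule recurrently_merged_factorization[OF x H])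
  have "good_colour H acc m \<longleftrightarrow> acc t e'"
  proof
    show "good_colour H acc m" if "acc t e'" unfolding good_colour_def using tf e'(2) that by blast
    assume "good_colour H acc m"
    then obtain t\<^sub>2 f\<^sub>2 e\<^sub>2 where good: "(t\<^sub>2, f\<^sub>2) \<in> C \<times> C" "to_nat_on (C \<times> C) (t\<^sub>2, f\<^sub>2) = m mod card (C \<times> C)"
      "merge_pair H t\<^sub>2 f\<^sub>2 e\<^sub>2" "acc t\<^sub>2 e\<^sub>2" unfolding good_colour_def by blast
    then have "(t\<^sub>2, f\<^sub>2) = (t, f)" using tf by (intro inj_onD[OF bij_betw_imp_inj_on[OF index]]) simp_all
    then show "acc t e'" using merge_pairs_agree[OF inv e'(2)] good by blast
  qed
  also have "\<dots> \<longleftrightarrow> acc s e" using inv x fac e'(1) unfolding factorization_invariant_def by blast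
  finally show ?thesis by (simp add: m_def)
qed

end

section \<open>Certificates for games with a semigroup winning condition\<close>

subsection \<open>Compositions of transitions\<close>

inductive_set compositions :: "('s \<Rightarrow> 's \<Rightarrow> 's) \<Rightarrow> ('q \<times> 's \<times> 'q) set \<Rightarrow> ('q \<times> 's \<times> 'q) set" for m T where
  base: "(p, v, q) \<in> T \<Longrightarrow> (p, v, q) \<in> compositions m T"
| compose: "(p, v, q) \<in> compositions m T \<Longrightarrow> (q, w, r) \<in> compositions m T \<Longrightarrow> (p, m v w, r) \<in> compositions m T"

lemma compositions_subset:
  assumes "T \<subseteq> Q \<times> C \<times> Q" "\<And>a b. a \<in> C \<Longrightarrow> b \<in> C \<Longrightarrow> m a b \<in> C"
  shows "compositions m T \<subseteq> Q \<times> C \<times> Q"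
proof
  have "p \<in> Q \<and> v \<in> C \<and> q \<in> Q" if "(p, v, q) \<in> compositions m T" for p v q
    using that by induction (use assms in auto)
  then show "r \<in> Q \<times> C \<times> Q" if "r \<in> compositions m T" for r
    using that by (cases r) auto
qed

context semigroup
begin

lemma composition_is_path:
  "(p, v, q) \<in> compositions (\<^bold>*) T \<Longrightarrow> \<exists>ts. ts \<noteq> [] \<and> set ts \<subseteq> T \<and>
     successively (\<lambda>t u. snd (snd t) = fst u) ts \<and> fst (hd ts) = p \<and> snd (snd (last ts)) = q \<and>
     list_product (\<^bold>*) (map (\<lambda>t. fst (snd t)) ts) = v"
proof (induction rule: compositions.induct)
  case (base p v q)
  then show ?case by (intro exI[of _ "[(p, v, q)]"]) simp
next
  case (compose p v q w r)
  from compose.IH(1) obtain ts where "ts \<noteq> []" "set ts \<subseteq> T" "successively (\<lambda>t u. snd (snd t) = fst u) ts"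
    "fst (hd ts) = p" "snd (snd (last ts)) = q" "list_product (\<^bold>*) (map (\<lambda>t. fst (snd t)) ts) = v" by blast
  moreover from compose.IH(2) obtain us where "us \<noteq> []" "set us \<subseteq> T"
    "successively (\<lambda>t u. snd (snd t) = fst u) us" "fst (hd us) = q" "snd (snd (last us)) = r"
    "list_product (\<^bold>*) (map (\<lambda>t. fst (snd t)) us) = w" by blast
  ultimately show ?case
    by (intro exI[of _ "ts @ us"]) (simp add: successively_append_iff list_product_append)
qed

lemma lasso_path:
  assumes "(q\<^sub>0, t, q) \<in> compositions (\<^bold>*) T" "(q, e, q) \<in> compositions (\<^bold>*) T"
    and linked: "linked_pair (\<^bold>*) t e"
  obtains s y \<rho> where "s 0 = q\<^sub>0" "\<And>n. (s n, y n, s (Suc n)) \<in> T" "factorization (\<^bold>*) y \<rho> t e"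
proof -
  have "(lasso q\<^sub>0 q j, lasso t e j, q) \<in> compositions (\<^bold>*) T" for j using assms by (cases j) auto
  then have "\<exists>ts. ts \<noteq> [] \<and> set ts \<subseteq> T \<and> successively (\<lambda>t u. snd (snd t) = fst u) ts \<and>
      fst (hd ts) = lasso q\<^sub>0 q j \<and> snd (snd (last ts)) = q \<and>
      list_product (\<^bold>*) (map (\<lambda>t. fst (snd t)) ts) = lasso t e j" for j
    by (rule composition_is_path)
  then obtain ws where ws: "\<And>j. ws j \<noteq> []" "\<And>j. set (ws j) \<subseteq> T"
    "\<And>j. successively (\<lambda>t u. snd (snd t) = fst u) (ws j)"
    and ends: "\<And>j. fst (hd (ws j)) = lasso q\<^sub>0 q j" "\<And>j. snd (snd (last (ws j))) = q"
    and product: "\<And>j. list_product (\<^bold>*) (map (\<lambda>t. fst (snd t)) (ws j)) = lasso t e j" by metis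
  obtain r \<kappa> where \<kappa>: "\<kappa> 0 = 0" "strict_mono \<kappa>" and r: "\<And>j. map r [\<kappa> j..<\<kappa> (Suc j)] = ws j"
    by (rule infinite_concat[of ws, OF ws(1)]) blast
  have less: "\<kappa> j < \<kappa> (Suc j)" for j using \<kappa>(2) by (simp add: strict_mono_less)
  have hd_r: "r (\<kappa> j) = hd (ws j)" and last_r: "r (\<kappa> (Suc j) - 1) = last (ws j)" for j
    using less[of j] by (simp_all flip: r add: hd_map last_map)
  have chain: "snd (snd (r n)) = fst (r (Suc n))" for n
    by (rule adjacent_if_segments[OF \<kappa>, of "\<lambda>t u. snd (snd t) = fst u"])
      (simp_all add: r ws(3) hd_r last_r ends del: One_nat_def)
  have "range r \<subseteq> T" by (rule range_subset_if_segments[OF \<kappa>]) (simp only: r ws(2))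
  then have T: "(fst (r n), fst (snd (r n)), fst (r (Suc n))) \<in> T" for n
    using chain[of n] by (metis prod.collapse rangeI subsetD)
  have "segment_product (\<^bold>*) (\<lambda>n. fst (snd (r n))) (\<kappa> j) (\<kappa> (Suc j)) = lasso t e j" for j
    using product[of j] by (simp add: segment_product_def comp_def flip: r)
  then have "factorization (\<^bold>*) (\<lambda>n. fst (snd (r n))) \<kappa> t e"
    using \<kappa> linked by (simp add: factorization_def)
  moreover have "fst (r 0) = q\<^sub>0" using hd_r[of 0] \<kappa>(1) ends(1)[of 0] by simp
  ultimately show ?thesis using that[of "\<lambda>n. fst (r n)" "\<lambda>n. fst (snd (r n))" \<kappa>] T by simp
qed

end

subsection \<open>Certificates\<close>

text \<open>In position \<open>v\<close> the player \<open>False\<close> chooses \<open>a \<in> A\<close>, the player \<open>True\<close> answers with \<open>b \<in> B\<close>, the value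
  \<open>h v a b\<close> is recorded and the next position is \<open>\<delta> v a b\<close>. The play is won by \<open>True\<close> iff the factorizations
  of the recorded sequence satisfy \<open>acc\<close>.\<close>

locale semigroup_game =
  fixes mul :: "'s \<Rightarrow> 's \<Rightarrow> 's" and acc :: "'s \<Rightarrow> 's \<Rightarrow> bool" and A :: "'a set" and B :: "'b set"
    and \<delta> :: "'v \<Rightarrow> 'a \<Rightarrow> 'b \<Rightarrow> 'v" and h :: "'v \<Rightarrow> 'a \<Rightarrow> 'b \<Rightarrow> 's" and v\<^sub>0 :: 'v
begin

definition round_allowed ::
    "('q \<Rightarrow> 'v) \<Rightarrow> 'q set \<Rightarrow> ('q \<times> 's \<times> 'q) set \<Rightarrow> 'q \<Rightarrow> 'a \<Rightarrow> 'b \<Rightarrow> bool" where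
  "round_allowed pos Q R q a b \<longleftrightarrow> (\<exists>q'\<in>Q. pos q' = \<delta> (pos q) a b \<and> (q, h (pos q) a b, q') \<in> R)"

text \<open>\<open>R\<close> is a set of values of play segments between states, closed under composition, so that winning is
  a condition on the linked pairs in \<open>R\<close> alone.\<close>

definition certificate ::
    "('q \<Rightarrow> 'v) \<Rightarrow> bool \<Rightarrow> 'q set \<Rightarrow> ('q \<times> 's \<times> 'q) set \<Rightarrow> 'q \<Rightarrow> bool" where
  "certificate pos pl Q R q\<^sub>0 \<longleftrightarrow> finite Q \<and> finite R \<and> q\<^sub>0 \<in> Q \<and> pos q\<^sub>0 = v\<^sub>0 \<and>
     (\<forall>p v q w r. (p, v, q) \<in> R \<longrightarrow> (q, w, r) \<in> R \<longrightarrow> (p, mul v w, r) \<in> R) \<and>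
     (if pl then \<forall>q\<in>Q. \<forall>a\<in>A. \<exists>b\<in>B. round_allowed pos Q R q a b
      else \<forall>q\<in>Q. \<exists>a\<in>A. \<forall>b\<in>B. round_allowed pos Q R q a b) \<and>
     (\<forall>t e q. (q\<^sub>0, t, q) \<in> R \<longrightarrow> (q, e, q) \<in> R \<longrightarrow> linked_pair mul t e \<longrightarrow> acc t e = pl)"

lemma certificate_finite: "certificate pos pl Q R q\<^sub>0 \<Longrightarrow> finite Q \<and> finite R"
  and certificate_initial: "certificate pos pl Q R q\<^sub>0 \<Longrightarrow> q\<^sub>0 \<in> Q \<and> pos q\<^sub>0 = v\<^sub>0"
  and certificate_compose: "certificate pos pl Q R q\<^sub>0 \<Longrightarrow> (p, v, q) \<in> R \<Longrightarrow> (q, w, r) \<in> R \<Longrightarrow> (p, mul v w, r) \<in> R"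
  and certificate_acc: "certificate pos pl Q R q\<^sub>0 \<Longrightarrow> (q\<^sub>0, t, q) \<in> R \<Longrightarrow> (q, e, q) \<in> R \<Longrightarrow>
    linked_pair mul t e \<Longrightarrow> acc t e = pl"
  and certificate_True: "certificate pos True Q R q\<^sub>0 \<Longrightarrow> q \<in> Q \<Longrightarrow> a \<in> A \<Longrightarrow> \<exists>b\<in>B. round_allowed pos Q R q a b"
  and certificate_False: "certificate pos False Q R q\<^sub>0 \<Longrightarrow> q \<in> Q \<Longrightarrow> \<exists>a\<in>A. \<forall>b\<in>B. round_allowed pos Q R q a b"
  by (simp add: certificate_def, (blast)?)+

definition map_states :: "('q \<Rightarrow> 'p) \<Rightarrow> ('q \<times> 's \<times> 'q) set \<Rightarrow> ('p \<times> 's \<times> 'p) set" where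
  "map_states g R = (\<lambda>(p, v, q). (g p, v, g q)) ` R"

lemma map_states_iff: "inj g \<Longrightarrow> (g p, v, g q) \<in> map_states g R \<longleftrightarrow> (p, v, q) \<in> R"
  by (auto simp: map_states_def inj_eq image_iff split: prod.splits)

lemma map_states_range: "(p, v, q) \<in> map_states g R \<Longrightarrow> \<exists>p' q'. p = g p' \<and> q = g q'"
  by (auto simp: map_states_def)

lemma round_allowed_map:
  assumes "inj g" "\<And>q. pos' (g q) = pos q" "round_allowed pos Q R q a b"
  shows "round_allowed pos' (g ` Q) (map_states g R) (g q) a b"
  using assms(2,3) map_states_iff[OF assms(1)] unfolding round_allowed_def by auto

lemma certificate_map:
  assumes g: "inj g" "\<And>q. pos' (g q) = pos q" and cert: "certificate pos pl Q R q\<^sub>0"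
  shows "certificate pos' pl (g ` Q) (map_states g R) (g q\<^sub>0)"
  unfolding certificate_def
proof (intro conjI allI impI)
  note R = map_states_iff[OF g(1)] and allowed = round_allowed_map[where pos = pos and pos' = pos', OF g]
  show "finite (g ` Q)" "finite (map_states g R)" "g q\<^sub>0 \<in> g ` Q" "pos' (g q\<^sub>0) = v\<^sub>0"
    using certificate_finite[OF cert] certificate_initial[OF cert] g(2) by (simp_all add: map_states_def)
  show "(p, mul v w, r) \<in> map_states g R"
    if pv: "(p, v, q) \<in> map_states g R" and qw: "(q, w, r) \<in> map_states g R" for p v q w r
  proof -
    obtain p' q' r' where eq: "p = g p'" "q = g q'" "r = g r'"
      using map_states_range[OF pv] map_states_range[OF qw] by blast
    show ?thesis using pv qw certificate_compose[OF cert] unfolding eq R by blast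
  qed
  show "if pl then \<forall>q\<in>g ` Q. \<forall>a\<in>A. \<exists>b\<in>B. round_allowed pos' (g ` Q) (map_states g R) q a b
      else \<forall>q\<in>g ` Q. \<exists>a\<in>A. \<forall>b\<in>B. round_allowed pos' (g ` Q) (map_states g R) q a b"
  proof (cases pl)
    case True
    with cert have "certificate pos True Q R q\<^sub>0" by simp
    from certificate_True[OF this] have "\<forall>q\<in>Q. \<forall>a\<in>A. \<exists>b\<in>B. round_allowed pos Q R q a b" by blast
    with True show ?thesis using allowed by simp meson
  next
    case False
    with cert have "certificate pos False Q R q\<^sub>0" by simp
    from certificate_False[OF this] have "\<forall>q\<in>Q. \<exists>a\<in>A. \<forall>b\<in>B. round_allowed pos Q R q a b" by blast
    with False show ?thesis using allowed by simp meson
  qed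
  show "acc t e = pl"
    if tq: "(g q\<^sub>0, t, q) \<in> map_states g R" and qe: "(q, e, q) \<in> map_states g R"
      and "linked_pair mul t e" for t e q
  proof -
    obtain q' where "q = g q'" using map_states_range[OF qe] by blast
    then show ?thesis using tq qe that(3) certificate_acc[OF cert] by (simp add: R)
  qed
qed

end

lemma (in finite_semigroup) certificate_play:
  assumes cert: "semigroup_game.certificate (\<^bold>*) acc A B \<delta> h v\<^sub>0 pos pl Q R q\<^sub>0"
    and q: "q 0 = q\<^sub>0" "\<And>n. q n \<in> Q" and R: "\<And>n. (q n, x n, q (Suc n)) \<in> R" and x: "range x \<subseteq> C"
  obtains \<rho> s e where "factorization (\<^bold>*) x \<rho> s e" "acc s e = pl"
proof -
  interpret semigroup_game "(\<^bold>*)" acc A B \<delta> h v\<^sub>0 .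
  have segment: "(q i, segment_product (\<^bold>*) x i j, q j) \<in> R" if "i < j" for i j
    using that
  proof (induction j)
    case (Suc j)
    then show ?case
      using R certificate_compose[OF cert] by (cases "i = j") (auto simp: segment_product_Suc)
  qed simp
  obtain \<rho> s e p where f: "factorization (\<^bold>*) x \<rho> s e" and p: "\<And>i. q (\<rho> (Suc i)) = p"
    using factorization_exists_state[OF x, of Q q] certificate_finite[OF cert] q(2) by blast
  then have \<rho>: "\<rho> 0 = 0" "\<rho> i < \<rho> (Suc i)" "segment_product (\<^bold>*) x (\<rho> i) (\<rho> (Suc i)) = lasso s e i" for i
    by (simp_all add: factorization_def strict_mono_less)
  have "(q\<^sub>0, s, p) \<in> R" "(p, e, p) \<in> R"
    using segment[OF \<rho>(2)[of 0]] segment[OF \<rho>(2)[of 1]] \<rho>(3)[of 0] \<rho>(3)[of 1] p[of 0] p[of 1]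
    by (simp_all add: \<rho>(1) q(1))
  then have "acc s e = pl" using certificate_acc[OF cert] f unfolding factorization_def by blast
  with f show ?thesis by (rule that)
qed

subsection \<open>Existence of certificates\<close>

locale finite_game = finite_semigroup mul C + semigroup_game mul acc A B \<delta> h v\<^sub>0
  for mul :: "'s \<Rightarrow> 's \<Rightarrow> 's" (infixl \<open>\<^bold>*\<close> 70) and C :: "'s set" and acc :: "'s \<Rightarrow> 's \<Rightarrow> bool"
    and A :: "'a set" and B :: "'b set"
    and \<delta> :: "'v \<Rightarrow> 'a \<Rightarrow> 'b \<Rightarrow> 'v" and h :: "'v \<Rightarrow> 'a \<Rightarrow> 'b \<Rightarrow> 's" and v\<^sub>0 :: 'v +
  fixes V :: "'v set" and H :: "'s set"
  assumes finite_A: "finite A" and A_nonempty: "A \<noteq> {}" and B_nonempty: "B \<noteq> {}"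
    and finite_V: "finite V" and v\<^sub>0: "v\<^sub>0 \<in> V"
    and \<delta>_closed: "v \<in> V \<Longrightarrow> a \<in> A \<Longrightarrow> b \<in> B \<Longrightarrow> \<delta> v a b \<in> V"
    and H_subset: "H \<subseteq> C" and h_value: "v \<in> V \<Longrightarrow> a \<in> A \<Longrightarrow> b \<in> B \<Longrightarrow> h v a b \<in> H"
    and invariant: "factorization_invariant H acc"
begin

definition next_state :: "'v \<times> 's list \<times> nat \<Rightarrow> 'a \<Rightarrow> 'b \<Rightarrow> 'v \<times> 's list \<times> nat" where
  "next_state s a b = (\<delta> (fst s) a b,
     next_profile (h (fst s) a b) (fst (snd s)), profile_colour (h (fst s) a b) (fst (snd s)))"

definition profiles :: "'s list set" where
  "profiles = {profile x k |x k. range x \<subseteq> C}"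

definition states :: "('v \<times> 's list \<times> nat) set" where
  "states = V \<times> profiles \<times> {..card C * card (C \<times> C)}"

definition initial_state :: "'v \<times> 's list \<times> nat" where
  "initial_state = (v\<^sub>0, [], 0)"

definition edges :: "((('v \<times> 's list \<times> nat) \<times> 'a option) \<times> (('v \<times> 's list \<times> nat) \<times> 'a option)) set" where
  "edges = {(v, u). case snd v of None \<Rightarrow> \<exists>a\<in>A. u = (fst v, Some a)
     | Some a \<Rightarrow> \<exists>b\<in>B. u = (next_state (fst v) a b, None)}"

definition vertices :: "(('v \<times> 's list \<times> nat) \<times> 'a option) set" where
  "vertices = states \<times> insert None (Some ` A)"

interpretation parity_game edges "\<lambda>v. snd v \<noteq> None" "\<lambda>v. snd (snd (fst v))" "good_colour H acc" .

lemma edges_None: "((s, None), u) \<in> edges \<longleftrightarrow> (\<exists>a\<in>A. u = (s, Some a))"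
  and edges_Some: "((s, Some a), u) \<in> edges \<longleftrightarrow> (\<exists>b\<in>B. u = (next_state s a b, None))"
  by (simp_all add: edges_def)

lemma finite_profiles: "finite profiles"
proof (rule finite_subset)
  show "profiles \<subseteq> {ps. set ps \<subseteq> C \<and> length ps \<le> card C}"
    using set_profile length_profile unfolding profiles_def by blast
  show "finite {ps. set ps \<subseteq> C \<and> length ps \<le> card C}" using finite_carrier by (rule finite_lists_length_le)
qed

lemma profiles_step:
  assumes "ps \<in> profiles" "g \<in> C"
  shows "next_profile g ps \<in> profiles" "profile_colour g ps \<le> card C * card (C \<times> C)"
proof -
  obtain x k where x: "range x \<subseteq> C" "ps = profile x k" using assms(1) by (auto simp: profiles_def)
  define y where "y = x(k := g)"
  have y: "range y \<subseteq> C" using x(1) assms(2) by (auto simp: y_def)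
  have ps: "ps = profile y k" unfolding x(2) by (rule profile_cong) (simp add: y_def)
  then have "next_profile g ps = profile y (Suc k)" "profile_colour g ps = colour y k"
    by (simp_all add: profile_Suc colour_def y_def)
  then show "next_profile g ps \<in> profiles" "profile_colour g ps \<le> card C * card (C \<times> C)"
    using y colour_le[OF y] by (auto simp: profiles_def)
qed

lemma next_state_states:
  assumes "s \<in> states" "a \<in> A" "b \<in> B"
  shows "next_state s a b \<in> states"
proof -
  have "fst s \<in> V" "fst (snd s) \<in> profiles" using assms(1) by (auto simp: states_def)
  moreover from this have "h (fst s) a b \<in> C" using h_value[OF _ assms(2,3)] H_subset by blast
  ultimately show ?thesis
    using profiles_step \<delta>_closed assms by (simp add: states_def next_state_def)
qed

lemma initial_state: "initial_state \<in> states"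
proof -
  obtain a b where "a \<in> A" "b \<in> B" using A_nonempty B_nonempty by auto
  then have "h v\<^sub>0 a b \<in> C" using h_value[OF v\<^sub>0] H_subset by blast
  then have "[] \<in> profiles"
    unfolding profiles_def by (intro CollectI exI[of _ "\<lambda>_. h v\<^sub>0 a b"] exI[of _ 0]) auto
  then show ?thesis using v\<^sub>0 by (simp add: initial_state_def states_def)
qed

lemma determined_vertices: "determined vertices"
proof (rule parity_determined)
  show "finite vertices"
    using finite_V finite_A finite_profiles by (simp add: vertices_def states_def)
  show "arena vertices" unfolding arena_def
  proof
    fix v assume "v \<in> vertices"
    then obtain s m where v: "v = (s, m)" "s \<in> states" "m \<in> insert None (Some ` A)"
      by (auto simp: vertices_def)
    obtain a b where ab: "a \<in> A" "b \<in> B" using A_nonempty B_nonempty by auto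
    show "\<exists>u\<in>vertices. (v, u) \<in> edges"
    proof (cases m)
      case None
      then show ?thesis using v ab by (intro bexI[of _ "(s, Some a)"]) (simp_all add: vertices_def edges_None)
    next
      case (Some a)
      then show ?thesis using v ab(2) next_state_states[of s a b]
        by (intro bexI[of _ "(next_state s a b, None)"]) (auto simp: vertices_def edges_Some)
    qed
  qed
qed

definition transitions ::
    "((('v \<times> 's list \<times> nat) \<times> 'a option) \<times> (('v \<times> 's list \<times> nat) \<times> 'a option)) set \<Rightarrow>
     (('v \<times> 's list \<times> nat) \<times> 's \<times> ('v \<times> 's list \<times> nat)) set" where
  "transitions F = {(s, h (fst s) a b, next_state s a b) |s a b. a \<in> A \<and> b \<in> B \<and>
     ((s, None), (s, Some a)) \<in> F \<and> ((s, Some a), (next_state s a b, None)) \<in> F}"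

lemma transition_path_winner:
  assumes path: "\<And>n. (s n, y n, s (Suc n)) \<in> transitions F" and F: "\<And>p. path F p \<Longrightarrow> path_winner p = pl"
    and start: "s 0 = initial_state"
  shows "good_colour H acc (least_recurrent (colour y)) = pl"
proof -
  have "\<exists>a b. y n = h (fst (s n)) a b \<and> s (Suc n) = next_state (s n) a b \<and>
      ((s n, None), (s n, Some a)) \<in> F \<and> ((s n, Some a), (s (Suc n), None)) \<in> F" for n
    using path[of n] unfolding transitions_def mem_Collect_eq prod.inject by metis
  then obtain a b where ab: "\<And>n. y n = h (fst (s n)) (a n) (b n)" "\<And>n. s (Suc n) = next_state (s n) (a n) (b n)"
    and moves: "\<And>n. ((s n, None), (s n, Some (a n))) \<in> F" "\<And>n. ((s n, Some (a n)), (s (Suc n), None)) \<in> F"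
    by metis
  have profile: "fst (snd (s n)) = profile y n" for n
    by (induction n) (simp_all add: start initial_state_def ab profile_Suc next_state_def)
  have colour: "snd (snd (s (Suc n))) = colour y n" for n
    using profile[of n] by (simp add: ab colour_def next_state_def)
  define p where "p n = (s (n div 2), if even n then None else Some (a (n div 2)))" for n
  have "(p n, p (Suc n)) \<in> F" for n
    using moves[of "n div 2"] by (cases "even n") (auto simp: p_def elim!: oddE)
  then have "path_winner p = pl" using F by (simp add: path_def)
  moreover have "least_recurrent (\<lambda>n. snd (snd (fst (p n)))) = least_recurrent (colour y)"
  proof -
    have "least_recurrent (\<lambda>n. snd (snd (fst (p n)))) = least_recurrent (\<lambda>n. snd (snd (s n)))"
      using least_recurrent_double[of "\<lambda>n. snd (snd (s n))"] by (simp add: p_def)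
    also have "\<dots> = least_recurrent (\<lambda>n. snd (snd (s (1 + n))))"
      using least_recurrent_shift[of "\<lambda>n. snd (snd (s n))" 1] by simp
    finally show ?thesis by (simp add: colour)
  qed
  ultimately show ?thesis by (simp add: path_winner_def)
qed

lemma transitions_states:
  assumes dom: "dominion vertices pl D F"
  shows "transitions F \<subseteq> {s. (s, None) \<in> D} \<times> H \<times> {s. (s, None) \<in> D}"
proof
  fix r assume "r \<in> transitions F"
  then obtain s a b where r: "r = (s, h (fst s) a b, next_state s a b)" "a \<in> A" "b \<in> B"
    and F: "((s, None), (s, Some a)) \<in> F" "((s, Some a), (next_state s a b, None)) \<in> F"
    by (auto simp: transitions_def)
  have D: "(s, None) \<in> D" "(next_state s a b, None) \<in> D" using F dominion_moves[OF dom] by blast+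
  then have "fst s \<in> V" using dominion_subset[OF dom] by (auto simp: vertices_def states_def)
  then show "r \<in> {s. (s, None) \<in> D} \<times> H \<times> {s. (s, None) \<in> D}" using r D h_value by simp
qed

lemma round_allowed_transitions:
  assumes dom: "dominion vertices pl D F" and "a \<in> A" "b \<in> B"
    and F: "((q, None), (q, Some a)) \<in> F" "((q, Some a), (next_state q a b, None)) \<in> F"
  shows "round_allowed fst {s. (s, None) \<in> D} (compositions (\<^bold>*) (transitions F)) q a b"
  unfolding round_allowed_def
proof (intro bexI conjI)
  show "next_state q a b \<in> {s. (s, None) \<in> D}" using F(2) dominion_moves[OF dom] by blast
  show "fst (next_state q a b) = \<delta> (fst q) a b" by (simp add: next_state_def)
  have "(q, h (fst q) a b, next_state q a b) \<in> transitions F"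
    unfolding transitions_def using assms by blast
  then show "(q, h (fst q) a b, next_state q a b) \<in> compositions (\<^bold>*) (transitions F)"
    by (rule compositions.base)
qed

lemma dominion_rounds_True:
  assumes dom: "dominion vertices True D F" and q: "(q, None) \<in> D" and a: "a \<in> A"
  shows "\<exists>b\<in>B. round_allowed fst {s. (s, None) \<in> D} (compositions (\<^bold>*) (transitions F)) q a b"
proof -
  have "q \<in> states" using q dominion_subset[OF dom] by (auto simp: vertices_def)
  then have "(q, Some a) \<in> vertices" "((q, None), (q, Some a)) \<in> edges"
    using a by (simp_all add: vertices_def edges_None)
  then have F: "((q, None), (q, Some a)) \<in> F"
    using dominion_other[OF dom q, of "(q, Some a)"] by simp
  then have "(q, Some a) \<in> D" using dominion_moves[OF dom] by blast
  then obtain u where u: "((q, Some a), u) \<in> F" using dominion_own[OF dom, of "(q, Some a)"] by auto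
  then have "((q, Some a), u) \<in> edges" using dominion_moves[OF dom] by blast
  then obtain b where "b \<in> B" "u = (next_state q a b, None)" unfolding edges_Some by blast
  then show ?thesis using round_allowed_transitions[OF dom a _ F] u by blast
qed

lemma dominion_rounds_False:
  assumes dom: "dominion vertices False D F" and q: "(q, None) \<in> D"
  shows "\<exists>a\<in>A. \<forall>b\<in>B. round_allowed fst {s. (s, None) \<in> D} (compositions (\<^bold>*) (transitions F)) q a b"
proof -
  have states: "q \<in> states" using q dominion_subset[OF dom] by (auto simp: vertices_def)
  obtain u where u: "((q, None), u) \<in> F" using dominion_own[OF dom q] by auto
  then have "((q, None), u) \<in> edges" using dominion_moves[OF dom] by blast
  then obtain a where a: "a \<in> A" "u = (q, Some a)" unfolding edges_None by blast
  have "((q, Some a), (next_state q a b, None)) \<in> F" if "b \<in> B" for b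
  proof (rule dominion_other[OF dom])
    show "(q, Some a) \<in> D" using u a(2) dominion_moves[OF dom] by blast
    show "(next_state q a b, None) \<in> vertices"
      using next_state_states[OF states a(1) that] by (simp add: vertices_def)
    show "((q, Some a), (next_state q a b, None)) \<in> edges" using that unfolding edges_Some by blast
  qed simp
  then show ?thesis using round_allowed_transitions[OF dom a(1) _ u[unfolded a(2)]] a(1) by blast
qed

theorem certificate_exists:
  "\<exists>pl Q R (q\<^sub>0 :: 'v \<times> 's list \<times> nat). certificate fst pl Q R q\<^sub>0"
proof -
  obtain D F where D: "\<And>pl. dominion vertices pl (D pl) (F pl)" "(\<Union>pl. D pl) = vertices"
    using determined_vertices unfolding determined_def by blast
  have "(initial_state, None) \<in> vertices" using initial_state by (simp add: vertices_def)
  then obtain pl where pl: "(initial_state, None) \<in> D pl" using D(2) by blast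
  note dom = D(1)[of pl]
  define Q where "Q = {s. (s, None) \<in> D pl}"
  define R where "R = compositions (\<^bold>*) (transitions (F pl))"
  have "Q \<subseteq> states" using dominion_subset[OF dom] by (auto simp: Q_def vertices_def)
  then have finite_Q: "finite Q"
    using finite_V finite_profiles finite_subset unfolding states_def by blast
  have T: "transitions (F pl) \<subseteq> Q \<times> C \<times> Q" using transitions_states[OF dom] H_subset by (auto simp: Q_def)
  then have "R \<subseteq> Q \<times> C \<times> Q" unfolding R_def by (rule compositions_subset) (rule closed)
  then have finite_R: "finite R" by (rule finite_subset) (simp add: finite_Q finite_carrier)
  have acc: "acc t e = pl" if te: "(initial_state, t, q) \<in> R" "(q, e, q) \<in> R" "linked_pair (\<^bold>*) t e" for t e q
  proof -
    obtain s y \<rho> where path: "s 0 = initial_state" "\<And>n. (s n, y n, s (Suc n)) \<in> transitions (F pl)"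
      and fac: "factorization (\<^bold>*) y \<rho> t e"
      by (rule lasso_path[OF te[unfolded R_def]]) blast
    have "range y \<subseteq> H" using path(2) transitions_states[OF dom] by blast
    from good_colour_iff_acc[OF H_subset invariant this fac]
    show ?thesis using transition_path_winner[OF path(2) dominion_path[OF dom] path(1)] by simp
  qed
  have "certificate fst pl Q R initial_state"
    unfolding certificate_def
  proof (intro conjI allI impI)
    show "initial_state \<in> Q" "fst initial_state = v\<^sub>0" using pl by (simp_all add: Q_def initial_state_def)
    show "(p, v \<^bold>* w, r) \<in> R" if "(p, v, q) \<in> R" "(q, w, r) \<in> R" for p v q w r
      using that unfolding R_def by (rule compositions.compose)
    show "if pl then \<forall>q\<in>Q. \<forall>a\<in>A. \<exists>b\<in>B. round_allowed fst Q R q a b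
        else \<forall>q\<in>Q. \<exists>a\<in>A. \<forall>b\<in>B. round_allowed fst Q R q a b"
      using dom dominion_rounds_True dominion_rounds_False unfolding Q_def R_def by (cases pl) simp_all
  qed (rule finite_Q finite_R acc; assumption)+
  then show ?thesis by blast
qed

end

section \<open>The synthesis game\<close>

subsection \<open>Checkpoints as a semigroup\<close>

lemma INFM_iff_segments:
  fixes \<rho> :: "nat \<Rightarrow> nat"
  assumes \<rho>: "strict_mono \<rho>" and "\<And>i. b \<longleftrightarrow> (\<exists>n\<in>{\<rho> i..<\<rho> (Suc i)}. P n)"
  shows "b \<longleftrightarrow> (\<exists>\<^sub>\<infinity>n. P n)"
  unfolding INFM_nat_le
proof (intro iffI allI)
  fix m assume b
  then obtain n where "n \<in> {\<rho> m..<\<rho> (Suc m)}" "P n" using assms(2) by blast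
  then show "\<exists>n\<ge>m. P n" using strict_mono_imp_increasing[OF \<rho>, of m] by (intro exI[of _ n]) simp
next
  assume "\<forall>m. \<exists>n\<ge>m. P n"
  then obtain n where n: "\<rho> 0 \<le> n" "P n" by blast
  then have "n \<in> {\<rho> (interval_index \<rho> n)..<\<rho> (Suc (interval_index \<rho> n))}"
    using nat_interval_index_bounds[OF \<rho>] by simp
  then show b using assms(2) n(2) by blast
qed

definition game_mult :: "sig_form \<Rightarrow> nat \<Rightarrow> nat \<Rightarrow> nat" where
  "game_mult \<phi> u v = \<langle>form_mult \<phi> (pfst u) (pfst v), max (psnd u) (psnd v)\<rangle>"

definition game_carrier :: "sig_form \<Rightarrow> nat set" where
  "game_carrier \<phi> = prod_encode ` (form_carrier \<phi> \<times> {..2})"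

definition game_accepts :: "sig_form \<Rightarrow> nat \<Rightarrow> nat \<Rightarrow> bool" where
  "game_accepts \<phi> s e \<longleftrightarrow> (if 2 \<le> psnd e then form_accepts \<phi> (pfst s) (pfst e) else 1 \<le> psnd e)"

lemma finite_semigroup_game_mult: "finite_semigroup (game_mult \<phi>) (game_carrier \<phi>)"
proof
  show "game_mult \<phi> (game_mult \<phi> a b) c = game_mult \<phi> a (game_mult \<phi> b c)" for a b c
    by (simp add: game_mult_def form_mult_assoc max.assoc)
  show "finite (game_carrier \<phi>)" by (simp add: game_carrier_def finite_form_carrier)
  show "game_mult \<phi> a b \<in> game_carrier \<phi>" if "a \<in> game_carrier \<phi>" "b \<in> game_carrier \<phi>" for a b
    using that by (auto simp: game_carrier_def game_mult_def form_mult_carrier)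
qed

lemma segment_product_game_mult:
  "i < j \<Longrightarrow> pfst (segment_product (game_mult \<phi>) x i j) = segment_product (form_mult \<phi>) (\<lambda>n. pfst (x n)) i j \<and>
     (k \<le> psnd (segment_product (game_mult \<phi>) x i j) \<longleftrightarrow> (\<exists>n\<in>{i..<j}. k \<le> psnd (x n)))"
proof (induction j)
  case (Suc j)
  have "{i..<Suc j} = insert j {i..<j}" using Suc.prems by auto
  then show ?case
    using Suc by (cases "i = j") (auto simp: segment_product_Suc game_mult_def le_max_iff_disj)
qed simp

lemma factorization_game_mult:
  assumes f: "factorization (game_mult \<phi>) x \<rho> s e"
  shows "factorization (form_mult \<phi>) (\<lambda>n. pfst (x n)) \<rho> (pfst s) (pfst e)"
    and "k \<le> psnd e \<longleftrightarrow> (\<exists>\<^sub>\<infinity>n. k \<le> psnd (x n))"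
proof -
  have \<rho>: "\<rho> 0 = 0" "strict_mono \<rho>" and less: "\<rho> i < \<rho> (Suc i)"
    and segment: "segment_product (game_mult \<phi>) x (\<rho> i) (\<rho> (Suc i)) = lasso s e i" for i
    using f by (simp_all add: factorization_def strict_mono_less)
  have "segment_product (form_mult \<phi>) (\<lambda>n. pfst (x n)) (\<rho> i) (\<rho> (Suc i)) = lasso (pfst s) (pfst e) i" for i
    using segment_product_game_mult[OF less[of i], of \<phi> x] segment[of i] by (cases i) simp_all
  moreover have "linked_pair (game_mult \<phi>) s e" using f by (simp add: factorization_def)
  then have "linked_pair (form_mult \<phi>) (pfst s) (pfst e)"
    unfolding linked_pair_def game_mult_def by (metis pfst_pair)
  ultimately show "factorization (form_mult \<phi>) (\<lambda>n. pfst (x n)) \<rho> (pfst s) (pfst e)"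
    using \<rho> by (simp add: factorization_def)
  show "k \<le> psnd e \<longleftrightarrow> (\<exists>\<^sub>\<infinity>n. k \<le> psnd (x n))"
  proof (rule INFM_iff_segments[of "\<lambda>i. \<rho> (Suc i)"])
    show "strict_mono (\<lambda>i. \<rho> (Suc i))" using \<rho>(2) by (simp add: strict_mono_def)
    show "k \<le> psnd e \<longleftrightarrow> (\<exists>n\<in>{\<rho> (Suc i)..<\<rho> (Suc (Suc i))}. k \<le> psnd (x n))" for i
      using segment_product_game_mult[OF less, of \<phi> x "Suc i" k] by (simp add: segment)
  qed
qed

subsection \<open>Rules of the game\<close>

text \<open>In a position \<open>\<langle>a, c\<rangle>\<close> the last input letter was \<open>a\<close>, and \<open>c = 1\<close> says that the output player has
  requested a checkpoint. The checkpoint is passed (flag \<open>2\<close>) unless the next input letter differs (flag \<open>1\<close>).\<close>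

definition round_flag :: "nat \<Rightarrow> nat \<Rightarrow> nat" where
  "round_flag v a = (if a \<noteq> pfst v then 1 else if psnd v = 1 then 2 else 0)"

definition output_moves :: "bool list list \<Rightarrow> nat set" where
  "output_moves Cout = prod_encode ` (alphabet Cout \<times> {..<2})"

definition game_move :: "nat \<Rightarrow> nat \<Rightarrow> nat \<Rightarrow> nat" where
  "game_move v a b = \<langle>a, psnd b\<rangle>"

definition game_value :: "bool list list \<Rightarrow> bool list list \<Rightarrow> sig_form \<Rightarrow> nat \<Rightarrow> nat \<Rightarrow> nat \<Rightarrow> nat" where
  "game_value Cin Cout \<phi> v a b = \<langle>form_value \<phi> (letter Cin Cout a (pfst b)), round_flag v a\<rangle>"

definition synthesis_certificate ::
    "bool list list \<Rightarrow> bool list list \<Rightarrow> mso \<Rightarrow> bool \<Rightarrow> nat set \<Rightarrow> (nat \<times> nat \<times> nat) set \<Rightarrow> nat \<Rightarrow> bool" where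
  "synthesis_certificate Cin Cout \<Psi> =
     semigroup_game.certificate (game_mult (signal_form \<Psi>)) (game_accepts (signal_form \<Psi>))
       (alphabet Cin) (output_moves Cout) game_move (game_value Cin Cout (signal_form \<Psi>)) \<langle>0, 0\<rangle> pfst"

lemma output_move_iff: "\<langle>b, of_bool c\<rangle> \<in> output_moves Cout \<longleftrightarrow> b \<in> alphabet Cout"
  by (auto simp: output_moves_def)

lemma output_move_cases:
  assumes "m \<in> output_moves Cout"
  obtains b c where "m = \<langle>b, of_bool c\<rangle>" "b \<in> alphabet Cout"
proof -
  obtain b k where "m = \<langle>b, k\<rangle>" "b \<in> alphabet Cout" "k < 2" using assms by (auto simp: output_moves_def)
  then show ?thesis using that[of b "k = 1"] by (auto simp: less_2_cases_iff)
qed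

locale synthesis_problem =
  fixes Cin Cout :: "bool list list" and \<Psi> :: mso
  assumes input_coding: "is_coding Cin" and output_coding: "is_coding Cout"
    and spec: "spec_formula Cin Cout \<Psi>"
begin

abbreviation game_certificate :: "bool \<Rightarrow> nat set \<Rightarrow> (nat \<times> nat \<times> nat) set \<Rightarrow> nat \<Rightarrow> bool" where
  "game_certificate \<equiv> synthesis_certificate Cin Cout \<Psi>"

abbreviation round_value :: "nat \<Rightarrow> nat \<Rightarrow> nat \<Rightarrow> nat" where
  "round_value \<equiv> game_value Cin Cout (signal_form \<Psi>)"

lemma zero_in_alphabets: "0 \<in> alphabet Cin" "0 \<in> alphabet Cout"
  using input_coding output_coding by (simp_all add: is_coding_def alphabet_def)

lemma round_value_carrier: "round_value v a b \<in> game_carrier (signal_form \<Psi>)"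
  by (simp add: game_value_def game_carrier_def form_value_carrier round_flag_def)

definition round_values :: "nat set" where
  "round_values = {round_value v a b |v a b. a \<in> alphabet Cin \<and> b \<in> output_moves Cout}"

lemma round_values_sequence:
  assumes "range x \<subseteq> round_values"
  obtains a b where "\<And>n. a n \<in> alphabet Cin" "\<And>n. b n \<in> alphabet Cout"
    "\<And>n. pfst (x n) = form_value (signal_form \<Psi>) (letter Cin Cout (a n) (b n))"
proof -
  have "\<exists>a b. a \<in> alphabet Cin \<and> b \<in> alphabet Cout \<and>
      pfst (x n) = form_value (signal_form \<Psi>) (letter Cin Cout a b)" for n
  proof -
    have "x n \<in> round_values" using assms by blast
    then obtain v a m where x: "x n = round_value v a m" "a \<in> alphabet Cin" "m \<in> output_moves Cout"
      unfolding round_values_def by blast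
    from x(3) obtain b c where "m = \<langle>b, of_bool c\<rangle>" "b \<in> alphabet Cout" by (rule output_move_cases)
    then show ?thesis using x by (auto simp: game_value_def)
  qed
  then show ?thesis using that by metis
qed

lemma factorization_invariant_game_accepts:
  "finite_semigroup.factorization_invariant (game_mult (signal_form \<Psi>)) round_values
     (game_accepts (signal_form \<Psi>))"
  unfolding finite_semigroup.factorization_invariant_def[OF finite_semigroup_game_mult]
proof (intro allI impI)
  fix x \<rho> s e \<rho>' s' e'
  assume "range x \<subseteq> round_values" and f: "factorization (game_mult (signal_form \<Psi>)) x \<rho> s e"
    and f': "factorization (game_mult (signal_form \<Psi>)) x \<rho>' s' e'"
  then obtain a b where ab: "\<And>n. a n \<in> alphabet Cin" "\<And>n. b n \<in> alphabet Cout"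
    and x: "\<And>n. pfst (x n) = form_value (signal_form \<Psi>) (letter Cin Cout (a n) (b n))"
    using round_values_sequence by blast
  define X where "X = glue real (\<lambda>n _. a n)"
  define Y where "Y = glue real (\<lambda>n _. b n)"
  have signals: "X \<in> signals (alphabet Cin)" "Y \<in> signals (alphabet Cout)"
    unfolding X_def Y_def using ab by (intro glue_signal time_partition_real step_on_const; simp)+
  have accepts: "form_accepts (signal_form \<Psi>) (pfst s) (pfst e) \<longleftrightarrow> Rsig_models Cin Cout \<Psi> X Y"
    if "factorization (game_mult (signal_form \<Psi>)) x \<rho> s e" for \<rho> s e
    using Rsig_models_iff_form_accepts[OF spec signals time_partition_real, of a b \<rho> "pfst s" "pfst e"]
      factorization_game_mult(1)[OF that] by (simp add: x X_def Y_def glue_eq[OF time_partition_real])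
  have "k \<le> psnd e \<longleftrightarrow> k \<le> psnd e'" for k
    using factorization_game_mult(2)[OF f] factorization_game_mult(2)[OF f'] by simp
  then have "psnd e = psnd e'" by (metis order_refl antisym)
  then show "game_accepts (signal_form \<Psi>) s e = game_accepts (signal_form \<Psi>) s' e'"
    using accepts[OF f] accepts[OF f'] by (simp add: game_accepts_def)
qed

theorem game_certificate_exists: "\<exists>pl Q R q\<^sub>0. game_certificate pl Q R q\<^sub>0"
proof -
  interpret finite_game "game_mult (signal_form \<Psi>)" "game_carrier (signal_form \<Psi>)"
    "game_accepts (signal_form \<Psi>)"
    "alphabet Cin" "output_moves Cout" game_move round_value "\<langle>0, 0\<rangle>"
    "prod_encode ` (alphabet Cin \<times> {..<2})" round_values
  proof (intro finite_game.intro finite_semigroup_game_mult finite_game_axioms.intro)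
    show "output_moves Cout \<noteq> {}" "alphabet Cin \<noteq> {}" "\<langle>0, 0\<rangle> \<in> prod_encode ` (alphabet Cin \<times> {..<2})"
      using zero_in_alphabets by (auto simp: output_moves_def lessThan_empty_iff)
    show "finite (alphabet Cin)" "finite (prod_encode ` (alphabet Cin \<times> {..<2}))"
      by (simp_all add: alphabet_def)
    show "game_move v a b \<in> prod_encode ` (alphabet Cin \<times> {..<2})"
      if "a \<in> alphabet Cin" "b \<in> output_moves Cout" for v a b
      using that by (auto simp: game_move_def output_moves_def)
    show "round_values \<subseteq> game_carrier (signal_form \<Psi>)"
      using round_value_carrier by (auto simp: round_values_def)
    show "round_value v a b \<in> round_values" if "a \<in> alphabet Cin" "b \<in> output_moves Cout" for v a b
      unfolding round_values_def using that by blast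
  qed (rule factorization_invariant_game_accepts)
  obtain pl Q R and q\<^sub>0 :: "nat \<times> nat list \<times> nat" where cert:
    "semigroup_game.certificate (game_mult (signal_form \<Psi>)) (game_accepts (signal_form \<Psi>)) (alphabet Cin)
      (output_moves Cout) game_move round_value \<langle>0, 0\<rangle> fst pl Q R q\<^sub>0"
    using certificate_exists by blast
  define g :: "nat \<times> nat list \<times> nat \<Rightarrow> nat" where "g q = \<langle>fst q, to_nat (snd q)\<rangle>" for q
  have "inj g" by (rule injI) (simp add: g_def prod_eq_iff)
  from semigroup_game.certificate_map[OF this _ cert, of pfst] show ?thesis
    unfolding synthesis_certificate_def by (auto simp: g_def)
qed

lemma game_certificate_play:
  assumes cert: "game_certificate pl Q R q\<^sub>0"
    and q: "q 0 = q\<^sub>0" "\<And>n. q n \<in> Q" and pos: "\<And>n. pfst (q (Suc n)) = \<langle>a n, of_bool (c n)\<rangle>"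
    and R: "\<And>n. (q n, round_value (pfst (q n)) (a n) \<langle>b n, of_bool (c n)\<rangle>, q (Suc n)) \<in> R"
  obtains \<rho> s e where "factorization (form_mult (signal_form \<Psi>))
      (\<lambda>n. form_value (signal_form \<Psi>) (letter Cin Cout (a n) (b n))) \<rho> s e"
    and "if \<exists>\<^sub>\<infinity>n. c n \<and> a (Suc n) = a n then form_accepts (signal_form \<Psi>) s e = pl
      else (\<exists>\<^sub>\<infinity>n. a (Suc n) \<noteq> a n) = pl"
proof -
  interpret finite_semigroup "game_mult (signal_form \<Psi>)" "game_carrier (signal_form \<Psi>)"
    by (rule finite_semigroup_game_mult)
  define x where "x n = round_value (pfst (q n)) (a n) \<langle>b n, of_bool (c n)\<rangle>" for n
  have "range x \<subseteq> game_carrier (signal_form \<Psi>)" using round_value_carrier by (auto simp: x_def)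
  then obtain \<rho> s e where f: "factorization (game_mult (signal_form \<Psi>)) x \<rho> s e"
    and acc: "game_accepts (signal_form \<Psi>) s e = pl"
    using certificate_play[OF cert[unfolded synthesis_certificate_def] q R[folded x_def]] by blast
  have flags: "k \<le> psnd e \<longleftrightarrow> (\<exists>\<^sub>\<infinity>n. k \<le> psnd (x (Suc n)))" for k
    using factorization_game_mult(2)[OF f] INFM_add_iff[of "\<lambda>n. k \<le> psnd (x n)" 1] by simp
  have flag: "psnd (x (Suc n)) = (if a (Suc n) \<noteq> a n then 1 else if c n then 2 else 0)" for n
    by (simp add: x_def game_value_def round_flag_def pos)
  have "2 \<le> psnd e \<longleftrightarrow> (\<exists>\<^sub>\<infinity>n. c n \<and> a (Suc n) = a n)"
    unfolding flags by (rule arg_cong[where f = "\<lambda>P. \<exists>\<^sub>\<infinity>n. P n"]) (auto simp: flag)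
  moreover have "1 \<le> psnd e \<longleftrightarrow> (\<exists>\<^sub>\<infinity>n. c n \<and> a (Suc n) = a n) \<or> (\<exists>\<^sub>\<infinity>n. a (Suc n) \<noteq> a n)"
    unfolding flags INFM_disj_distrib[symmetric] by (rule arg_cong[where f = "\<lambda>P. \<exists>\<^sub>\<infinity>n. P n"]) (auto simp: flag)
  ultimately show ?thesis
    using that[of \<rho> "pfst s" "pfst e"] factorization_game_mult(1)[OF f] acc
    by (auto simp: game_accepts_def x_def game_value_def split: if_splits)
qed

end

section \<open>Operators and certificates\<close>

definition synthesizable :: "bool list list \<Rightarrow> bool list list \<Rightarrow> mso \<Rightarrow> bool" where
  "synthesizable Cin Cout \<Psi> \<longleftrightarrow> (\<exists>F. C_operator (alphabet Cin) (alphabet Cout) F \<and>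
     (\<forall>X\<in>signals (alphabet Cin). Rsig_models Cin Cout \<Psi> X (F X)))"

lemma unbounded_if_infinitely_many_jumps:
  fixes \<beta> :: "nat \<Rightarrow> real"
  assumes "\<And>n. \<beta> n \<le> \<beta> (Suc n)" and jumps: "\<exists>\<^sub>\<infinity>n. \<beta> n + 1 \<le> \<beta> (Suc n)"
  shows "\<not> bdd_above (range \<beta>)"
proof
  assume "bdd_above (range \<beta>)"
  then obtain M where M: "\<And>n. \<beta> n \<le> M" by (auto simp: bdd_above_def)
  have mono: "mono \<beta>" using assms(1) by (simp add: mono_iff_le_Suc)
  have "\<exists>n. \<beta> 0 + real j \<le> \<beta> n" for j
  proof (induction j)
    case (Suc j)
    then obtain n where n: "\<beta> 0 + real j \<le> \<beta> n" by blast
    obtain k where k: "n \<le> k" "\<beta> k + 1 \<le> \<beta> (Suc k)" using jumps unfolding INFM_nat_le by blast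
    then have "\<beta> n \<le> \<beta> k" using mono by (simp add: monoD)
    then show ?case using n k by (intro exI[of _ "Suc k"]) simp
  qed auto
  moreover obtain j :: nat where "M - \<beta> 0 < real j" using reals_Archimedean2 by blast
  ultimately obtain n where "M < \<beta> n" by (smt (verit))
  with M show False by (simp add: not_le[symmetric])
qed

lemma eventually_constant_sequence:
  fixes f :: "nat \<Rightarrow> 'a"
  assumes "\<And>n. N \<le> n \<Longrightarrow> f (Suc n) = f n" "N \<le> n"
  shows "f n = f N"
  using assms(2) by (induction rule: dec_induct) (simp_all add: assms(1))

text \<open>Here \<open>\<tau>\<close> are the times of the rounds and \<open>\<beta>\<close> the times of the last passed checkpoint.\<close>

lemma bdd_above_iff_finitely_many_checkpoints:
  fixes \<tau> \<beta> :: "nat \<Rightarrow> real"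
  assumes \<tau>: "strict_mono \<tau>" and bounds: "\<And>n. \<beta> n \<le> \<tau> n" "\<And>n. \<tau> n < \<beta> n + K"
    and \<beta>: "\<And>n. \<beta> (Suc n) = (if passed n then \<tau> (Suc n) else \<beta> n)"
    and apart: "\<And>n. passed n \<Longrightarrow> \<beta> n + 1 \<le> \<tau> (Suc n)"
  shows "bdd_above (range \<tau>) \<longleftrightarrow> \<not> (\<exists>\<^sub>\<infinity>n. passed n)"
proof
  assume "bdd_above (range \<tau>)"
  then obtain M where "\<And>n. \<tau> n \<le> M" by (auto simp: bdd_above_def)
  then have "\<beta> n \<le> M" for n using bounds(1)[of n] order_trans by blast
  then have "bdd_above (range \<beta>)" by (rule bdd_aboveI2)
  moreover have "\<beta> n \<le> \<beta> (Suc n)" for n using \<beta>[of n] apart[of n] by auto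
  ultimately have no_jumps: "\<not> (\<exists>\<^sub>\<infinity>n. \<beta> n + 1 \<le> \<beta> (Suc n))"
    using unbounded_if_infinitely_many_jumps[of \<beta>] by blast
  have "\<beta> n + 1 \<le> \<beta> (Suc n)" if "passed n" for n using apart[OF that] \<beta>[of n] that by simp
  then show "\<not> (\<exists>\<^sub>\<infinity>n. passed n)" using contrapos_nn[OF no_jumps INFM_mono[of passed]] by blast
next
  assume "\<not> (\<exists>\<^sub>\<infinity>n. passed n)"
  then obtain N where N: "\<And>n. N \<le> n \<Longrightarrow> \<not> passed n" unfolding INFM_nat_le by blast
  have "\<tau> n \<le> \<beta> N + K" for n
  proof -
    have "\<beta> (max n N) = \<beta> N" by (rule eventually_constant_sequence) (simp_all add: \<beta> N)
    moreover have "\<tau> n \<le> \<tau> (max n N)" using \<tau> by (simp add: strict_mono_less_eq)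
    ultimately show ?thesis using bounds(2)[of "max n N"] by simp
  qed
  then show "bdd_above (range \<tau>)" by (rule bdd_aboveI2)
qed

lemma (in synthesis_problem) Rsig_models_play:
  assumes cert: "game_certificate pl Q R q\<^sub>0"
    and q: "q 0 = q\<^sub>0" "\<And>n. q n \<in> Q" and pos: "\<And>n. pfst (q (Suc n)) = \<langle>a n, of_bool (c n)\<rangle>"
    and R: "\<And>n. (q n, round_value (pfst (q n)) (a n) \<langle>b n, of_bool (c n)\<rangle>, q (Suc n)) \<in> R"
  shows "\<exists>\<^sub>\<infinity>n. c n \<and> a (Suc n) = a n \<Longrightarrow> X \<in> signals \<Sigma> \<Longrightarrow> Y \<in> signals \<Delta> \<Longrightarrow> time_partition \<kappa> \<Longrightarrow>
      (\<And>n t. t \<in> {\<kappa> n..<\<kappa> (Suc n)} \<Longrightarrow> X t = a n \<and> Y t = b n) \<Longrightarrow> Rsig_models Cin Cout \<Psi> X Y \<longleftrightarrow> pl"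
    and "\<not> (\<exists>\<^sub>\<infinity>n. c n \<and> a (Suc n) = a n) \<Longrightarrow> (\<exists>\<^sub>\<infinity>n. a (Suc n) \<noteq> a n) \<longleftrightarrow> pl"
proof -
  obtain \<rho> s e where f: "factorization (form_mult (signal_form \<Psi>))
      (\<lambda>n. form_value (signal_form \<Psi>) (letter Cin Cout (a n) (b n))) \<rho> s e"
    and win: "if \<exists>\<^sub>\<infinity>n. c n \<and> a (Suc n) = a n then form_accepts (signal_form \<Psi>) s e = pl
      else (\<exists>\<^sub>\<infinity>n. a (Suc n) \<noteq> a n) = pl"
    by (rule game_certificate_play[OF assms]) blast
  show "Rsig_models Cin Cout \<Psi> X Y \<longleftrightarrow> pl" if inf: "\<exists>\<^sub>\<infinity>n. c n \<and> a (Suc n) = a n"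
    and "X \<in> signals \<Sigma>" "Y \<in> signals \<Delta>" "time_partition \<kappa>"
    and "\<And>n t. t \<in> {\<kappa> n..<\<kappa> (Suc n)} \<Longrightarrow> X t = a n \<and> Y t = b n"
    using Rsig_models_iff_form_accepts[OF spec that(2-5) f] win inf by simp
  show "(\<exists>\<^sub>\<infinity>n. a (Suc n) \<noteq> a n) \<longleftrightarrow> pl" if "\<not> (\<exists>\<^sub>\<infinity>n. c n \<and> a (Suc n) = a n)"
    using win that by simp
qed

subsection \<open>The operator of a strategy for the output player\<close>

text \<open>The next tick is the next change of the input, but at most halfway to the deadline, which is
  two time units after the last passed checkpoint. So passed checkpoints are at least one time unit apart, and
  an input that prevents all further checkpoints changes infinitely often before the deadline.\<close>

locale output_strategy = synthesis_problem +
  fixes Q R q\<^sub>0 and reply :: "nat \<Rightarrow> nat \<Rightarrow> nat" and requests :: "nat \<Rightarrow> nat \<Rightarrow> bool"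
    and advance :: "nat \<Rightarrow> nat \<Rightarrow> nat"
  assumes certificate: "game_certificate True Q R q\<^sub>0" and initial: "q\<^sub>0 \<in> Q"
    and response: "q \<in> Q \<Longrightarrow> a \<in> alphabet Cin \<Longrightarrow> reply q a \<in> alphabet Cout \<and> advance q a \<in> Q \<and>
      pfst (advance q a) = \<langle>a, of_bool (requests q a)\<rangle> \<and>
      (q, round_value (pfst q) a \<langle>reply q a, of_bool (requests q a)\<rangle>, advance q a) \<in> R"
begin

fun tick :: "(real \<Rightarrow> nat) \<Rightarrow> nat \<Rightarrow> real" and checkpoint :: "(real \<Rightarrow> nat) \<Rightarrow> nat \<Rightarrow> real"
  and state :: "(real \<Rightarrow> nat) \<Rightarrow> nat \<Rightarrow> nat" where
  "tick X 0 = 0"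
| "tick X (Suc n) = next_change X (tick X n) ((tick X n + checkpoint X n + 2) / 2)"
| "checkpoint X 0 = 0"
| "checkpoint X (Suc n) = (if requests (state X n) (X (tick X n)) \<and> X (tick X (Suc n)) = X (tick X n)
     then tick X (Suc n) else checkpoint X n)"
| "state X 0 = q\<^sub>0"
| "state X (Suc n) = advance (state X n) (X (tick X n))"

declare tick.simps(2) [simp del]

definition operator :: "(real \<Rightarrow> nat) \<Rightarrow> real \<Rightarrow> nat" where
  "operator X = glue (tick X) (\<lambda>n _. reply (state X n) (X (tick X n)))"

context
  fixes X :: "real \<Rightarrow> nat"
  assumes X: "X \<in> signals (alphabet Cin)"
begin

lemma step_on_input: "step_on {0..} X" and input_letter: "0 \<le> t \<Longrightarrow> X t \<in> alphabet Cin"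
  using X by (auto simp: signals_iff)

lemma tick_bounds: "0 \<le> checkpoint X n" "checkpoint X n \<le> tick X n" "tick X n < checkpoint X n + 2"
  and tick_less: "tick X n < tick X (Suc n)"
proof -
  have next_tick: "tick X n < tick X (Suc n)" "tick X (Suc n) < checkpoint X n + 2"
    if "0 \<le> checkpoint X n" "checkpoint X n \<le> tick X n" "tick X n < checkpoint X n + 2" for n
  proof -
    have "tick X n < (tick X n + checkpoint X n + 2) / 2" using that by simp
    then show "tick X n < tick X (Suc n)" "tick X (Suc n) < checkpoint X n + 2"
      using next_change_greater[OF step_on_input, of "tick X n"] next_change_le[of "tick X n" _ X] that
      unfolding tick.simps(2) by (simp, fastforce)
  qed
  have "0 \<le> checkpoint X n \<and> checkpoint X n \<le> tick X n \<and> tick X n < checkpoint X n + 2" for n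
  proof (induction n)
    case (Suc n)
    with next_tick[of n] show ?case by auto
  qed simp
  then show "0 \<le> checkpoint X n" "checkpoint X n \<le> tick X n" "tick X n < checkpoint X n + 2"
    "tick X n < tick X (Suc n)" using next_tick by blast+
qed

lemma tick_nonneg: "0 \<le> tick X n"
  using tick_bounds[of n] by linarith

lemma strict_mono_tick: "strict_mono (tick X)"
  unfolding strict_mono_Suc_iff using tick_less by blast

lemma state_in_Q: "state X n \<in> Q"
  by (induction n) (use initial response input_letter tick_nonneg in auto)

lemma input_between_ticks: "t \<in> {tick X n..<tick X (Suc n)} \<Longrightarrow> X t = X (tick X n)"
  using const_before_next_change[of "tick X n" "(tick X n + checkpoint X n + 2) / 2" t X] tick_bounds[of n]
  by (simp add: tick.simps(2))

lemma bdd_above_tick_iff: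
  "bdd_above (range (tick X)) \<longleftrightarrow>
     \<not> (\<exists>\<^sub>\<infinity>n. requests (state X n) (X (tick X n)) \<and> X (tick X (Suc n)) = X (tick X n))"
proof (rule bdd_above_iff_finitely_many_checkpoints[OF strict_mono_tick, of "checkpoint X" 2])
  fix n assume "requests (state X n) (X (tick X n)) \<and> X (tick X (Suc n)) = X (tick X n)"
  then have "\<not> tick X (Suc n) < (tick X n + checkpoint X n + 2) / 2"
    using next_change_neq[OF step_on_input tick_nonneg] tick_bounds[of n] by (auto simp: tick.simps(2))
  then show "checkpoint X n + 1 \<le> tick X (Suc n)" using tick_bounds[of n] by simp
qed (simp_all add: tick_bounds)

lemma
  shows time_partition_tick: "time_partition (tick X)"
    and operator_signal: "operator X \<in> signals (alphabet Cout)"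
    and Rsig_models_operator: "Rsig_models Cin Cout \<Psi> X (operator X)"
proof -
  let ?a = "\<lambda>n. X (tick X n)"
  have inputs: "?a n \<in> alphabet Cin" for n using input_letter tick_nonneg by blast
  note responses = response[OF state_in_Q inputs]
  note play = Rsig_models_play[OF certificate, of "state X" ?a "\<lambda>n. requests (state X n) (?a n)"
      "\<lambda>n. reply (state X n) (?a n)"]
  have "\<exists>\<^sub>\<infinity>n. requests (state X n) (?a n) \<and> ?a (Suc n) = ?a n"
  proof (rule ccontr)
    assume finitely: "\<not> ?thesis"
    then have "\<exists>\<^sub>\<infinity>n. ?a (Suc n) \<noteq> ?a n" using play(2) responses state_in_Q by simp
    moreover have "bdd_above (range (tick X))" using finitely bdd_above_tick_iff by simp
    ultimately show False
      using step_on_eventually_constant[OF step_on_input strict_mono_tick tick_nonneg]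
      by (simp add: frequently_def)
  qed
  note passed = this
  then show partition: "time_partition (tick X)"
    using bdd_above_tick_iff strict_mono_tick by (simp add: time_partition_def)
  show signal: "operator X \<in> signals (alphabet Cout)"
    unfolding operator_def by (rule glue_signal[OF partition]) (use responses step_on_const in auto)
  have "X t = ?a n \<and> operator X t = reply (state X n) (?a n)" if "t \<in> {tick X n..<tick X (Suc n)}" for n t
    using input_between_ticks[OF that] glue_eq[OF partition that] by (simp add: operator_def)
  then show "Rsig_models Cin Cout \<Psi> X (operator X)"
    using play(1)[OF _ _ _ _ passed X signal partition] responses state_in_Q by simp
qed

lemma run_cong:
  assumes "\<And>s. s \<in> {0..<r} \<Longrightarrow> X s = Y s" "tick X n < r"
  shows "tick Y n = tick X n \<and> checkpoint Y n = checkpoint X n \<and> state Y n = state X n"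
  using assms(2)
proof (induction n)
  case (Suc n)
  have less: "tick X n < r" using Suc.prems tick_less[of n] by simp
  then have IH: "tick Y n = tick X n" "checkpoint Y n = checkpoint X n" "state Y n = state X n"
    using Suc.IH by blast+
  have "next_change Y (tick X n) ((tick X n + checkpoint X n + 2) / 2) = tick X (Suc n)"
    unfolding tick.simps(2)
  proof (rule next_change_cong[OF _ less])
    show "X s = Y s" if "s \<in> {tick X n..<r}" for s using assms(1) that tick_nonneg[of n] by simp
  qed (use Suc.prems tick_bounds[of n] in \<open>simp_all add: tick.simps(2)\<close>)
  then have tick: "tick Y (Suc n) = tick X (Suc n)" by (simp add: IH tick.simps(2))
  have "X (tick X m) = Y (tick X m)" if "tick X m < r" for m
    using assms(1) that tick_nonneg by simp
  then show ?case using tick IH less Suc.prems by simp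
qed simp

end

lemma operator_causal:
  assumes "0 \<le> t" and X: "X \<in> signals (alphabet Cin)" and Y: "Y \<in> signals (alphabet Cin)"
    and agree: "\<And>s. s \<in> {0..t} \<Longrightarrow> X s = Y s"
  shows "operator X t = operator Y t"
proof -
  have t: "t \<in> {0..}" using assms(1) by simp
  obtain \<delta> a where \<delta>: "\<delta> > 0" "\<And>s. s \<in> {0..} \<inter> {t..<t+\<delta>} \<Longrightarrow> X s = a"
    using step_on_right[OF step_on_input[OF X] t] by blast
  obtain \<epsilon> b where \<epsilon>: "\<epsilon> > 0" "\<And>s. s \<in> {0..} \<inter> {t..<t+\<epsilon>} \<Longrightarrow> Y s = b"
    using step_on_right[OF step_on_input[OF Y] t] by blast
  define r where "r = t + min \<delta> \<epsilon>"
  have "t < r" using \<delta>(1) \<epsilon>(1) by (simp add: r_def)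
  have eq: "X s = Y s" if "s \<in> {0..<r}" for s
  proof (cases "s \<le> t")
    case False
    then have "X s = a" "X t = a" "Y s = b" "Y t = b"
      using that \<delta> \<epsilon> assms(1) by (simp_all add: r_def)
    then show ?thesis using agree[of t] assms(1) by simp
  qed (use agree that in simp)
  define n where "n = interval_index (tick X) t"
  have n: "t \<in> {tick X n..<tick X (Suc n)}"
    unfolding n_def by (rule time_partition_interval[OF time_partition_tick[OF X] assms(1)])
  then have run: "tick Y n = tick X n" "state Y n = state X n"
    using run_cong[OF X eq, of r n] \<open>t < r\<close> by auto
  have "t < tick Y (Suc n)"
  proof (rule ccontr)
    assume "\<not> ?thesis"
    then have "tick X (Suc n) = tick Y (Suc n)"
      using run_cong[OF Y eq[symmetric], of r "Suc n"] \<open>t < r\<close> by linarith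
    with \<open>\<not> ?thesis\<close> n show False by simp
  qed
  then have "t \<in> {tick Y n..<tick Y (Suc n)}" using n run(1) by simp
  then have "operator Y t = reply (state Y n) (Y (tick Y n))"
    unfolding operator_def by (rule glue_eq[OF time_partition_tick[OF Y]])
  moreover have "operator X t = reply (state X n) (X (tick X n))"
    unfolding operator_def by (rule glue_eq[OF time_partition_tick[OF X] n])
  moreover have "X (tick X n) = Y (tick X n)" using agree tick_nonneg[OF X] n by simp
  ultimately show ?thesis using run by simp
qed

lemma synthesizable: "synthesizable Cin Cout \<Psi>"
  unfolding synthesizable_def C_operator_def
  using operator_signal operator_causal Rsig_models_operator by (intro exI[of _ operator]) blast

end

subsection \<open>The input of a strategy for the input player\<close>

text \<open>The operator \<open>F\<close> is played against the certificate. The input changes no later than the next spontaneous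
  change of the output and strictly before one time unit after the last passed checkpoint.\<close>

locale input_strategy = synthesis_problem +
  fixes F :: "(real \<Rightarrow> nat) \<Rightarrow> real \<Rightarrow> nat" and Q R q\<^sub>0
    and challenge :: "nat \<Rightarrow> nat" and advance :: "nat \<Rightarrow> nat \<Rightarrow> bool \<Rightarrow> nat"
  assumes certificate: "game_certificate False Q R q\<^sub>0" and initial: "q\<^sub>0 \<in> Q"
    and challenge_letter: "q \<in> Q \<Longrightarrow> challenge q \<in> alphabet Cin"
    and response: "q \<in> Q \<Longrightarrow> b \<in> alphabet Cout \<Longrightarrow>
      advance q b c \<in> Q \<and> pfst (advance q b c) = \<langle>challenge q, of_bool c\<rangle> \<and>
      (q, round_value (pfst q) (challenge q) \<langle>b, of_bool c\<rangle>, advance q b c) \<in> R"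
    and F: "C_operator (alphabet Cin) (alphabet Cout) F"
begin

fun tick :: "nat \<Rightarrow> real" and checkpoint :: "nat \<Rightarrow> real" and output_change :: "nat \<Rightarrow> real"
  and state :: "nat \<Rightarrow> nat" and input :: "nat \<Rightarrow> real \<Rightarrow> nat" where
  "tick 0 = 0"
| "tick (Suc n) = (if challenge (state (Suc n)) = challenge (state n)
     then output_change n else (tick n + output_change n) / 2)"
| "checkpoint 0 = 0"
| "checkpoint (Suc n) = (if output_change n = checkpoint n + 1 \<and> challenge (state (Suc n)) = challenge (state n)
     then tick (Suc n) else checkpoint n)"
| "output_change n = next_change (F (input n)) (tick n) (checkpoint n + 1)"
| "state 0 = q\<^sub>0"
| "state (Suc n) = advance (state n) (F (input n) (tick n)) (output_change n = checkpoint n + 1)"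
| "input 0 = (\<lambda>s\<in>{0..}. challenge q\<^sub>0)"
| "input (Suc n) = (\<lambda>s. if s < tick (Suc n) then input n s else challenge (state (Suc n)))"

declare tick.simps(2) [simp del] output_change.simps [simp del]
  state.simps(2) [simp del] input.simps(2) [simp del]

abbreviation answer :: "nat \<Rightarrow> nat" where
  "answer n \<equiv> F (input n) (tick n)"

abbreviation requested :: "nat \<Rightarrow> bool" where
  "requested n \<equiv> output_change n = checkpoint n + 1"

lemma F_signal: "X \<in> signals (alphabet Cin) \<Longrightarrow> F X \<in> signals (alphabet Cout)"
  using F by (auto simp: C_operator_def)

lemma F_causal:
  "0 \<le> t \<Longrightarrow> X \<in> signals (alphabet Cin) \<Longrightarrow> Y \<in> signals (alphabet Cin) \<Longrightarrow>
     (\<And>s. s \<in> {0..t} \<Longrightarrow> X s = Y s) \<Longrightarrow> F X t = F Y t"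
  using F unfolding C_operator_def by blast

lemma next_tick:
  assumes "input n \<in> signals (alphabet Cin)" "0 \<le> tick n" "tick n < checkpoint n + 1"
  shows "tick n < output_change n" "output_change n \<le> checkpoint n + 1"
    "tick n < tick (Suc n)" "tick (Suc n) \<le> output_change n" "answer n \<in> alphabet Cout"
proof -
  have "F (input n) \<in> signals (alphabet Cout)" using assms(1) by (rule F_signal)
  then have output_step: "step_on {0..} (F (input n))" and "answer n \<in> alphabet Cout"
    using assms(2) by (auto simp: signals_iff)
  have "tick n < output_change n" "output_change n \<le> checkpoint n + 1"
    unfolding output_change.simps using next_change_greater[OF output_step] next_change_le assms by blast+
  with \<open>answer n \<in> alphabet Cout\<close> show "tick n < output_change n" "output_change n \<le> checkpoint n + 1"
    "tick n < tick (Suc n)" "tick (Suc n) \<le> output_change n" "answer n \<in> alphabet Cout"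
    by (simp_all add: tick.simps(2))
qed

lemma input_Suc_signal:
  assumes "input n \<in> signals (alphabet Cin)" "0 \<le> tick (Suc n)" "state (Suc n) \<in> Q"
  shows "input (Suc n) \<in> signals (alphabet Cin)"
proof -
  have n: "input n \<in> {0..} \<rightarrow>\<^sub>E alphabet Cin" "step_on {0..} (input n)"
    using assms(1) by (simp_all add: signals_iff)
  have "step_on {0..} (input (Suc n))"
    unfolding input.simps(2) using n(2) by (intro step_on_if_less step_on_const) (rule step_on_subset, auto)
  moreover have "input (Suc n) \<in> {0..} \<rightarrow>\<^sub>E alphabet Cin"
    unfolding input.simps(2) using n(1) challenge_letter[OF assms(3)] assms(2)
    by (auto simp: PiE_def Pi_def extensional_def)
  ultimately show ?thesis by (simp add: signals_iff)
qed

lemma play_bounds: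
  "input n \<in> signals (alphabet Cin)" "state n \<in> Q" "0 \<le> checkpoint n" "checkpoint n \<le> tick n"
  "tick n < checkpoint n + 1"
proof -
  have "input n \<in> signals (alphabet Cin) \<and> state n \<in> Q \<and> 0 \<le> checkpoint n \<and> checkpoint n \<le> tick n \<and>
      tick n < checkpoint n + 1"
  proof (induction n)
    case 0
    have "step_on {0..} (\<lambda>s\<in>{0..}. challenge q\<^sub>0)"
      by (rule step_on_cong[OF step_on_const[of _ "challenge q\<^sub>0"]]) simp
    then have "input 0 \<in> signals (alphabet Cin)" using initial challenge_letter by (simp add: signals_iff)
    then show ?case using initial by (simp del: input.simps)
  next
    case (Suc n)
    then have nonneg: "0 \<le> tick n" by linarith
    from Suc have bounds: "tick n < output_change n" "output_change n \<le> checkpoint n + 1"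
      "tick n < tick (Suc n)" "tick (Suc n) \<le> output_change n" "answer n \<in> alphabet Cout"
      using next_tick[OF _ nonneg] by blast+
    have "state (Suc n) \<in> Q" using response Suc bounds(5) by (simp add: state.simps(2))
    moreover have "input (Suc n) \<in> signals (alphabet Cin)"
      using Suc bounds(3) nonneg calculation by (intro input_Suc_signal) auto
    moreover have "tick (Suc n) < checkpoint n + 1"
      if "\<not> (requested n \<and> challenge (state (Suc n)) = challenge (state n))"
      using that bounds by (auto simp: tick.simps(2))
    ultimately show ?case using Suc bounds by auto
  qed
  then show "input n \<in> signals (alphabet Cin)" "state n \<in> Q" "0 \<le> checkpoint n" "checkpoint n \<le> tick n"
    "tick n < checkpoint n + 1" by blast+
qed

lemma tick_nonneg: "0 \<le> tick n"
  using play_bounds[of n] by linarith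

lemmas tick_bounds = next_tick[OF play_bounds(1) tick_nonneg play_bounds(5)]

lemma strict_mono_tick: "strict_mono tick"
  unfolding strict_mono_Suc_iff using tick_bounds by blast

lemma input_after_tick: "tick n \<le> s \<Longrightarrow> input n s = challenge (state n)"
  using tick_nonneg[of n] by (cases n) (simp_all add: input.simps(2))

lemma input_before_tick: "n \<le> m \<Longrightarrow> s < tick (Suc n) \<Longrightarrow> input m s = input n s"
proof (induction m rule: nat_induct_at_least)
  case (Suc m)
  then have "tick (Suc n) \<le> tick (Suc m)" using strict_mono_tick by (simp add: strict_mono_less_eq)
  with Suc show ?case by (simp add: input.simps(2))
qed simp

lemma output_between_ticks: "t \<in> {tick n..<tick (Suc n)} \<Longrightarrow> F (input n) t = answer n"
  using const_before_next_change[OF play_bounds(5), of t n "F (input n)"] tick_bounds(4)[of n]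
  by (simp add: output_change.simps)

abbreviation passed :: "nat \<Rightarrow> bool" where
  "passed n \<equiv> requested n \<and> challenge (state (Suc n)) = challenge (state n)"

lemma bdd_above_tick_iff: "bdd_above (range tick) \<longleftrightarrow> \<not> (\<exists>\<^sub>\<infinity>n. passed n)"
  by (rule bdd_above_iff_finitely_many_checkpoints[OF strict_mono_tick, of checkpoint 1])
    (simp_all add: play_bounds tick.simps(2))

lemma passed_if_input_stable:
  assumes "\<forall>\<^sub>\<infinity>n. challenge (state (Suc n)) = challenge (state n)"
  shows "\<exists>\<^sub>\<infinity>n. passed n"
proof (rule ccontr)
  assume finitely: "\<not> ?thesis"
  have "\<forall>\<^sub>\<infinity>n. challenge (state (Suc n)) = challenge (state n) \<and> \<not> requested n"
    using MOST_conjI[OF assms finitely[unfolded not_INFM]] by (rule MOST_mono) blast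
  then obtain N where N: "\<And>n. N \<le> n \<Longrightarrow> challenge (state (Suc n)) = challenge (state n)"
    "\<And>n. N \<le> n \<Longrightarrow> \<not> requested n"
    unfolding MOST_nat_le by blast
  have input: "input n = input N" if "N \<le> n" for n
  proof (rule eventually_constant_sequence[OF _ that], rule ext)
    show "input (Suc n) s = input n s" if "N \<le> n" for n s
      using input_after_tick[of n s] N(1)[OF that] tick_bounds(3)[of n] by (simp add: input.simps(2))
  qed
  have output_step: "step_on {0..} (F (input N))" using F_signal[OF play_bounds(1)] by (simp add: signals_iff)
  have "F (input N) (tick (Suc n)) \<noteq> F (input N) (tick n)" if "N \<le> n" for n
  proof -
    have "tick (Suc n) = next_change (F (input N)) (tick n) (checkpoint n + 1)"
      using N(1)[OF that] input[OF that] by (simp add: tick.simps(2) output_change.simps)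
    moreover from this have "tick (Suc n) < checkpoint n + 1"
      using N(2)[OF that] tick_bounds(2)[of n] input[OF that] by (auto simp: output_change.simps)
    ultimately show ?thesis using next_change_neq[OF output_step tick_nonneg play_bounds(5)] by metis
  qed
  then have "\<not> (\<forall>\<^sub>\<infinity>n. F (input N) (tick (Suc n)) = F (input N) (tick n))"
    unfolding MOST_nat_le by (metis max.cobounded1 max.cobounded2)
  moreover have "bdd_above (range tick)" using finitely bdd_above_tick_iff by simp
  ultimately show False using step_on_eventually_constant[OF output_step strict_mono_tick tick_nonneg] by blast
qed

definition diagonal_input :: "real \<Rightarrow> nat" where
  "diagonal_input = glue tick (\<lambda>n _. challenge (state n))"

lemma not_Rsig_models:
  "diagonal_input \<in> signals (alphabet Cin) \<and> \<not> Rsig_models Cin Cout \<Psi> diagonal_input (F diagonal_input)"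
proof -
  have pos: "pfst (state (Suc n)) = \<langle>challenge (state n), of_bool (requested n)\<rangle>"
    and R: "(state n, round_value (pfst (state n)) (challenge (state n)) \<langle>answer n, of_bool (requested n)\<rangle>,
      state (Suc n)) \<in> R" for n
    using response[OF play_bounds(2) tick_bounds(5)] unfolding state.simps(2) by blast+
  note play = Rsig_models_play[OF certificate state.simps(1) play_bounds(2) pos R]
  have passed: "\<exists>\<^sub>\<infinity>n. passed n"
  proof (rule ccontr)
    assume finitely: "\<not> ?thesis"
    then have "\<not> (\<exists>\<^sub>\<infinity>n. challenge (state (Suc n)) \<noteq> challenge (state n))" using play(2) by blast
    then have "\<forall>\<^sub>\<infinity>n. challenge (state (Suc n)) = challenge (state n)" unfolding not_INFM by simp
    from passed_if_input_stable[OF this] finitely show False by contradiction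
  qed
  then have partition: "time_partition tick"
    using bdd_above_tick_iff strict_mono_tick by (simp add: time_partition_def)
  have signal: "diagonal_input \<in> signals (alphabet Cin)"
    unfolding diagonal_input_def
    by (rule glue_signal[OF partition step_on_const]) (simp add: challenge_letter play_bounds(2))
  have XY: "diagonal_input t = challenge (state n) \<and> F diagonal_input t = answer n"
    if t: "t \<in> {tick n..<tick (Suc n)}" for n t
  proof
    have diagonal: "diagonal_input s = input n s" if "s \<in> {0..t}" for s
    proof -
      define m where "m = interval_index tick s"
      have m: "s \<in> {tick m..<tick (Suc m)}"
        unfolding m_def using that by (intro time_partition_interval[OF partition]) simp
      have "tick m < tick (Suc n)" using m that t by simp
      then have "m \<le> n" using strict_mono_tick by (simp add: strict_mono_less)
      then have "input n s = challenge (state m)" using input_before_tick[of m n s] input_after_tick m by simp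
      then show ?thesis unfolding diagonal_input_def by (simp add: glue_eq[OF partition m])
    qed
    show "diagonal_input t = challenge (state n)" unfolding diagonal_input_def by (rule glue_eq[OF partition t])
    have "F diagonal_input t = F (input n) t"
      using t tick_nonneg[of n] diagonal signal play_bounds(1) by (intro F_causal) auto
    then show "F diagonal_input t = answer n" using output_between_ticks[OF t] by simp
  qed
  show ?thesis using play(1)[OF passed signal F_signal[OF signal] partition XY] signal by blast
qed

end

subsection \<open>Certificates decide synthesizability\<close>

context synthesis_problem
begin

lemma output_strategy_exists:
  assumes cert: "game_certificate True Q R q\<^sub>0"
  obtains reply requests advance where "output_strategy Cin Cout \<Psi> Q R q\<^sub>0 reply requests advance"
proof -
  note def = synthesis_certificate_def[of Cin Cout \<Psi>]
  have response: "\<exists>b c q'. b \<in> alphabet Cout \<and> q' \<in> Q \<and> pfst q' = \<langle>a, of_bool c\<rangle> \<and>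
      (q, round_value (pfst q) a \<langle>b, of_bool c\<rangle>, q') \<in> R" if qa: "q \<in> Q" "a \<in> alphabet Cin" for q a
  proof -
    obtain m q' where "m \<in> output_moves Cout" "q' \<in> Q" "pfst q' = \<langle>a, psnd m\<rangle>"
      "(q, round_value (pfst q) a m, q') \<in> R"
      using semigroup_game.certificate_True[OF cert[unfolded def] qa]
      unfolding semigroup_game.round_allowed_def game_move_def by blast
    moreover from this(1) obtain b c where "m = \<langle>b, of_bool c\<rangle>" "b \<in> alphabet Cout" by (rule output_move_cases)
    ultimately show ?thesis by (intro exI[of _ b] exI[of _ c] exI[of _ q']) simp
  qed
  obtain reply requests advance where "\<And>q a. q \<in> Q \<Longrightarrow> a \<in> alphabet Cin \<Longrightarrow>
      reply q a \<in> alphabet Cout \<and> advance q a \<in> Q \<and>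
      pfst (advance q a) = \<langle>a, of_bool (requests q a)\<rangle> \<and>
      (q, round_value (pfst q) a \<langle>reply q a, of_bool (requests q a)\<rangle>, advance q a) \<in> R"
    using response by metis
  then have "output_strategy Cin Cout \<Psi> Q R q\<^sub>0 reply requests advance"
    using semigroup_game.certificate_initial[OF cert[unfolded def]] cert by unfold_locales auto
  then show ?thesis by (rule that)
qed

lemma input_strategy_exists:
  assumes cert: "game_certificate False Q R q\<^sub>0" and F: "C_operator (alphabet Cin) (alphabet Cout) F"
  obtains challenge advance where "input_strategy Cin Cout \<Psi> F Q R q\<^sub>0 challenge advance"
proof -
  note def = synthesis_certificate_def[of Cin Cout \<Psi>]
  have challenge: "\<exists>a\<in>alphabet Cin. \<forall>b\<in>alphabet Cout. \<forall>c. \<exists>q'. q' \<in> Q \<and> pfst q' = \<langle>a, of_bool c\<rangle> \<and>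
      (q, round_value (pfst q) a \<langle>b, of_bool c\<rangle>, q') \<in> R" if q: "q \<in> Q" for q
  proof -
    obtain a where "a \<in> alphabet Cin" and a: "\<And>m. m \<in> output_moves Cout \<Longrightarrow>
        \<exists>q'\<in>Q. pfst q' = \<langle>a, psnd m\<rangle> \<and> (q, round_value (pfst q) a m, q') \<in> R"
      using semigroup_game.certificate_False[OF cert[unfolded def] q]
      unfolding semigroup_game.round_allowed_def game_move_def by blast
    moreover have "\<exists>q'\<in>Q. pfst q' = \<langle>a, of_bool c\<rangle> \<and> (q, round_value (pfst q) a \<langle>b, of_bool c\<rangle>, q') \<in> R"
      if "b \<in> alphabet Cout" for b c
      using a[OF output_move_iff[THEN iffD2, OF that]] by (simp only: psnd_pair)
    ultimately show ?thesis by blast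
  qed
  obtain challenge advance where "\<And>q. q \<in> Q \<Longrightarrow> challenge q \<in> alphabet Cin"
    "\<And>q b c. q \<in> Q \<Longrightarrow> b \<in> alphabet Cout \<Longrightarrow> advance q b c \<in> Q \<and> pfst (advance q b c) = \<langle>challenge q, of_bool c\<rangle> \<and>
      (q, round_value (pfst q) (challenge q) \<langle>b, of_bool c\<rangle>, advance q b c) \<in> R"
    using challenge by metis
  then have "input_strategy Cin Cout \<Psi> F Q R q\<^sub>0 challenge advance"
    using semigroup_game.certificate_initial[OF cert[unfolded def]] cert F by unfold_locales auto
  then show ?thesis by (rule that)
qed

theorem synthesizable_iff_certificate:
  assumes cert: "game_certificate pl Q R q\<^sub>0"
  shows "synthesizable Cin Cout \<Psi> \<longleftrightarrow> pl"
proof (cases pl)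
  case True
  then obtain reply requests advance where "output_strategy Cin Cout \<Psi> Q R q\<^sub>0 reply requests advance"
    using output_strategy_exists cert by metis
  with True show ?thesis using output_strategy.synthesizable by blast
next
  case False
  have "\<exists>X\<in>signals (alphabet Cin). \<not> Rsig_models Cin Cout \<Psi> X (F X)"
    if F: "C_operator (alphabet Cin) (alphabet Cout) F" for F
  proof -
    obtain challenge advance where "input_strategy Cin Cout \<Psi> F Q R q\<^sub>0 challenge advance"
      using input_strategy_exists[OF _ F] cert False by metis
    from input_strategy.not_Rsig_models[OF this] show ?thesis by blast
  qed
  with False show ?thesis unfolding synthesizable_def by blast
qed

end

section \<open>Computability of the synthesis game\<close>

subsection \<open>Codes of signal formulas\<close>

abbreviation (input) code_tag :: "nat \<Rightarrow> nat" where "code_tag c \<equiv> pfst c"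
abbreviation (input) code_left :: "nat \<Rightarrow> nat" where "code_left c \<equiv> pfst (psnd c)"
abbreviation (input) code_right :: "nat \<Rightarrow> nat" where "code_right c \<equiv> psnd (psnd c)"

lemma subcode_less: "code_tag c \<noteq> 0 \<Longrightarrow> psnd c < c \<and> code_left c < c \<and> code_right c < c"
  using less_pair_right[of "pfst c" "psnd c"] pfst_le[of "psnd c"] psnd_le[of "psnd c"] by simp

abbreviation First_code :: "nat \<Rightarrow> nat \<Rightarrow> nat \<Rightarrow> nat" where "First_code x y z \<equiv> \<langle>0, \<langle>x, \<langle>y, z\<rangle>\<rangle>\<rangle>"
abbreviation Nand_code :: "nat \<Rightarrow> nat \<Rightarrow> nat" where "Nand_code c d \<equiv> \<langle>1, \<langle>c, d\<rangle>\<rangle>"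
abbreviation ExS_code :: "nat \<Rightarrow> nat \<Rightarrow> nat" where "ExS_code X c \<equiv> \<langle>2, \<langle>X, c\<rangle>\<rangle>"

primrec sig_form_encode :: "sig_form \<Rightarrow> nat" where
  "sig_form_encode (First x y z) = First_code x y z"
| "sig_form_encode (Nand \<phi> \<psi>) = Nand_code (sig_form_encode \<phi>) (sig_form_encode \<psi>)"
| "sig_form_encode (ExS X \<phi>) = ExS_code X (sig_form_encode \<phi>)"

function sig_form_decode :: "nat \<Rightarrow> sig_form" where
  "sig_form_decode c =
     (if code_tag c = 0 then First (code_left c) (pfst (code_right c)) (psnd (code_right c))
      else if code_tag c = 1 then Nand (sig_form_decode (code_left c)) (sig_form_decode (code_right c))
      else ExS (code_left c) (sig_form_decode (code_right c)))"
  by pat_completeness auto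
termination by (relation "measure id") (simp_all add: subcode_less)

declare sig_form_decode.simps [simp del]

lemma sig_form_decode_encode [simp]: "sig_form_decode (sig_form_encode \<phi>) = \<phi>"
  by (induction \<phi>) (simp_all add: sig_form_decode.simps)

lemma computable_sig_form_recursion:
  fixes F :: "sig_form \<Rightarrow> nat \<Rightarrow> nat" and G :: "nat \<Rightarrow> nat \<Rightarrow> (nat \<Rightarrow> nat \<Rightarrow> nat) \<Rightarrow> nat"
  assumes G: "\<And>f. (\<And>e c a. computable e \<Longrightarrow> computable c \<Longrightarrow> computable a \<Longrightarrow> computable (\<lambda>x. f (e x) (c x) (a x))) \<Longrightarrow>
      computable (\<lambda>z. G (pfst z) (pfst (psnd z)) (f (psnd (psnd z))))"
    and First: "\<And>c a r. code_tag c = 0 \<Longrightarrow>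
      F (First (code_left c) (pfst (code_right c)) (psnd (code_right c))) a = G c a r"
    and Nand: "\<And>N c a r. code_tag c = 1 \<Longrightarrow> a < 2 ^ N \<Longrightarrow>
      (\<And>b. b < 2 ^ N \<Longrightarrow> r (code_left c) b = F (sig_form_decode (code_left c)) b) \<Longrightarrow>
      (\<And>b. b < 2 ^ N \<Longrightarrow> r (code_right c) b = F (sig_form_decode (code_right c)) b) \<Longrightarrow>
      F (Nand (sig_form_decode (code_left c)) (sig_form_decode (code_right c))) a = G c a r"
    and ExS: "\<And>N c a r. code_tag c \<noteq> 0 \<Longrightarrow> code_tag c \<noteq> 1 \<Longrightarrow> code_left c < N \<Longrightarrow> a < 2 ^ N \<Longrightarrow>
      (\<And>b. b < 2 ^ N \<Longrightarrow> r (code_right c) b = F (sig_form_decode (code_right c)) b) \<Longrightarrow>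
      F (ExS (code_left c) (sig_form_decode (code_right c))) a = G c a r"
    and "computable f" "computable g"
  shows "computable (\<lambda>x. F (sig_form_decode (f x)) (g x))"
proof (rule computable_bounded_recursion[where F = "\<lambda>c. F (sig_form_decode c)" and G = G])
  show "computable_operator G" by (rule computable_operatorI) (rule G)
  fix N c a :: nat assume "c \<le> N" "a < 2 ^ N"
  let ?r = "\<lambda>c' a'. if c' < c \<and> a' < 2 ^ N then F (sig_form_decode c') a' else 0"
  consider "code_tag c = 0" | "code_tag c = 1" | "code_tag c \<noteq> 0" "code_tag c \<noteq> 1" by blast
  then show "F (sig_form_decode c) a = G c a ?r"
  proof cases
    case 1
    then show ?thesis using First by (simp add: sig_form_decode.simps[of c])
  next
    case 2
    then show ?thesis
      using Nand[OF 2 \<open>a < 2 ^ N\<close>, of ?r] subcode_less[of c] by (simp add: sig_form_decode.simps[of c])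
  next
    case 3
    then show ?thesis
      using ExS[OF 3 _ \<open>a < 2 ^ N\<close>, of ?r] subcode_less[of c] \<open>c \<le> N\<close> by (simp add: sig_form_decode.simps[of c])
  qed
qed (rule assms)+

subsection \<open>Computability of the semigroup of a signal formula\<close>

lemma set_encode_eq_Least:
  assumes "finite S" "P (set_encode S)" "\<And>w. P w \<Longrightarrow> S \<subseteq> set_decode w"
  shows "set_encode S = (LEAST w. P w)"
proof (rule Least_equality[symmetric])
  show "set_encode S \<le> w" if "P w" for w
    using subset_decode_imp_le[of "set_encode S" w] assms(1) assms(3)[OF that] by simp
qed (rule assms(2))

lemma finite_subset_set_decode: "finite S \<Longrightarrow> \<exists>w. S \<subseteq> set_decode w"
  by (rule exI[of _ "set_encode S"]) simp

lemma computable_form_mult [computable_intros]: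
  assumes "computable f" "computable g" "computable h"
  shows "computable (\<lambda>x. form_mult (sig_form_decode (f x)) (g x) (h x))"
proof -
  define F where "F \<phi> a = form_mult \<phi> (pfst a) (psnd a)" for \<phi> a
  define G where "G c a r =
     (if code_tag c = 0 then if pfst a = 0 then psnd a else pfst a
      else if code_tag c = 1 then
        \<langle>r (code_left c) \<langle>pfst (pfst a), pfst (psnd a)\<rangle>, r (code_right c) \<langle>psnd (pfst a), psnd (psnd a)\<rangle>\<rangle>
      else LEAST w. \<forall>i\<in>set_decode (pfst a). \<forall>j\<in>set_decode (psnd a). r (code_right c) \<langle>i, j\<rangle> \<in> set_decode w)"
    for c a and r :: "nat \<Rightarrow> nat \<Rightarrow> nat"
  have less: "\<langle>i, j\<rangle> < 2 ^ N" if "a < 2 ^ N" "i \<le> pfst a" "j \<le> psnd a" for i j a N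
    using pair_mono[OF that(2,3)] that(1) by simp
  have "computable (\<lambda>x. F (sig_form_decode (f x)) \<langle>g x, h x\<rangle>)"
  proof (rule computable_sig_form_recursion[where F = F and G = G])
    fix f :: "nat \<Rightarrow> nat \<Rightarrow> nat \<Rightarrow> nat"
    assume f: "\<And>e c a. computable e \<Longrightarrow> computable c \<Longrightarrow> computable a \<Longrightarrow> computable (\<lambda>x. f (e x) (c x) (a x))"
    have "\<exists>w. \<forall>i\<in>set_decode a. \<forall>j\<in>set_decode b. k i j \<in> set_decode w" for a b and k :: "nat \<Rightarrow> nat \<Rightarrow> nat"
      using finite_subset_set_decode[of "(\<lambda>(i, j). k i j) ` (set_decode a \<times> set_decode b)"] by auto
    then show "computable (\<lambda>z. G (pfst z) (pfst (psnd z)) (f (psnd (psnd z))))"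
      unfolding G_def by (intro computable_intros f)
  next
    fix N c a :: nat and r assume c: "code_tag c \<noteq> 0" "code_tag c \<noteq> 1" and a: "a < 2 ^ N"
      and r: "\<And>b. b < 2 ^ N \<Longrightarrow> r (code_right c) b = F (sig_form_decode (code_right c)) b"
    let ?m = "form_mult (sig_form_decode (code_right c))"
    have "r (code_right c) \<langle>i, j\<rangle> = ?m i j" if "i \<in> set_decode (pfst a)" "j \<in> set_decode (psnd a)" for i j
      using r[OF less[OF a, of i j]] that[THEN set_decode_less] by (simp add: F_def)
    then have "set_encode ((\<lambda>(i, j). ?m i j) ` (set_decode (pfst a) \<times> set_decode (psnd a))) =
        (LEAST w. \<forall>i\<in>set_decode (pfst a). \<forall>j\<in>set_decode (psnd a). r (code_right c) \<langle>i, j\<rangle> \<in> set_decode w)"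
      by (intro set_encode_eq_Least) auto
    with c show "F (ExS (code_left c) (sig_form_decode (code_right c))) a = G c a r" by (simp add: F_def G_def)
  qed (simp_all add: F_def G_def less pfst_le psnd_le computable_pair assms)
  then show ?thesis by (simp add: F_def)
qed

lemma computable_pred_linked_pair [computable_intros]:
  "computable f \<Longrightarrow> computable g \<Longrightarrow> computable h \<Longrightarrow>
     computable_pred (\<lambda>x. linked_pair (form_mult (sig_form_decode (f x))) (g x) (h x))"
  unfolding linked_pair_def by (intro computable_intros)

lemma computable_pred_form_accepts [computable_intros]:
  assumes "computable f" "computable g" "computable h"
  shows "computable_pred (\<lambda>x. form_accepts (sig_form_decode (f x)) (g x) (h x))"
proof -
  define F :: "sig_form \<Rightarrow> nat \<Rightarrow> nat" where "F \<phi> a = of_bool (form_accepts \<phi> (pfst a) (psnd a))" for \<phi> a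
  define G :: "nat \<Rightarrow> nat \<Rightarrow> (nat \<Rightarrow> nat \<Rightarrow> nat) \<Rightarrow> nat" where "G c a r = of_bool
     (if code_tag c = 0 then pfst a = 1
      else if code_tag c = 1 then \<not> (0 < r (code_left c) \<langle>pfst (pfst a), pfst (psnd a)\<rangle> \<and>
        0 < r (code_right c) \<langle>psnd (pfst a), psnd (psnd a)\<rangle>)
      else \<exists>i\<in>set_decode (pfst a). \<exists>j\<in>set_decode (psnd a).
        linked_pair (form_mult (sig_form_decode (code_right c))) i j \<and> 0 < r (code_right c) \<langle>i, j\<rangle>)" for c a r
  have less: "\<langle>i, j\<rangle> < 2 ^ N" if "a < 2 ^ N" "i \<le> pfst a" "j \<le> psnd a" for i j a N
    using pair_mono[OF that(2,3)] that(1) by simp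
  have "computable (\<lambda>x. F (sig_form_decode (f x)) \<langle>g x, h x\<rangle>)"
  proof (rule computable_sig_form_recursion[where F = F and G = G])
    fix f :: "nat \<Rightarrow> nat \<Rightarrow> nat \<Rightarrow> nat"
    assume f: "\<And>e c a. computable e \<Longrightarrow> computable c \<Longrightarrow> computable a \<Longrightarrow> computable (\<lambda>x. f (e x) (c x) (a x))"
    show "computable (\<lambda>z. G (pfst z) (pfst (psnd z)) (f (psnd (psnd z))))"
      unfolding G_def by (intro computable_intros f)
  next
    fix N c a :: nat and r assume c: "code_tag c \<noteq> 0" "code_tag c \<noteq> 1" and a: "a < 2 ^ N"
      and r: "\<And>b. b < 2 ^ N \<Longrightarrow> r (code_right c) b = F (sig_form_decode (code_right c)) b"
    have "0 < r (code_right c) \<langle>i, j\<rangle> \<longleftrightarrow> form_accepts (sig_form_decode (code_right c)) i j"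
      if "i \<in> set_decode (pfst a)" "j \<in> set_decode (psnd a)" for i j
      using r[OF less[OF a, of i j]] that[THEN set_decode_less] by (simp add: F_def)
    with c show "F (ExS (code_left c) (sig_form_decode (code_right c))) a = G c a r"
      by (simp add: F_def G_def cong: bex_cong)
  qed (simp_all add: F_def G_def less pfst_le psnd_le computable_pair assms)
  then show ?thesis by (simp add: F_def computable_pred_def)
qed

lemma in_prod_encode_Times: "a \<in> prod_encode ` (A \<times> B) \<longleftrightarrow> pfst a \<in> A \<and> psnd a \<in> B"
  by (cases a rule: pair_cases) auto

lemma in_set_encode_Pow:
  assumes "finite A"
  shows "a \<in> set_encode ` Pow A \<longleftrightarrow> set_decode a \<subseteq> A"
proof
  assume "a \<in> set_encode ` Pow A"
  then obtain B where "a = set_encode B" "B \<subseteq> A" by blast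
  then show "set_decode a \<subseteq> A" using finite_subset[OF _ assms] by simp
next
  assume "set_decode a \<subseteq> A"
  then show "a \<in> set_encode ` Pow A" by (intro image_eqI[of _ _ "set_decode a"]) simp_all
qed

lemma computable_pred_form_carrier [computable_intros]:
  assumes "computable f" "computable g"
  shows "computable_pred (\<lambda>x. g x \<in> form_carrier (sig_form_decode (f x)))"
proof -
  define F :: "sig_form \<Rightarrow> nat \<Rightarrow> nat" where "F \<phi> a = of_bool (a \<in> form_carrier \<phi>)" for \<phi> a
  define G :: "nat \<Rightarrow> nat \<Rightarrow> (nat \<Rightarrow> nat \<Rightarrow> nat) \<Rightarrow> nat" where "G c a r = of_bool
     (if code_tag c = 0 then a \<le> 2
      else if code_tag c = 1 then 0 < r (code_left c) (pfst a) \<and> 0 < r (code_right c) (psnd a)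
      else \<forall>i\<in>set_decode a. 0 < r (code_right c) i)" for c a r
  have less: "b < 2 ^ N" if "a < 2 ^ N" "b \<le> a" for a b N :: nat using that by simp
  have "computable (\<lambda>x. F (sig_form_decode (f x)) (g x))"
  proof (rule computable_sig_form_recursion[where F = F and G = G])
    fix f :: "nat \<Rightarrow> nat \<Rightarrow> nat \<Rightarrow> nat"
    assume f: "\<And>e c a. computable e \<Longrightarrow> computable c \<Longrightarrow> computable a \<Longrightarrow> computable (\<lambda>x. f (e x) (c x) (a x))"
    show "computable (\<lambda>z. G (pfst z) (pfst (psnd z)) (f (psnd (psnd z))))"
      unfolding G_def by (intro computable_intros f)
  next
    have "a \<in> {0, 1, 2} \<longleftrightarrow> a \<le> 2" for a :: nat by auto
    then show "F (First (code_left c) (pfst (code_right c)) (psnd (code_right c))) a = G c a r"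
      if "code_tag c = 0" for c a r using that by (simp add: F_def G_def)
  next
    fix N c a :: nat and r assume c: "code_tag c = 1" and a: "a < 2 ^ N"
      and "\<And>b. b < 2 ^ N \<Longrightarrow> r (code_left c) b = F (sig_form_decode (code_left c)) b"
      and "\<And>b. b < 2 ^ N \<Longrightarrow> r (code_right c) b = F (sig_form_decode (code_right c)) b"
    then show "F (Nand (sig_form_decode (code_left c)) (sig_form_decode (code_right c))) a = G c a r"
      by (simp add: F_def G_def in_prod_encode_Times less pfst_le psnd_le)
  next
    fix N c a :: nat and r assume c: "code_tag c \<noteq> 0" "code_tag c \<noteq> 1" and a: "a < 2 ^ N"
      and r: "\<And>b. b < 2 ^ N \<Longrightarrow> r (code_right c) b = F (sig_form_decode (code_right c)) b"
    have "0 < r (code_right c) i \<longleftrightarrow> i \<in> form_carrier (sig_form_decode (code_right c))"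
      if "i \<in> set_decode a" for i
      using r[OF less[OF a, of i]] set_decode_less[OF that] by (simp add: F_def)
    then show "F (ExS (code_left c) (sig_form_decode (code_right c))) a = G c a r"
      using c by (simp add: F_def G_def in_set_encode_Pow finite_form_carrier subset_eq cong: ball_cong)
  qed (rule assms)+
  then show ?thesis by (simp add: F_def computable_pred_def)
qed

lemma unset_bit_nat_eq: "unset_bit n a = a - of_bool (bit a n) * 2 ^ n" for a :: nat
proof (cases "bit a n")
  case True
  have "a = set_bit n (unset_bit n a)"
    using True by (intro bit_eqI) (auto simp: bit_set_bit_iff bit_unset_bit_iff)
  also have "\<dots> = unset_bit n a + 2 ^ n" by (simp add: set_bit_eq bit_unset_bit_iff)
  finally show ?thesis using True by simp
next
  case False
  then have "unset_bit n a = a" by (intro bit_eqI) (auto simp: bit_unset_bit_iff)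
  with False show ?thesis by simp
qed

lemma computable_set_bit [computable_intros]:
  "computable f \<Longrightarrow> computable g \<Longrightarrow> computable (\<lambda>x. set_bit (f x) (g x))"
  unfolding set_bit_eq bit_iff_odd by (intro computable_intros)

lemma computable_unset_bit [computable_intros]:
  "computable f \<Longrightarrow> computable g \<Longrightarrow> computable (\<lambda>x. unset_bit (f x) (g x))"
  unfolding unset_bit_nat_eq bit_iff_odd by (intro computable_intros)

lemma set_decode_set_bit: "set_decode (set_bit n a) = insert n (set_decode a)"
  and set_decode_unset_bit: "set_decode (unset_bit n a) = set_decode a - {n}"
  by (auto simp: set_decode_def bit_set_bit_iff bit_unset_bit_iff simp flip: bit_iff_odd)

lemma set_bit_less_power: "n < N \<Longrightarrow> a < 2 ^ N \<Longrightarrow> set_bit n a < 2 ^ N" for a :: nat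
  by (simp add: take_bit_set_bit_eq flip: take_bit_nat_eq_self_iff)

lemma unset_bit_less_power: "a < 2 ^ N \<Longrightarrow> unset_bit n a < 2 ^ N" for a :: nat
  by (simp add: unset_bit_nat_eq)

lemma finite_generated_form_mult:
  assumes "a \<in> form_carrier \<phi>" "b \<in> form_carrier \<phi>"
  shows "finite (generated (form_mult \<phi>) {a, b})"
proof (rule finite_subset[OF generated_subset finite_form_carrier])
  show "{a, b} \<subseteq> form_carrier \<phi>" using assms by simp
qed (rule form_mult_carrier)

text \<open>The restriction to the carrier guarantees that such a number exists.\<close>

definition subsemigroup_code :: "sig_form \<Rightarrow> nat \<Rightarrow> nat \<Rightarrow> nat \<Rightarrow> bool" where
  "subsemigroup_code \<phi> a b w \<longleftrightarrow> (a \<in> form_carrier \<phi> \<and> b \<in> form_carrier \<phi> \<longrightarrow> a \<in> set_decode w \<and>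
     b \<in> set_decode w \<and> (\<forall>i\<in>set_decode w. \<forall>j\<in>set_decode w. form_mult \<phi> i j \<in> set_decode w))"

lemma subsemigroup_code_generated: "subsemigroup_code \<phi> a b (set_encode (generated (form_mult \<phi>) {a, b}))"
  unfolding subsemigroup_code_def using finite_generated_form_mult[of a \<phi> b] by (auto intro: generated.intros)

lemma set_encode_generated_eq_Least:
  assumes "a \<in> form_carrier \<phi>" "b \<in> form_carrier \<phi>"
  shows "set_encode (generated (form_mult \<phi>) {a, b}) = (LEAST w. subsemigroup_code \<phi> a b w)"
proof (rule set_encode_eq_Least[OF finite_generated_form_mult[OF assms]])
  show "subsemigroup_code \<phi> a b (set_encode (generated (form_mult \<phi>) {a, b}))"
    by (rule subsemigroup_code_generated)
  show "generated (form_mult \<phi>) {a, b} \<subseteq> set_decode w" if "subsemigroup_code \<phi> a b w" for w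
    using that assms unfolding subsemigroup_code_def by (intro generated_subset) auto
qed

lemma computable_form_value [computable_intros]:
  assumes "computable f" "computable g"
  shows "computable (\<lambda>x. form_value (sig_form_decode (f x)) (set_decode (g x)))"
proof -
  define G where "G c a r =
     (if code_tag c = 0 then
        if code_left c \<in> set_decode a \<or> pfst (code_right c) \<in> set_decode a
        then if psnd (code_right c) \<in> set_decode a then 1 else 2 else 0
      else if code_tag c = 1 then \<langle>r (code_left c) a, r (code_right c) a\<rangle>
      else LEAST w. subsemigroup_code (sig_form_decode (code_right c))
        (r (code_right c) (set_bit (code_left c) a)) (r (code_right c) (unset_bit (code_left c) a)) w)"
    for c a and r :: "nat \<Rightarrow> nat \<Rightarrow> nat"
  show ?thesis
  proof (rule computable_sig_form_recursion[where F = "\<lambda>\<phi> a. form_value \<phi> (set_decode a)" and G = G])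
    fix f :: "nat \<Rightarrow> nat \<Rightarrow> nat \<Rightarrow> nat"
    assume f: "\<And>e c a. computable e \<Longrightarrow> computable c \<Longrightarrow> computable a \<Longrightarrow> computable (\<lambda>x. f (e x) (c x) (a x))"
    have "\<exists>w. subsemigroup_code \<phi> a b w" for \<phi> a b using subsemigroup_code_generated by blast
    then show "computable (\<lambda>z. G (pfst z) (pfst (psnd z)) (f (psnd (psnd z))))"
      unfolding G_def subsemigroup_code_def by (intro computable_intros f)
  next
    fix N c a :: nat and r assume c: "code_tag c \<noteq> 0" "code_tag c \<noteq> 1" and "code_left c < N" "a < 2 ^ N"
      and r: "\<And>b. b < 2 ^ N \<Longrightarrow> r (code_right c) b = form_value (sig_form_decode (code_right c)) (set_decode b)"
    then show "form_value (ExS (code_left c) (sig_form_decode (code_right c))) (set_decode a) = G c a r"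
      by (simp add: G_def set_bit_less_power unset_bit_less_power set_decode_set_bit set_decode_unset_bit
          set_encode_generated_eq_Least form_value_carrier)
  qed (simp_all add: G_def assms)
qed

lemma computable_pred_free_vars [computable_intros]:
  assumes "computable f" "computable g"
  shows "computable_pred (\<lambda>x. g x \<in> free_vars (sig_form_decode (f x)))"
proof -
  define F :: "sig_form \<Rightarrow> nat \<Rightarrow> nat" where "F \<phi> v = of_bool (v \<in> free_vars \<phi>)" for \<phi> v
  define G :: "nat \<Rightarrow> nat \<Rightarrow> (nat \<Rightarrow> nat \<Rightarrow> nat) \<Rightarrow> nat" where "G c v r = of_bool
     (if code_tag c = 0 then v = code_left c \<or> v = pfst (code_right c) \<or> v = psnd (code_right c)
      else if code_tag c = 1 then 0 < r (code_left c) v \<or> 0 < r (code_right c) v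
      else v \<noteq> code_left c \<and> 0 < r (code_right c) v)" for c v r
  have "computable (\<lambda>x. F (sig_form_decode (f x)) (g x))"
  proof (rule computable_sig_form_recursion[where F = F and G = G])
    fix f :: "nat \<Rightarrow> nat \<Rightarrow> nat \<Rightarrow> nat"
    assume f: "\<And>e c a. computable e \<Longrightarrow> computable c \<Longrightarrow> computable a \<Longrightarrow> computable (\<lambda>x. f (e x) (c x) (a x))"
    show "computable (\<lambda>z. G (pfst z) (pfst (psnd z)) (f (psnd (psnd z))))"
      unfolding G_def by (intro computable_intros f)
  qed (auto simp: F_def G_def assms)
  then show ?thesis by (simp add: F_def computable_pred_def)
qed

lemma free_vars_le_encode: "v \<in> free_vars \<phi> \<Longrightarrow> v \<le> sig_form_encode \<phi>"
proof (induction \<phi>)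
  case (First x y z)
  then show ?case
    using pfst_le[of "First_code x y z"] psnd_le[of "First_code x y z"]
      pfst_le[of "\<langle>x, \<langle>y, z\<rangle>\<rangle>"] psnd_le[of "\<langle>x, \<langle>y, z\<rangle>\<rangle>"]
      pfst_le[of "\<langle>y, z\<rangle>"] psnd_le[of "\<langle>y, z\<rangle>"] by auto
next
  case (Nand \<phi> \<psi>)
  then show ?case using subcode_less[of "sig_form_encode (Nand \<phi> \<psi>)"] by fastforce
next
  case (ExS X \<phi>)
  then show ?case using subcode_less[of "sig_form_encode (ExS X \<phi>)"] by fastforce
qed

subsection \<open>Codes of formulas of monadic second-order logic\<close>

text \<open>Every number is decoded. It is the code of a formula iff it is the code of the formula it decodes to.\<close>

function mso_decode :: "nat \<Rightarrow> mso" where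
  "mso_decode n =
     (if code_tag n = 0 then Less (code_left n) (code_right n)
      else if code_tag n = 1 then Pred (code_left n) (code_right n)
      else if code_tag n = 2 then Neg (mso_decode (psnd n))
      else if code_tag n = 3 then Conj (mso_decode (code_left n)) (mso_decode (code_right n))
      else if code_tag n = 4 then Disj (mso_decode (code_left n)) (mso_decode (code_right n))
      else if code_tag n = 5 then Ex1 (code_left n) (mso_decode (code_right n))
      else if code_tag n = 6 then All1 (code_left n) (mso_decode (code_right n))
      else if code_tag n = 7 then Ex2 (code_left n) (mso_decode (code_right n))
      else All2 (code_left n) (mso_decode (code_right n)))"
  by pat_completeness auto
termination by (relation "measure id") (simp_all add: subcode_less)

declare mso_decode.simps [simp del]

lemma mso_decode_encode [simp]: "mso_decode (mso_encode \<phi>) = \<phi>"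
  by (induction \<phi>) (simp_all add: mso_decode.simps)

lemma computable_mso_encode_decode [computable_intros]:
  assumes "computable f" shows "computable (\<lambda>x. mso_encode (mso_decode (f x)))"
proof -
  define G where "G n r =
     (if code_tag n = 0 then \<langle>0, psnd n\<rangle> else if code_tag n = 1 then \<langle>1, psnd n\<rangle>
      else if code_tag n = 2 then \<langle>2, r (psnd n)\<rangle>
      else if code_tag n < 5 then \<langle>code_tag n, \<langle>r (code_left n), r (code_right n)\<rangle>\<rangle>
      else \<langle>if code_tag n < 8 then code_tag n else 8, \<langle>code_left n, r (code_right n)\<rangle>\<rangle>)"
    for n and r :: "nat \<Rightarrow> nat"
  show ?thesis
  proof (rule computable_course_of_values[where F = "\<lambda>n. mso_encode (mso_decode n)" and G = G])
    show "computable_operator (\<lambda>n _ f. G n (\<lambda>m. f m 0))"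
    proof (rule computable_operatorI)
      fix f :: "nat \<Rightarrow> nat \<Rightarrow> nat \<Rightarrow> nat"
      assume f: "\<And>e c a. computable e \<Longrightarrow> computable c \<Longrightarrow> computable a \<Longrightarrow> computable (\<lambda>x. f (e x) (c x) (a x))"
      show "computable (\<lambda>z. G (pfst z) (\<lambda>m. f (psnd (psnd z)) m 0))"
        unfolding G_def by (intro computable_intros f)
    qed
    show "mso_encode (mso_decode n) = G n (\<lambda>m. if m < n then mso_encode (mso_decode m) else 0)" for n
      using subcode_less[of n] by (simp add: G_def mso_decode.simps[of n])
  qed (rule assms)
qed

abbreviation Not_code :: "nat \<Rightarrow> nat" where "Not_code c \<equiv> Nand_code c c"
abbreviation Ex_point_code :: "nat \<Rightarrow> nat \<Rightarrow> nat" where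
  "Ex_point_code x c \<equiv> ExS_code x (Not_code (Nand_code (First_code x x x) c))"

lemma computable_signal_form [computable_intros]:
  assumes "computable f" shows "computable (\<lambda>x. sig_form_encode (signal_form (mso_decode (f x))))"
proof -
  define G where "G n r =
     (if code_tag n = 0 then
        Not_code (First_code (2 * code_left n + 1) (2 * code_right n + 1) (2 * code_right n + 1))
      else if code_tag n = 1 then First_code (2 * code_right n + 1) (2 * code_right n + 1) (2 * code_left n)
      else if code_tag n = 2 then Not_code (r (psnd n))
      else if code_tag n = 3 then Not_code (Nand_code (r (code_left n)) (r (code_right n)))
      else if code_tag n = 4 then Nand_code (Not_code (r (code_left n))) (Not_code (r (code_right n)))
      else if code_tag n = 5 then Ex_point_code (2 * code_left n + 1) (r (code_right n))
      else if code_tag n = 6 then Not_code (Ex_point_code (2 * code_left n + 1) (Not_code (r (code_right n))))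
      else if code_tag n = 7 then ExS_code (2 * code_left n) (r (code_right n))
      else Not_code (ExS_code (2 * code_left n) (Not_code (r (code_right n)))))" for n and r :: "nat \<Rightarrow> nat"
  show ?thesis
  proof (rule computable_course_of_values[where
        F = "\<lambda>n. sig_form_encode (signal_form (mso_decode n))" and G = G])
    show "computable_operator (\<lambda>n _ f. G n (\<lambda>m. f m 0))"
    proof (rule computable_operatorI)
      fix f :: "nat \<Rightarrow> nat \<Rightarrow> nat \<Rightarrow> nat"
      assume f: "\<And>e c a. computable e \<Longrightarrow> computable c \<Longrightarrow> computable a \<Longrightarrow> computable (\<lambda>x. f (e x) (c x) (a x))"
      show "computable (\<lambda>z. G (pfst z) (\<lambda>m. f (psnd (psnd z)) m 0))"
        unfolding G_def by (intro computable_intros f)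
    qed
    show "sig_form_encode (signal_form (mso_decode n)) =
        G n (\<lambda>m. if m < n then sig_form_encode (signal_form (mso_decode m)) else 0)" for n
      using subcode_less[of n] by (simp add: G_def mso_decode.simps[of n])
  qed (rule assms)
qed

subsection \<open>Codes of lists and of alphabets\<close>

definition code_length :: "nat \<Rightarrow> nat" where
  "code_length c = length (list_decode c)"

definition code_nth :: "nat \<Rightarrow> nat \<Rightarrow> nat" where
  "code_nth c i = (if i < length (list_decode c) then list_decode c ! i else 0)"

lemma list_encode_drop:
  "list_encode (drop i (list_decode c)) = ((\<lambda>c. psnd (c - 1)) ^^ i) c"
proof (induction i arbitrary: c)
  case (Suc i)
  have "list_decode (psnd (c - 1)) = drop 1 (list_decode c)"
    using pfst_le[of 0] psnd_le[of 0] by (cases c) (simp_all add: psnd_def split: prod.split)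
  then show ?case using Suc[of "psnd (c - 1)"] by (simp add: funpow_Suc_right del: funpow.simps)
qed simp

lemma computable_list_encode_drop:
  "computable f \<Longrightarrow> computable g \<Longrightarrow> computable (\<lambda>x. list_encode (drop (f x) (list_decode (g x))))"
  unfolding list_encode_drop by (intro computable_funpow computable_intros)

lemma list_encode_eq_0_iff: "list_encode xs = 0 \<longleftrightarrow> xs = []"
  by (cases xs) auto

lemma code_length_eq_Least: "code_length c = (LEAST i. list_encode (drop i (list_decode c)) = 0)"
  unfolding list_encode_eq_0_iff code_length_def by (rule Least_equality[symmetric]) auto

lemma computable_code_length [computable_intros]: "computable f \<Longrightarrow> computable (\<lambda>x. code_length (f x))"
proof -
  assume f: "computable f"
  have "\<exists>i. list_encode (drop i (list_decode c)) = 0" for c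
    by (rule exI[of _ "length (list_decode c)"]) (simp add: list_encode_eq_0_iff)
  then show ?thesis
    unfolding code_length_eq_Least
    by (intro computable_intros computable_list_encode_drop computable_compose[OF f])
qed

lemma code_nth_eq: "code_nth c i = pfst (list_encode (drop i (list_decode c)) - 1)"
proof (cases "i < length (list_decode c)")
  case True
  then show ?thesis by (simp add: code_nth_def Cons_nth_drop_Suc[symmetric])
next
  case False
  then show ?thesis using pfst_le[of 0] by (simp add: code_nth_def)
qed

lemma computable_code_nth [computable_intros]:
  "computable f \<Longrightarrow> computable g \<Longrightarrow> computable (\<lambda>x. code_nth (f x) (g x))"
  unfolding code_nth_eq by (intro computable_intros computable_list_encode_drop)

definition coding_decode :: "nat \<Rightarrow> bool list list" where
  "coding_decode n = map (\<lambda>r. map (\<lambda>b. b = 1) (list_decode r)) (list_decode n)"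

lemma coding_decode_encode [simp]: "coding_decode (coding_encode C) = C"
  by (simp add: coding_decode_def coding_encode_def comp_def)

definition is_coding_code :: "nat \<Rightarrow> bool" where
  "is_coding_code n \<longleftrightarrow> is_coding (coding_decode n) \<and> coding_encode (coding_decode n) = n"

lemma coding_encode_decode_iff:
  "coding_encode (coding_decode n) = n \<longleftrightarrow>
     (\<forall>i<code_length n. \<forall>j<code_length (code_nth n i). code_nth (code_nth n i) j < 2)"
proof -
  have row: "list_encode (map of_bool (map (\<lambda>b. b = 1) (list_decode r))) = r \<longleftrightarrow>
      (\<forall>b\<in>set (list_decode r). b < 2)" for r
  proof -
    have "list_encode (map of_bool (map (\<lambda>b. b = 1) (list_decode r))) = r \<longleftrightarrow>
        map of_bool (map (\<lambda>b. b = 1) (list_decode r)) = list_decode r"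
      by (metis list_decode_inverse list_encode_inverse)
    also have "\<dots> \<longleftrightarrow> (\<forall>b\<in>set (list_decode r). of_bool (b = 1) = b)"
      using map_eq_conv[of "\<lambda>b. of_bool (b = 1)" "list_decode r" id] by (simp add: comp_def)
    also have "\<dots> \<longleftrightarrow> (\<forall>b\<in>set (list_decode r). b < 2)" by (auto simp: less_2_cases_iff)
    finally show ?thesis .
  qed
  have "coding_encode (coding_decode n) = n \<longleftrightarrow>
      map (\<lambda>r. list_encode (map of_bool (map (\<lambda>b. b = 1) (list_decode r)))) (list_decode n) = list_decode n"
    unfolding coding_encode_def coding_decode_def map_map comp_def
    by (metis list_decode_inverse list_encode_inverse)
  also have "\<dots> \<longleftrightarrow> (\<forall>r\<in>set (list_decode n). \<forall>b\<in>set (list_decode r). b < 2)"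
    using map_eq_conv[of _ "list_decode n" id] by (simp only: row list.map_id id_apply)
  finally show ?thesis by (simp add: all_set_conv_all_nth code_length_def code_nth_def)
qed

lemma is_coding_code_iff:
  "is_coding_code n \<longleftrightarrow> code_length n \<noteq> 0 \<and>
     (\<forall>i<code_length n. \<forall>j<code_length (code_nth n i). code_nth (code_nth n i) j < 2) \<and>
     (\<forall>i<code_length n. code_length (code_nth n i) = code_length (code_nth n 0)) \<and>
     (\<forall>i<code_length n. \<forall>j<code_length n. i \<noteq> j \<longrightarrow> code_nth n i \<noteq> code_nth n j)"
  (is "_ \<longleftrightarrow> ?nonempty \<and> ?bits \<and> ?lengths \<and> ?distinct")
proof (cases "?bits")
  case True
  then have encode: "coding_encode (coding_decode n) = n" by (simp add: coding_encode_decode_iff)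
  then have "list_decode n = map (\<lambda>w. list_encode (map of_bool w)) (coding_decode n)"
    by (metis coding_encode_def list_encode_inverse)
  moreover have "inj (\<lambda>w. list_encode (map (of_bool :: bool \<Rightarrow> nat) w))"
    by (simp add: inj_def list_encode_eq inj_map_eq_map)
  ultimately have "distinct (list_decode n) \<longleftrightarrow> distinct (coding_decode n)"
    by (auto simp: distinct_map intro: inj_on_subset)
  then have "distinct (coding_decode n) \<longleftrightarrow> ?distinct"
    by (simp add: distinct_conv_nth code_length_def code_nth_def)
  moreover have "(\<forall>w\<in>set (coding_decode n). length w = length (hd (coding_decode n))) \<longleftrightarrow> ?lengths"
    if "coding_decode n \<noteq> []"
    using that by (simp add: coding_decode_def all_set_conv_all_nth code_length_def code_nth_def hd_conv_nth)
  moreover have "coding_decode n \<noteq> [] \<longleftrightarrow> ?nonempty" by (simp add: coding_decode_def code_length_def)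
  ultimately show ?thesis using True encode unfolding is_coding_code_def is_coding_def by blast
qed (unfold is_coding_code_def coding_encode_decode_iff, blast)

lemma computable_pred_is_coding_code [computable_intros]:
  assumes "computable f" shows "computable_pred (\<lambda>x. is_coding_code (f x))"
  by (rule computable_pred_compose[OF _ assms]) (unfold is_coding_code_iff, intro computable_intros)

lemma length_coding_decode: "length (coding_decode n) = code_length n"
  by (simp add: coding_decode_def code_length_def)

lemma width_coding_decode:
  assumes "is_coding_code n"
  shows "width (coding_decode n) = code_length (code_nth n 0)"
proof -
  have "coding_decode n \<noteq> []" using assms unfolding is_coding_code_def is_coding_def by blast
  then show ?thesis by (simp add: width_def coding_decode_def code_length_def code_nth_def hd_conv_nth)
qed

lemma nth_nth_coding_decode:
  assumes "is_coding_code n" "a \<in> alphabet (coding_decode n)" "i < width (coding_decode n)"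
  shows "coding_decode n ! a ! i \<longleftrightarrow> code_nth (code_nth n a) i = 1"
proof -
  have a: "a < length (list_decode n)" using assms(2) by (simp add: alphabet_def coding_decode_def)
  then have "coding_decode n ! a \<in> set (coding_decode n)" by (simp add: coding_decode_def)
  then have "i < length (coding_decode n ! a)"
    using assms unfolding is_coding_code_def is_coding_def width_def by metis
  with a show ?thesis by (simp add: coding_decode_def code_nth_def)
qed

subsection \<open>Codes of instances and certificates\<close>

abbreviation (input) input_code :: "nat \<Rightarrow> nat" where "input_code n \<equiv> pfst n"
abbreviation (input) output_code :: "nat \<Rightarrow> nat" where "output_code n \<equiv> pfst (psnd n)"

abbreviation decoded_input :: "nat \<Rightarrow> bool list list" where "decoded_input n \<equiv> coding_decode (pfst n)"
abbreviation decoded_output :: "nat \<Rightarrow> bool list list" where "decoded_output n \<equiv> coding_decode (pfst (psnd n))"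
abbreviation decoded_formula :: "nat \<Rightarrow> mso" where "decoded_formula n \<equiv> mso_decode (psnd (psnd n))"

definition formula_code :: "nat \<Rightarrow> nat" where
  "formula_code n = sig_form_encode (signal_form (decoded_formula n))"

definition valid_instance :: "nat \<Rightarrow> bool" where
  "valid_instance n \<longleftrightarrow> is_coding_code (input_code n) \<and> is_coding_code (output_code n) \<and>
     mso_encode (decoded_formula n) = psnd (psnd n) \<and>
     spec_formula (decoded_input n) (decoded_output n) (decoded_formula n)"

lemma computable_formula_code [computable_intros]: "computable f \<Longrightarrow> computable (\<lambda>x. formula_code (f x))"
  unfolding formula_code_def by (intro computable_intros)

lemma sig_form_decode_formula_code [simp]:
  "sig_form_decode (formula_code n) = signal_form (decoded_formula n)"
  by (simp add: formula_code_def)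

lemma spec_formula_iff_free_vars:
  "spec_formula Cin Cout \<Psi> \<longleftrightarrow>
     (\<forall>v<Suc (sig_form_encode (signal_form \<Psi>)). v \<in> free_vars (signal_form \<Psi>) \<longrightarrow>
        2 dvd v \<and> v div 2 < width Cin + width Cout)"
proof -
  have "spec_formula Cin Cout \<Psi> \<longleftrightarrow>
      (\<forall>v\<in>free_vars (signal_form \<Psi>). 2 dvd v \<and> v div 2 < width Cin + width Cout)"
    unfolding free_vars_signal_form ball_Un ball_simps spec_formula_def by auto
  then show ?thesis using free_vars_le_encode[of _ "signal_form \<Psi>"] by (auto simp: less_Suc_eq_le)
qed

lemma computable_pred_valid_instance: "computable_pred valid_instance"
proof -
  have "computable_pred (\<lambda>n. is_coding_code (input_code n) \<and> is_coding_code (output_code n) \<and>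
      mso_encode (decoded_formula n) = psnd (psnd n) \<and>
      (\<forall>v<Suc (formula_code n). v \<in> free_vars (sig_form_decode (formula_code n)) \<longrightarrow> 2 dvd v \<and>
        v div 2 < code_length (code_nth (input_code n) 0) + code_length (code_nth (output_code n) 0)))"
    by (intro computable_intros)
  then show ?thesis
    by (rule computable_pred_cong)
      (auto simp: valid_instance_def spec_formula_iff_free_vars formula_code_def width_coding_decode)
qed

lemma synthesis_problem_if_valid:
  "valid_instance n \<Longrightarrow>
     synthesis_problem (decoded_input n) (decoded_output n) (decoded_formula n)"
  by (simp add: valid_instance_def synthesis_problem_def is_coding_code_def)

lemma instance_encode_iff_valid:
  "(\<exists>Cin Cout \<Psi>. n = instance_encode Cin Cout \<Psi> \<and> is_coding Cin \<and> is_coding Cout \<and>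
      spec_formula Cin Cout \<Psi> \<and> P Cin Cout \<Psi>) \<longleftrightarrow>
     valid_instance n \<and> P (decoded_input n) (decoded_output n) (decoded_formula n)"
proof
  assume "valid_instance n \<and> P (decoded_input n) (decoded_output n) (decoded_formula n)"
  moreover from this have "n = instance_encode (decoded_input n) (decoded_output n) (decoded_formula n)"
    by (simp add: valid_instance_def is_coding_code_def instance_encode_def)
  ultimately show "\<exists>Cin Cout \<Psi>. n = instance_encode Cin Cout \<Psi> \<and> is_coding Cin \<and> is_coding Cout \<and>
      spec_formula Cin Cout \<Psi> \<and> P Cin Cout \<Psi>"
    unfolding valid_instance_def is_coding_code_def by blast
qed (auto simp: valid_instance_def is_coding_code_def instance_encode_def)

definition letter_code :: "nat \<Rightarrow> nat \<Rightarrow> nat \<Rightarrow> nat" where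
  "letter_code n a b = (LEAST w.
     (\<forall>i<code_length (code_nth (input_code n) 0). code_nth (code_nth (input_code n) a) i = 1 \<longrightarrow>
        2 * i \<in> set_decode w) \<and>
     (\<forall>j<code_length (code_nth (output_code n) 0). code_nth (code_nth (output_code n) b) j = 1 \<longrightarrow>
        2 * (code_length (code_nth (input_code n) 0) + j) \<in> set_decode w))"

lemma set_decode_letter_code:
  assumes "valid_instance n" "a \<in> alphabet (decoded_input n)" "b \<in> alphabet (decoded_output n)"
  shows "set_decode (letter_code n a b) = letter (decoded_input n) (decoded_output n) a b"
proof -
  have codes: "is_coding_code (input_code n)" "is_coding_code (output_code n)"
    using assms(1) by (simp_all add: valid_instance_def)
  let ?S = "letter (decoded_input n) (decoded_output n) a b"
  have finite: "finite ?S" by (simp add: letter_def)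
  have subset: "?S \<subseteq> set_decode w \<longleftrightarrow>
      (\<forall>i<code_length (code_nth (input_code n) 0). code_nth (code_nth (input_code n) a) i = 1 \<longrightarrow>
        2 * i \<in> set_decode w) \<and>
      (\<forall>j<code_length (code_nth (output_code n) 0). code_nth (code_nth (output_code n) b) j = 1 \<longrightarrow>
        2 * (code_length (code_nth (input_code n) 0) + j) \<in> set_decode w)" for w
    using nth_nth_coding_decode[OF codes(1) assms(2)] nth_nth_coding_decode[OF codes(2) assms(3)]
    by (auto simp: letter_def width_coding_decode codes)
  have "letter_code n a b = (LEAST w. ?S \<subseteq> set_decode w)" unfolding letter_code_def subset ..
  also have "\<dots> = set_encode ?S" by (rule set_encode_eq_Least[symmetric]) (simp_all add: finite)
  finally show ?thesis using finite by simp
qed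

lemma computable_letter_code [computable_intros]:
  assumes "computable f" "computable g" "computable h"
  shows "computable (\<lambda>x. letter_code (f x) (g x) (h x))"
proof (rule computable_compose3[OF _ assms], unfold letter_code_def, intro computable_intros)
  show "\<exists>w. (\<forall>i<m. P i \<longrightarrow> 2 * i \<in> set_decode w) \<and> (\<forall>j<k. P' j \<longrightarrow> 2 * (m + j) \<in> set_decode w)"
    for m k :: nat and P P' :: "nat \<Rightarrow> bool"
    by (rule exI[of _ "set_encode {..2 * (m + k)}"]) auto
qed

definition coded_relation :: "nat \<Rightarrow> (nat \<times> nat \<times> nat) set" where
  "coded_relation r = {(p, v, q). \<langle>p, \<langle>v, q\<rangle>\<rangle> \<in> set_decode r}"

lemma coded_relation_iff: "(p, v, q) \<in> coded_relation r \<longleftrightarrow> \<langle>p, \<langle>v, q\<rangle>\<rangle> \<in> set_decode r"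
  by (simp add: coded_relation_def)

lemma all_coded_relation:
  "(\<forall>p v q. (p, v, q) \<in> coded_relation r \<longrightarrow> P p v q) \<longleftrightarrow>
     (\<forall>t\<in>set_decode r. P (pfst t) (pfst (psnd t)) (psnd (psnd t)))"
  unfolding coded_relation_iff by (metis pair_pfst_psnd pfst_pair psnd_pair)

lemma finite_coded_relation: "finite (coded_relation r)"
proof (rule finite_subset)
  show "coded_relation r \<subseteq> (\<lambda>t. (pfst t, pfst (psnd t), psnd (psnd t))) ` set_decode r"
    by (force simp: coded_relation_iff)
qed simp

lemma finite_relation_coded:
  assumes "finite R" obtains r where "coded_relation r = R"
proof -
  have "coded_relation (set_encode ((\<lambda>(p, v, q). \<langle>p, \<langle>v, q\<rangle>\<rangle>) ` R)) = R"
    using assms by (auto simp: coded_relation_iff intro: rev_image_eqI)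
  then show ?thesis by (rule that)
qed

lemma certificate_coded_relation:
  fixes mul :: "nat \<Rightarrow> nat \<Rightarrow> nat" and pos :: "nat \<Rightarrow> 'v"
    and \<delta> :: "'v \<Rightarrow> 'a \<Rightarrow> 'b \<Rightarrow> 'v" and h :: "'v \<Rightarrow> 'a \<Rightarrow> 'b \<Rightarrow> nat"
  shows "semigroup_game.certificate mul acc A B \<delta> h v\<^sub>0 pos pl (set_decode Q) (coded_relation r) q\<^sub>0 \<longleftrightarrow>
     q\<^sub>0 \<in> set_decode Q \<and> pos q\<^sub>0 = v\<^sub>0 \<and>
     (\<forall>t\<in>set_decode r. \<forall>u\<in>set_decode r. pfst u = psnd (psnd t) \<longrightarrow>
        \<langle>pfst t, \<langle>mul (pfst (psnd t)) (pfst (psnd u)), psnd (psnd u)\<rangle>\<rangle> \<in> set_decode r) \<and>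
     (if pl then \<forall>q\<in>set_decode Q. \<forall>a\<in>A. \<exists>b\<in>B.
        semigroup_game.round_allowed \<delta> h pos (set_decode Q) (coded_relation r) q a b
      else \<forall>q\<in>set_decode Q. \<exists>a\<in>A. \<forall>b\<in>B.
        semigroup_game.round_allowed \<delta> h pos (set_decode Q) (coded_relation r) q a b) \<and>
     (\<forall>t\<in>set_decode r. pfst t = q\<^sub>0 \<longrightarrow>
        (\<forall>u\<in>set_decode r. pfst u = psnd (psnd t) \<longrightarrow> psnd (psnd u) = psnd (psnd t) \<longrightarrow>
        linked_pair mul (pfst (psnd t)) (pfst (psnd u)) \<longrightarrow> acc (pfst (psnd t)) (pfst (psnd u)) = pl))"
proof -
  let ?R = "coded_relation r"
  have compose: "(\<forall>p v q w s. (p, v, q) \<in> ?R \<longrightarrow> (q, w, s) \<in> ?R \<longrightarrow> (p, mul v w, s) \<in> ?R) \<longleftrightarrow>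
      (\<forall>p v q. (p, v, q) \<in> ?R \<longrightarrow> (\<forall>q' w s. (q', w, s) \<in> ?R \<longrightarrow> q' = q \<longrightarrow> (p, mul v w, s) \<in> ?R))"
    by blast
  have accept: "(\<forall>t e q. (q\<^sub>0, t, q) \<in> ?R \<longrightarrow> (q, e, q) \<in> ?R \<longrightarrow> linked_pair mul t e \<longrightarrow> acc t e = pl) \<longleftrightarrow>
      (\<forall>p t q. (p, t, q) \<in> ?R \<longrightarrow> p = q\<^sub>0 \<longrightarrow>
        (\<forall>q' e q''. (q', e, q'') \<in> ?R \<longrightarrow> q' = q \<longrightarrow> q'' = q \<longrightarrow> linked_pair mul t e \<longrightarrow> acc t e = pl))"
    by blast
  show ?thesis
    unfolding semigroup_game.certificate_def compose accept unfolding all_coded_relation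
    by (simp add: coded_relation_iff finite_coded_relation)
qed

subsection \<open>The decision procedure\<close>

definition round_code :: "nat \<Rightarrow> nat \<Rightarrow> nat \<Rightarrow> nat \<Rightarrow> nat \<Rightarrow> nat \<Rightarrow> nat \<Rightarrow> bool" where
  "round_code n Q r q a b c \<longleftrightarrow> (\<exists>q'\<in>set_decode Q. pfst q' = \<langle>a, c\<rangle> \<and>
     \<langle>q, \<langle>\<langle>form_value (sig_form_decode (formula_code n)) (set_decode (letter_code n a b)),
       round_flag (pfst q) a\<rangle>, q'\<rangle>\<rangle> \<in> set_decode r)"

definition certifies :: "bool \<Rightarrow> nat \<Rightarrow> nat \<Rightarrow> bool" where
  "certifies pl n w \<longleftrightarrow> synthesis_certificate (decoded_input n) (decoded_output n)
     (decoded_formula n) pl (set_decode (pfst (psnd w))) (coded_relation (psnd (psnd w))) (pfst w)"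

definition certificate_check :: "bool \<Rightarrow> nat \<Rightarrow> nat \<Rightarrow> bool" where
  "certificate_check pl n w \<longleftrightarrow> (let q\<^sub>0 = pfst w; Q = pfst (psnd w); r = psnd (psnd w); c = formula_code n in
     q\<^sub>0 \<in> set_decode Q \<and> pfst q\<^sub>0 = \<langle>0, 0\<rangle> \<and>
     (\<forall>t\<in>set_decode r. \<forall>u\<in>set_decode r. pfst u = psnd (psnd t) \<longrightarrow>
        \<langle>pfst t, \<langle>game_mult (sig_form_decode c) (pfst (psnd t)) (pfst (psnd u)), psnd (psnd u)\<rangle>\<rangle> \<in> set_decode r) \<and>
     (if pl then \<forall>q\<in>set_decode Q. \<forall>a<code_length (input_code n).
        \<exists>b<code_length (output_code n). \<exists>k<2. round_code n Q r q a b k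
      else \<forall>q\<in>set_decode Q. \<exists>a<code_length (input_code n).
        \<forall>b<code_length (output_code n). \<forall>k<2. round_code n Q r q a b k) \<and>
     (\<forall>t\<in>set_decode r. pfst t = q\<^sub>0 \<longrightarrow>
        (\<forall>u\<in>set_decode r. pfst u = psnd (psnd t) \<longrightarrow> psnd (psnd u) = psnd (psnd t) \<longrightarrow>
        linked_pair (game_mult (sig_form_decode c)) (pfst (psnd t)) (pfst (psnd u)) \<longrightarrow>
        game_accepts (sig_form_decode c) (pfst (psnd t)) (pfst (psnd u)) = pl)))"

lemma computable_pred_certificate_check: "computable_pred (\<lambda>z. certificate_check pl (pfst z) (psnd z))"
  unfolding certificate_check_def Let_def round_code_def linked_pair_def game_mult_def game_accepts_def
    round_flag_def
  by (intro computable_intros)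

lemma round_allowed_iff_round_code:
  assumes "valid_instance n" "a \<in> alphabet (decoded_input n)" "b \<in> alphabet (decoded_output n)"
  shows "semigroup_game.round_allowed game_move (game_value (decoded_input n) (decoded_output n)
      (signal_form (decoded_formula n))) pfst (set_decode Q) (coded_relation r) q a \<langle>b, k\<rangle> \<longleftrightarrow>
    round_code n Q r q a b k"
  by (simp add: semigroup_game.round_allowed_def round_code_def game_move_def game_value_def coded_relation_iff
      set_decode_letter_code[OF assms])

lemma certifies_iff_check:
  assumes "valid_instance n"
  shows "certifies pl n w \<longleftrightarrow> certificate_check pl n w"
proof -
  have moves: "(\<exists>m\<in>output_moves C. P m) \<longleftrightarrow> (\<exists>b\<in>alphabet C. \<exists>k<2. P \<langle>b, k\<rangle>)"
    "(\<forall>m\<in>output_moves C. P m) \<longleftrightarrow> (\<forall>b\<in>alphabet C. \<forall>k<2. P \<langle>b, k\<rangle>)" for C and P :: "nat \<Rightarrow> bool"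
    by (auto simp: output_moves_def)
  show ?thesis
    unfolding certifies_def synthesis_certificate_def certificate_coded_relation certificate_check_def
      Let_def moves
    by (simp add: round_allowed_iff_round_code[OF assms] cong: ball_cong bex_cong)
      (simp add: alphabet_def length_coding_decode Ball_def Bex_def)
qed

lemma certificate_check_exists:
  assumes "valid_instance n"
  shows "\<exists>pl w. certificate_check pl n w"
proof -
  obtain pl Q R q\<^sub>0 where cert: "synthesis_certificate (decoded_input n) (decoded_output n)
      (decoded_formula n) pl Q R q\<^sub>0"
    using synthesis_problem.game_certificate_exists[OF synthesis_problem_if_valid[OF assms]] by blast
  then have finite: "finite Q \<and> finite R"
    unfolding synthesis_certificate_def by (rule semigroup_game.certificate_finite)
  then obtain r where "coded_relation r = R" using finite_relation_coded by blast
  then have "certifies pl n \<langle>q\<^sub>0, \<langle>set_encode Q, r\<rangle>\<rangle>" using cert finite by (simp add: certifies_def)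
  then show ?thesis using certifies_iff_check[OF assms] by blast
qed

theorem theorem5p19:
  "decidable {instance_encode Cin Cout \<Psi> | Cin Cout \<Psi>.
     is_coding Cin \<and> is_coding Cout \<and> spec_formula Cin Cout \<Psi> \<and>
     (\<exists>F. C_operator (alphabet Cin) (alphabet Cout) F \<and>
          (\<forall>X\<in>signals (alphabet Cin). Rsig_models Cin Cout \<Psi> X (F X)))}"
  unfolding synthesizable_def[symmetric]
proof (rule decidable_if_certified[OF computable_pred_valid_instance _ computable_pred_certificate_check])
  let ?A = "{instance_encode Cin Cout \<Psi> | Cin Cout \<Psi>.
     is_coding Cin \<and> is_coding Cout \<and> spec_formula Cin Cout \<Psi> \<and> synthesizable Cin Cout \<Psi>}"
  have A: "n \<in> ?A \<longleftrightarrow> valid_instance n \<and>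
      synthesizable (decoded_input n) (decoded_output n) (decoded_formula n)" for n
    using instance_encode_iff_valid by simp
  then show "?A \<subseteq> Collect valid_instance" by blast
  show "\<exists>pl w. certificate_check pl n w" if "valid_instance n" for n
    using certificate_check_exists[OF that] .
  show "n \<in> ?A \<longleftrightarrow> pl" if n: "valid_instance n" and "certificate_check pl n w" for n pl w
    using synthesis_problem.synthesizable_iff_certificate[OF synthesis_problem_if_valid[OF n]]
      that certifies_iff_check[OF n] A[of n] unfolding certifies_def by blast
qed

end
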